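(* Let $m\ge1$, $\vec{\bm c}_0,\vec{\bm c}_1\in\mathcal{C}^m$, and let $f$ be a spherical polynomial of degree $d$ on $\mathbb{R}^{2m}$. For $\vec{\bm a},\vec{\bm b}\in\mathbb{R}^{2m}$ the series $\theta^{\vec{\bm c}_0,\vec{\bm c}_1}_{\vec{\bm a},\vec{\bm b}}[f](\tau)$ converges absolutely and satisfies \[ \theta^{\vec{\bm c}_0,\vec{\bm c}_1}_{\vec{\bm a},\vec{\bm b}}[f]\Big(-\frac1\tau\Big)=(-\tau)^{m+d}e^{2\pi iB_m(\vec{\bm a},\vec{\bm b})}\,\theta^{\vec{\bm c}_0,\vec{\bm c}_1}_{-\vec{\bm b},\vec{\bm a}}[f](\tau). \]
   Context: Write points of $\mathbb{R}^{2m}$ as $\vec{\bm x}=(\bm x_1,\dots,\bm x_m)$ with $\bm x_j=(x_j,y_j)^T$. $Q_m(\vec{\bm x})=\sum_j x_jy_j$, $B_m(\vec{\bm x},\vec{\bm x}')=\sum_j(x_jy_j'+y_jx_j')$; $Q_1,B_1$ are the case $m=1$. $\Delta_m=2\sum_j\partial^2/\partial x_j\partial y_j$; a spherical polynomial of degree $d$ is a homogeneous degree-$d$ polynomial annihilated by $\Delta_m$. $\mathcal{C}=\{\bm c=(c_1,c_2)^T\in\mathbb{R}^2: Q_1(\bm c)<0,\ c_2>0\}$. $E(z)=2\int_0^ze^{-\pi u^2}du$, $E^{(k)}$ its $k$-th derivative. For $\bm c\in\mathcal{C}$: $\rho_{\bm c,k}(\bm x)=E^{(k)}(B_1(\bm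 c,\bm x)/\sqrt{-Q_1(\bm c)})$ and $\partial_{\bm c}(\bm x)=\frac{1}{\sqrt{-Q_1(\bm c)}}(c_1\partial_x+c_2\partial_y)$ acting on the coordinates of $\bm x=(x,y)^T$. For $\vec{\bm c}_0=(\bm c^{(0)}_j)_j$, $\vec{\bm c}_1=(\bm c^{(1)}_j)_j$, $p^{\vec{\bm c}_0,\vec{\bm c}_1}[f](\vec{\bm x})=\sum_{\vec\sigma\in\{0,1\}^m}(-1)^{|\vec\sigma|}\sum_{k=0}^d\frac{(-1)^k}{(4\pi)^k}\sum_{\vec k\in\mathbb{Z}^m_{\ge0},|\vec k|=k}\prod_j\frac{\rho_{\bm c_j^{(\sigma_j)},k_j}(\bm x_j)}{k_j!}\big(\prod_j\partial_{\bm c_j^{(\sigma_j)}}(\bm x_j)^{k_j}\big)f(\vec{\bm x})$. For $\tau=u+iv$ in the upper half-plane, $q=e^{2\pi i\tau}$, define $\theta^{\vec{\bm c}_0,\vec{\bm c}_1}_{\vec{\bm a},\vec{\bm b}}[f](\tau)=v^{-d/2}\sum_{\vec{\bm x}\in\vec{\bm a}+\mathbb{Z}^{2m}}p^{\vec{\bm c}_0,\vec{\bm c}_1}[f](\vec{\bm x}\sqrt v)\,q^{Q_m(\vec{\bm x})}e^{2\pi iB_m(\vec{\bm x},\vec{\bm b})}$, where $q^{\alpha}=e^{2\pi i\alpha\tau}$. *)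

theory Defs
  imports "HOL-Analysis.Analysis"
begin

text \<open>
  A point of the real space of dimension \<open>2 m\<close> is an element \<open>x\<close> of type \<open>real^2^'m\<close>, with \<open>m = CARD('m)\<close>;
  its \<open>j\<close>-th block \<open>x $ j\<close> has the coordinates \<open>x $ j $ 1\<close> (the informal \<open>x\<^sub>j\<close>) and
  \<open>x $ j $ 2\<close> (the informal \<open>y\<^sub>j\<close>).
\<close>

definition Q1 :: "real^2 \<Rightarrow> real" where
  "Q1 x = x $ 1 * x $ 2"

definition B1 :: "real^2 \<Rightarrow> real^2 \<Rightarrow> real" where
  "B1 x x' = x $ 1 * x' $ 2 + x $ 2 * x' $ 1"

definition Qm :: "real^2^'m \<Rightarrow> real" where
  "Qm x = (\<Sum>j\<in>UNIV. Q1 (x $ j))"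

definition Bm :: "real^2^'m \<Rightarrow> real^2^'m \<Rightarrow> real" where
  "Bm x x' = (\<Sum>j\<in>UNIV. B1 (x $ j) (x' $ j))"

definition cone_C :: "(real^2) set" where
  "cone_C = {c. Q1 c < 0 \<and> c $ 2 > 0}"

definition homogeneous_polynomial :: "nat \<Rightarrow> (real^2^'m \<Rightarrow> complex) \<Rightarrow> bool" where
  "homogeneous_polynomial d f \<longleftrightarrow>
     (\<exists>coef :: nat^2^'m \<Rightarrow> complex. \<forall>x.
        f x = (\<Sum>\<alpha> | (\<Sum>j\<in>UNIV. \<Sum>i\<in>UNIV. \<alpha> $ j $ i) = d.
                 coef \<alpha> * of_real (\<Prod>j\<in>UNIV. \<Prod>i\<in>UNIV. (x $ j $ i) ^ (\<alpha> $ j $ i))))"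

definition partial :: "'m \<Rightarrow> 2 \<Rightarrow> (real^2^'m \<Rightarrow> complex) \<Rightarrow> real^2^'m \<Rightarrow> complex" where
  "partial j i f x = vector_derivative (\<lambda>t. f (x + t *\<^sub>R axis j (axis i 1))) (at 0)"

definition laplacian :: "(real^2^'m \<Rightarrow> complex) \<Rightarrow> real^2^'m \<Rightarrow> complex" where
  "laplacian f x = 2 * (\<Sum>j\<in>UNIV. partial j 1 (partial j 2 f) x)"

definition spherical_polynomial :: "nat \<Rightarrow> (real^2^'m \<Rightarrow> complex) \<Rightarrow> bool" where
  "spherical_polynomial d f \<longleftrightarrow> homogeneous_polynomial d f \<and> (\<forall>x. laplacian f x = 0)"

text \<open>The interval integral is oriented, so this is the odd function \<open>E\<close> also for \<open>z < 0\<close>.\<close>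

definition E :: "real \<Rightarrow> real" where
  "E z = 2 * (LBINT u=0..z. exp (- pi * u\<^sup>2))"

definition rho :: "real^2 \<Rightarrow> nat \<Rightarrow> real^2 \<Rightarrow> real" where
  "rho c k x = (deriv ^^ k) E (B1 c x / sqrt (- Q1 c))"

definition dir_deriv :: "'m \<Rightarrow> real^2 \<Rightarrow> (real^2^'m \<Rightarrow> complex) \<Rightarrow> real^2^'m \<Rightarrow> complex" where
  "dir_deriv j c f x =
     (1 / sqrt (- Q1 c)) *\<^sub>R (c $ 1 *\<^sub>R partial j 1 f x + c $ 2 *\<^sub>R partial j 2 f x)"

text \<open>
  The product over \<open>j\<close> of the operators \<open>dir_deriv j (c $ j) ^^ (k $ j)\<close> is their composition.
  The operators commute on smooth functions, in particular on the polynomials they are applied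
  to, so the choice of the enumeration of the index type is immaterial.
\<close>

definition index_list :: "'m::finite list" where
  "index_list = (SOME js. distinct js \<and> set js = UNIV)"

definition dir_deriv_prod ::
    "real^2^'m \<Rightarrow> nat^'m \<Rightarrow> (real^2^'m \<Rightarrow> complex) \<Rightarrow> real^2^'m \<Rightarrow> complex" where
  "dir_deriv_prod c k = foldr (\<lambda>j. dir_deriv j (c $ j) ^^ (k $ j)) index_list"

definition select :: "real^2^'m \<Rightarrow> real^2^'m \<Rightarrow> nat^'m \<Rightarrow> real^2^'m" where
  "select c0 c1 \<sigma> = (\<chi> j. if \<sigma> $ j = 0 then c0 $ j else c1 $ j)"

definition p_op :: "nat \<Rightarrow> real^2^'m \<Rightarrow> real^2^'m \<Rightarrow> (real^2^'m \<Rightarrow> complex) \<Rightarrow> real^2^'m \<Rightarrow> complex"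
  where
  "p_op d c0 c1 f x =
     (\<Sum>\<sigma> | \<forall>j. \<sigma> $ j \<in> {0, 1::nat}. (-1) ^ (\<Sum>j\<in>UNIV. \<sigma> $ j) *
       (\<Sum>k = 0..d. of_real ((-1) ^ k / (4 * pi) ^ k) *
         (\<Sum>kv | (\<Sum>j\<in>UNIV. kv $ j) = k.
            of_real (\<Prod>j\<in>UNIV. rho (select c0 c1 \<sigma> $ j) (kv $ j) (x $ j) / fact (kv $ j)) *
            dir_deriv_prod (select c0 c1 \<sigma>) kv f x)))"

definition shifted_lattice :: "real^2^'m \<Rightarrow> (real^2^'m) set" where
  "shifted_lattice a = {a + n | n. \<forall>j i. n $ j $ i \<in> \<int>}"

definition theta_term ::
    "nat \<Rightarrow> real^2^'m \<Rightarrow> real^2^'m \<Rightarrow> real^2^'m \<Rightarrow> (real^2^'m \<Rightarrow> complex) \<Rightarrow> complex \<Rightarrow>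
     real^2^'m \<Rightarrow> complex" where
  "theta_term d c0 c1 b f \<tau> x =
     p_op d c0 c1 f (sqrt (Im \<tau>) *\<^sub>R x) *
     exp (2 * of_real pi * \<i> * of_real (Qm x) * \<tau>) *
     exp (2 * of_real pi * \<i> * of_real (Bm x b))"

definition theta ::
    "nat \<Rightarrow> real^2^'m \<Rightarrow> real^2^'m \<Rightarrow> real^2^'m \<Rightarrow> real^2^'m \<Rightarrow> (real^2^'m \<Rightarrow> complex) \<Rightarrow>
     complex \<Rightarrow> complex" where
  "theta d c0 c1 a b f \<tau> =
     of_real (Im \<tau> powr (- real d / 2)) *
     (\<Sum>\<^sub>\<infinity>x\<in>shifted_lattice a. theta_term d c0 c1 b f \<tau> x)"

text \<open>All finite sums above range over finite sets, so none of them degenerates to 0.\<close>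

lemma finite_vec_sum_eq: "finite {k :: nat^'m. (\<Sum>j\<in>UNIV. k $ j) = n}"
proof (rule finite_subset)
  show "{k :: nat^'m. (\<Sum>j\<in>UNIV. k $ j) = n} \<subseteq> vec_lambda ` (PiE UNIV (\<lambda>_. {..n}))"
  proof
    fix k :: "nat^'m" assume "k \<in> {k. (\<Sum>j\<in>UNIV. k $ j) = n}"
    then have "k $ j \<le> n" for j
      using member_le_sum[of j UNIV "\<lambda>j. k $ j"] by auto
    then have "vec_nth k \<in> PiE UNIV (\<lambda>_. {..n})" by auto
    then show "k \<in> vec_lambda ` (PiE UNIV (\<lambda>_. {..n}))"
      by (rule image_eqI[where f = vec_lambda, rotated]) (simp add: vec_nth_inverse)
  qed
qed (auto intro!: finite_imageI finite_PiE)

lemma finite_vec_01: "finite {\<sigma> :: nat^'m. \<forall>j. \<sigma> $ j \<in> {0, 1}}"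
proof (rule finite_subset)
  show "{\<sigma> :: nat^'m. \<forall>j. \<sigma> $ j \<in> {0, 1}} \<subseteq> vec_lambda ` (PiE UNIV (\<lambda>_. {0, 1}))"
  proof
    fix s :: "nat^'m" assume "s \<in> {\<sigma>. \<forall>j. \<sigma> $ j \<in> {0, 1}}"
    then have "vec_nth s \<in> PiE UNIV (\<lambda>_. {0, 1})" by (simp add: PiE_iff)
    then show "s \<in> vec_lambda ` (PiE UNIV (\<lambda>_. {0, 1}))"
      by (rule image_eqI[where f = vec_lambda, rotated]) (simp add: vec_nth_inverse)
  qed
qed (auto intro!: finite_imageI finite_PiE)

lemma finite_multiindex:
  "finite {\<alpha> :: nat^2^'m. (\<Sum>j\<in>UNIV. \<Sum>i\<in>UNIV. \<alpha> $ j $ i) = d}"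
proof (rule finite_subset)
  let ?S = "{k :: nat^2. \<exists>n\<le>d. (\<Sum>i\<in>UNIV. k $ i) = n}"
  have "?S = (\<Union>n\<le>d. {k :: nat^2. (\<Sum>i\<in>UNIV. k $ i) = n})" by auto
  then have fin: "finite ?S" by (simp only:) (intro finite_UN_I finite_atMost finite_vec_sum_eq)
  then show "finite ((vec_lambda :: ('m \<Rightarrow> nat^2) \<Rightarrow> nat^2^'m) ` (PiE UNIV (\<lambda>_. ?S)))"
    by (intro finite_imageI finite_PiE) auto
  show "{\<alpha> :: nat^2^'m. (\<Sum>j\<in>UNIV. \<Sum>i\<in>UNIV. \<alpha> $ j $ i) = d}
          \<subseteq> vec_lambda ` (PiE UNIV (\<lambda>_. ?S))"
  proof
    fix k :: "nat^2^'m" assume "k \<in> {\<alpha>. (\<Sum>j\<in>UNIV. \<Sum>i\<in>UNIV. \<alpha> $ j $ i) = d}"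
    then have "(\<Sum>i\<in>UNIV. k $ j $ i) \<le> d" for j
      using member_le_sum[of j UNIV "\<lambda>j. \<Sum>i\<in>UNIV. k $ j $ i"] by auto
    then have "vec_nth k \<in> PiE UNIV (\<lambda>_. ?S)" by auto
    then show "k \<in> vec_lambda ` (PiE UNIV (\<lambda>_. ?S))"
      by (rule image_eqI[where f = vec_lambda, rotated]) (simp add: vec_nth_inverse)
  qed
qed

end

theory Submission
  imports Defs "HOL-Probability.Characteristic_Functions"
begin

text \<open>
  In one block the completed sign function is a primitive: for the vectors \<open>(- exp (- s), exp s)\<close> on the
  hyperbola \<open>Q1 c = - 1\<close>, the difference of the functions \<open>E (exp s * x - exp (- s) * y)\<close> at two rapidities
  is the integral over \<open>s\<close> of a Hermite polynomial times a Gaussian, so that the indefinite theta series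
  is an integral over a compact path of absolutely convergent positive definite ones. For fixed \<open>s\<close>,
  Poisson summation in \<open>y\<close> alone turns the kernel into
  \<open>(cnj \<tau> * x + \<eta>) ^ n * exp (- pi * (exp s)\<^sup>2 * \<bar>\<tau> * x + \<eta>\<bar>\<^sup>2 / Im \<tau>)\<close>, and in this form
  \<open>\<tau> \<mapsto> - 1 / \<tau>\<close> is just the exchange of \<open>x\<close> and \<open>\<eta>\<close>.

  The monomials of the integral representation differ from those of the definition by the heat flow of
  the Laplacian, which acts trivially on a spherical polynomial. This is the only place where
  harmonicity enters, and it allows the blocks to be treated one monomial at a time.
\<close>

section \<open>Fourier coefficients\<close>

definition cis2pi :: "real \<Rightarrow> complex" where
  "cis2pi x = cis (2 * pi * x)"

lemma cis2pi_0 [simp]: "cis2pi 0 = 1"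
  by (simp add: cis2pi_def)

lemma norm_cis2pi [simp]: "norm (cis2pi x) = 1"
  by (simp add: cis2pi_def)

lemma cis2pi_add: "cis2pi (x + y) = cis2pi x * cis2pi y"
  by (simp add: cis2pi_def cis_mult ring_distribs)

lemma cis2pi_of_int [simp]: "cis2pi (of_int k) = 1"
  by (simp add: cis2pi_def cis_multiple_2pi)

lemma cnj_cis2pi: "cnj (cis2pi x) = cis2pi (- x)"
  by (simp add: cis2pi_def cis_cnj)

lemma cis2pi_eq_exp: "cis2pi x = exp (2 * of_real pi * \<i> * of_real x)"
  by (simp add: cis2pi_def cis_conv_exp mult_ac)

lemma has_vector_derivative_cis2pi:
  "((\<lambda>x. cis2pi (w * x)) has_vector_derivative 2 * of_real pi * \<i> * of_real w * cis2pi (w * x))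
     (at x within A)"
proof -
  have "((\<lambda>z. exp (2 * of_real pi * \<i> * of_real w * z)) has_field_derivative
      2 * of_real pi * \<i> * of_real w * exp (2 * of_real pi * \<i> * of_real w * of_real x))
      (at (of_real x))"
    by (auto intro!: derivative_eq_intros)
  from has_vector_derivative_real_field[OF this, of A] show ?thesis
    by (simp add: cis2pi_eq_exp mult_ac)
qed

lemma continuous_on_cis2pi [continuous_intros]:
  "continuous_on A g \<Longrightarrow> continuous_on A (\<lambda>x. cis2pi (g x))"
  unfolding cis2pi_def by (intro continuous_intros)

lemma integral_cis2pi_period:
  "integral {0..1} (\<lambda>x. cis2pi (of_int k * x)) = (if k = 0 then 1 else 0)"
proof (cases "k = 0")
  case False
  define c where "c = 2 * of_real pi * \<i> * of_int k"
  have "c \<noteq> 0"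
    using False by (simp add: c_def)
  have "((\<lambda>x. cis2pi (of_int k * x)) has_integral
      cis2pi (of_int k * 1) / c - cis2pi (of_int k * 0) / c) {0..1}"
  proof (rule fundamental_theorem_of_calculus)
    fix x :: real
    show "((\<lambda>x. cis2pi (of_int k * x) / c) has_vector_derivative cis2pi (of_int k * x))
        (at x within {0..1})"
      using has_vector_derivative_divide[OF has_vector_derivative_cis2pi[of "of_int k" x "{0..1}"], of c]
        \<open>c \<noteq> 0\<close> by (simp add: c_def)
  qed simp
  then show ?thesis
    using False by (simp add: integral_unique)
qed simp

definition fourier_coeff :: "(real \<Rightarrow> complex) \<Rightarrow> int \<Rightarrow> complex" where
  "fourier_coeff G k = integral {0..1} (\<lambda>x. G x * cis2pi (- (of_int k * x)))"

lemma fourier_coeff_add: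
  assumes "continuous_on {0..1} F" "continuous_on {0..1} G"
  shows "fourier_coeff (\<lambda>x. F x + G x) k = fourier_coeff F k + fourier_coeff G k"
  unfolding fourier_coeff_def distrib_right
  by (intro integral_add integrable_continuous_real continuous_intros assms)

lemma fourier_coeff_diff:
  assumes "continuous_on {0..1} F" "continuous_on {0..1} G"
  shows "fourier_coeff (\<lambda>x. F x - G x) k = fourier_coeff F k - fourier_coeff G k"
  unfolding fourier_coeff_def left_diff_distrib
  by (intro integral_diff integrable_continuous_real continuous_intros assms)

lemma fourier_coeff_cmult: "fourier_coeff (\<lambda>x. c * G x) k = c * fourier_coeff G k"
  unfolding fourier_coeff_def mult.assoc by (rule integral_mult_right)

lemma fourier_coeff_mult_cis2pi:
  "fourier_coeff (\<lambda>x. G x * cis2pi (of_int j * x)) k = fourier_coeff G (k - j)"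
  unfolding fourier_coeff_def
  by (intro integral_cong) (simp add: mult.assoc cis2pi_add[symmetric] algebra_simps)

lemma continuous_on_polynomial_cis2pi:
  fixes p :: "complex \<Rightarrow> 'a::euclidean_space"
  assumes "polynomial_function p"
  shows "continuous_on A (\<lambda>x. p (cis2pi x))"
  by (rule continuous_on_compose2[OF continuous_on_polymonial_function[OF assms, of UNIV]])
    (auto intro: continuous_on_cis2pi)

lemma fourier_coeff_eq_0_mult_polynomial:
  assumes "real_polynomial_function p"
    and "continuous_on {0..1} G" "\<And>k. fourier_coeff G k = 0"
  shows "fourier_coeff (\<lambda>x. G x * of_real (p (cis2pi x))) k = 0"
  using assms
proof (induction p arbitrary: G k rule: real_polynomial_function.induct)
  case (linear p)
  define u where "u = (of_real (p 1) - \<i> * of_real (p \<i>)) / 2"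
  have "of_real (p z) = u * z + cnj u * cnj z" for z
  proof -
    have "p z = p (Re z *\<^sub>R 1 + Im z *\<^sub>R \<i>)"
      by (simp add: scaleR_conv_of_real complex_eq[symmetric] mult.commute)
    also have "\<dots> = Re z * p 1 + Im z * p \<i>"
      using linear.hyps by (simp only: linear_simps real_scaleR_def)
    finally show ?thesis
      by (simp add: complex_eq_iff u_def add_divide_distrib[symmetric])
  qed
  then have "(\<lambda>x. G x * of_real (p (cis2pi x))) =
      (\<lambda>x. u * (G x * cis2pi (of_int 1 * x)) + cnj u * (G x * cis2pi (of_int (- 1) * x)))"
    by (simp add: cnj_cis2pi algebra_simps)
  moreover have "continuous_on {0..1} (\<lambda>x. w * (G x * cis2pi (of_int j * x)))" for w j
    by (intro continuous_intros linear.prems(1))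
  ultimately show ?case
    by (simp only: fourier_coeff_add fourier_coeff_cmult fourier_coeff_mult_cis2pi linear.prems(2)) simp
next
  case (const c)
  have "(\<lambda>x. G x * of_real c) = (\<lambda>x. of_real c * G x)"
    by (simp add: mult.commute)
  then show ?case
    using const.prems(2) by (simp only: fourier_coeff_cmult mult_zero_right)
next
  case (add p q)
  then show ?case
    by (simp add: ring_distribs fourier_coeff_add continuous_on_mult continuous_on_of_real
        continuous_on_polynomial_cis2pi real_polynomial_function_eq)
next
  case (mult p q)
  have "continuous_on {0..1} (\<lambda>x. G x * of_real (p (cis2pi x)))"
    using mult by (intro continuous_on_mult continuous_on_of_real continuous_on_polynomial_cis2pi)
      (auto simp: real_polynomial_function_eq)
  from mult.IH(2)[OF this mult.IH(1)[OF mult.prems]] show ?case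
    by (simp add: mult.assoc)
qed

lemma image_cis2pi: "cis2pi ` {0..1} = sphere 0 1"
proof
  show "sphere 0 1 \<subseteq> cis2pi ` {0..1}"
  proof
    fix z :: complex assume "z \<in> sphere 0 1"
    then have "z = cis2pi (Arg2pi z / (2 * pi))"
      using Arg2pi_eq[of z] by (simp add: cis2pi_def cis_conv_exp)
    moreover have "Arg2pi z / (2 * pi) \<in> {0..1}"
      using Arg2pi_ge_0[of z] Arg2pi_lt_2pi[of z] by simp
    ultimately show "z \<in> cis2pi ` {0..1}"
      by blast
  qed
qed auto

text \<open>A continuous function with equal end values lives on the circle, where Stone--Weierstrass applies.\<close>

lemma circle_polynomial_approximation:
  fixes G :: "real \<Rightarrow> complex"
  assumes cont: "continuous_on {0..1} G" and ends: "G 0 = G 1" and "\<epsilon> > 0"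
  obtains p where "polynomial_function p" "\<And>x. x \<in> {0..1} \<Longrightarrow> norm (G x - p (cis2pi x)) < \<epsilon>"
proof -
  define g where "g = (\<lambda>z. G (Arg2pi z / (2 * pi)))"
  have g_cis2pi: "g (cis2pi x) = G x" if "x \<in> {0..1}" for x
  proof (cases "x = 1")
    case False
    then have "Arg2pi (cis2pi x) = 2 * pi * x"
      using that by (intro Arg2pi_unique[of 1]) (auto simp: cis2pi_def cis_conv_exp)
    then show ?thesis
      by (simp add: g_def)
  next
    case True
    then have "cis2pi x = 1"
      using cis2pi_of_int[of 1] by simp
    then show ?thesis
      using ends True by (simp add: g_def Arg2pi_of_real[of 1, simplified])
  qed
  have "quotient_map (top_of_set {0..1}) (top_of_set (sphere 0 1)) cis2pi"
    by (intro T1_Spaces.continuous_imp_quotient_map)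
      (auto simp: image_cis2pi continuous_map_in_subtopology compact_space_subtopology
        Hausdorff_space_subtopology
        intro!: continuous_intros continuous_on_cis2pi[OF continuous_on_id])
  moreover have "continuous_map (top_of_set {0..1}) euclidean (g \<circ> cis2pi)"
    using cont by (simp add: o_def g_cis2pi cong: continuous_on_cong_simp)
  ultimately have "continuous_on (sphere 0 1) g"
    by (metis continuous_compose_quotient_map_eq continuous_map_iff_continuous)
  then obtain p where p: "polynomial_function p" "\<And>z. z \<in> sphere 0 1 \<Longrightarrow> norm (g z - p z) < \<epsilon>"
    using Stone_Weierstrass_polynomial_function[of "sphere 0 1" g \<epsilon>] \<open>\<epsilon> > 0\<close> by auto
  show ?thesis
    by (rule that[OF p(1)]) (metis p(2) g_cis2pi norm_cis2pi mem_sphere_0)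
qed

lemma integral_mult_polynomial_eq_0:
  fixes p :: "complex \<Rightarrow> complex"
  assumes p: "polynomial_function p"
    and G: "continuous_on {0..1} G" "\<And>k. fourier_coeff G k = 0"
  shows "integral {0..1} (\<lambda>x. G x * p (cis2pi x)) = 0"
proof -
  have Re_Im: "real_polynomial_function (\<lambda>z. Re (p z))" "real_polynomial_function (\<lambda>z. Im (p z))"
    using p bounded_linear_Re bounded_linear_Im unfolding polynomial_function_def o_def by blast+
  have "G x * p (cis2pi x) =
      G x * of_real (Re (p (cis2pi x))) + \<i> * (G x * of_real (Im (p (cis2pi x))))" for x
    using complex_eq[of "p (cis2pi x)"] by (metis distrib_left mult.left_commute)
  then have "integral {0..1} (\<lambda>x. G x * p (cis2pi x)) =
      fourier_coeff (\<lambda>x. G x * of_real (Re (p (cis2pi x))) + \<i> * (G x * of_real (Im (p (cis2pi x))))) 0"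
    by (simp add: fourier_coeff_def)
  also have "\<dots> = 0"
    by (subst fourier_coeff_add)
      (auto simp: fourier_coeff_cmult fourier_coeff_eq_0_mult_polynomial[OF Re_Im(1) G]
        fourier_coeff_eq_0_mult_polynomial[OF Re_Im(2) G]
        intro!: continuous_intros G
          continuous_on_polynomial_cis2pi[OF p])
  finally show ?thesis .
qed

lemma integral_norm_square_le:
  assumes G: "continuous_on {0..1} G" "\<And>k. fourier_coeff G k = 0" and ends: "G 0 = G 1" and "\<epsilon> > 0"
  shows "integral {0..1} (\<lambda>x. (norm (G x))\<^sup>2) \<le> \<epsilon> * integral {0..1} (\<lambda>x. norm (G x))"
    (is "?I \<le> _")
proof -
  obtain p where p: "polynomial_function p"
    and close: "\<And>x. x \<in> {0..1} \<Longrightarrow> norm (cnj (G x) - p (cis2pi x)) < \<epsilon>"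
    using circle_polynomial_approximation[of "\<lambda>x. cnj (G x)" \<epsilon>] \<open>\<epsilon> > 0\<close> ends
    by (auto intro: continuous_intros G)
  have "of_real ?I = integral {0..1} (\<lambda>x. of_real ((norm (G x))\<^sup>2) :: complex)"
    by (intro integral_unique[symmetric] has_integral_of_real integrable_integral
        integrable_continuous_real continuous_intros G)
  also have "\<dots> = integral {0..1} (\<lambda>x. G x * cnj (G x)) - integral {0..1} (\<lambda>x. G x * p (cis2pi x))"
    using integral_mult_polynomial_eq_0[OF p G] by (simp add: complex_norm_square del: of_real_power)
  also have "\<dots> = integral {0..1} (\<lambda>x. G x * (cnj (G x) - p (cis2pi x)))"
    unfolding right_diff_distrib
    by (intro integral_diff[symmetric] integrable_continuous_real continuous_intros G
        continuous_on_polynomial_cis2pi[OF p])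
  also have "norm \<dots> \<le> integral {0..1} (\<lambda>x. norm (G x) * \<epsilon>)"
    using close
    by (intro integral_norm_bound_integral integrable_continuous_real continuous_intros G
        continuous_on_polynomial_cis2pi[OF p])
      (auto simp: norm_mult less_imp_le intro!: mult_left_mono)
  finally show ?thesis
    by (simp add: mult.commute)
qed

theorem fourier_coeff_eq_0_imp_eq_0:
  assumes G: "continuous_on {0..1} G" "\<And>k. fourier_coeff G k = 0" "G 0 = G 1" and x: "x \<in> {0..1}"
  shows "G x = 0"
proof -
  define I where "I = integral {0..1} (\<lambda>x. (norm (G x))\<^sup>2)"
  define L where "L = integral {0..1} (\<lambda>x. norm (G x))"
  have "\<forall>\<^sub>F \<epsilon> in at_right 0. I \<le> \<epsilon> * L"
    unfolding I_def L_def
    by (rule eventually_mono[OF eventually_at_right_less integral_norm_square_le[OF G]])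
  moreover have "((\<lambda>\<epsilon>. \<epsilon> * L) \<longlongrightarrow> 0 * L) (at_right 0)"
    by (intro tendsto_intros)
  ultimately have "I \<le> 0 * L"
    by (intro tendsto_lowerbound) auto
  moreover have "0 \<le> I"
    unfolding I_def by (intro integral_nonneg integrable_continuous_real continuous_intros G) simp
  ultimately have "I = 0"
    by simp
  then have "\<forall>x\<in>{0..1}. (norm (G x))\<^sup>2 = 0"
    unfolding I_def by (subst (asm) integral_eq_0_iff) (auto intro!: continuous_intros G)
  then show ?thesis
    using x by simp
qed

section \<open>Poisson summation\<close>

definition cauchy_weight :: "real \<Rightarrow> real" where
  "cauchy_weight y = 1 / (1 + y\<^sup>2)"

lemma cauchy_weight_nonneg: "0 \<le> cauchy_weight y"
  by (simp add: cauchy_weight_def)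

lemma cauchy_weight_shift_le: "cauchy_weight (x + y) \<le> 2 * (1 + x\<^sup>2) * cauchy_weight y"
proof -
  have "y\<^sup>2 \<le> 2 * (x + y)\<^sup>2 + 2 * x\<^sup>2"
    using zero_le_power2[of "2 * x + y"] by (simp add: power2_eq_square algebra_simps)
  moreover have "0 \<le> x\<^sup>2 * (x + y)\<^sup>2"
    by simp
  ultimately have "1 + y\<^sup>2 \<le> 2 * (1 + x\<^sup>2) * (1 + (x + y)\<^sup>2)"
    unfolding distrib_left distrib_right by linarith
  then show ?thesis
    by (simp add: cauchy_weight_def field_simps add_pos_nonneg)
qed

lemma summable_on_cauchy_weight_int: "(\<lambda>m. cauchy_weight (of_int m)) summable_on UNIV"
proof -
  have "summable (\<lambda>n. inverse (real (Suc n) ^ 2))"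
    using inverse_power_summable[of 2, where ?'a = real] by (subst summable_Suc_iff) simp
  then have "summable (\<lambda>n. norm (cauchy_weight (real n)))"
  proof (rule summable_comparison_test'[OF summable_mult[of _ 2], of _ 0])
    fix n :: nat
    have "(real (Suc n))\<^sup>2 \<le> 2 * (1 + (real n)\<^sup>2)"
      using zero_le_power2[of "real n - 1"] by (simp add: power2_eq_square algebra_simps)
    then show "norm (norm (cauchy_weight (real n))) \<le> 2 * inverse (real (Suc n) ^ 2)"
      by (simp add: cauchy_weight_def divide_le_eq field_simps add_pos_nonneg)
  qed
  then have nat: "(\<lambda>n. cauchy_weight (real n)) summable_on UNIV"
    by (rule norm_summable_imp_summable_on)
  have "(\<lambda>m. cauchy_weight (of_int m)) summable_on range int"
    by (subst summable_on_reindex) (auto simp: o_def nat)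
  moreover have "(\<lambda>m. cauchy_weight (of_int m)) summable_on range (\<lambda>n. - int n)"
    using nat by (subst summable_on_reindex) (auto simp: o_def inj_on_def cauchy_weight_def)
  ultimately have "(\<lambda>m. cauchy_weight (of_int m)) summable_on range int \<union> range (\<lambda>n. - int n)"
    by (rule summable_on_union)
  also have "range int \<union> range (\<lambda>n. - int n) = UNIV"
    by (auto simp: image_iff) (metis int_cases2)
  finally show ?thesis .
qed

lemma summable_on_cauchy_weight_shift: "(\<lambda>m. cauchy_weight (x + of_int m)) summable_on UNIV"
  by (rule summable_on_comparison_test[OF summable_on_cmult_right[OF summable_on_cauchy_weight_int]
        cauchy_weight_shift_le])
    (simp add: cauchy_weight_nonneg)

lemma uniform_limit_infsum_integral:
  fixes g :: "'i \<Rightarrow> real \<Rightarrow> 'b :: banach"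
  assumes cont: "\<And>i. continuous_on {a..b} (g i)"
    and lim: "uniform_limit {a..b} (\<lambda>X y. \<Sum>i\<in>X. g i y) s (finite_subsets_at_top S)"
  shows "((\<lambda>i. integral {a..b} (g i)) has_sum integral {a..b} s) S"
proof -
  obtain I J where IJ: "\<And>X. ((\<lambda>y. \<Sum>i\<in>X. g i y) has_integral I X) {a..b}"
    "(s has_integral J) {a..b}" "(I \<longlongrightarrow> J) (finite_subsets_at_top S)"
    by (rule uniform_limit_integral[OF lim]) (auto intro!: continuous_intros cont)
  have "I X = (\<Sum>i\<in>X. integral {a..b} (g i))" if "finite X" for X
    by (rule has_integral_unique[OF IJ(1) has_integral_sum[OF that]])
      (auto intro!: integrable_integral integrable_continuous_real cont)
  then have "((\<lambda>X. \<Sum>i\<in>X. integral {a..b} (g i)) \<longlongrightarrow> J) (finite_subsets_at_top S)"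
    by (intro Lim_transform_eventually[OF IJ(3)] eventually_finite_subsets_at_top_weakI) auto
  with IJ(2) show ?thesis
    by (simp add: has_sum_def has_integral_iff)
qed

lemma
  fixes g :: "'i \<Rightarrow> real \<Rightarrow> 'b :: banach"
  assumes cont: "\<And>i. continuous_on {a..b} (g i)"
    and bound: "\<And>i x. i \<in> S \<Longrightarrow> x \<in> {a..b} \<Longrightarrow> norm (g i x) \<le> M i"
    and summable: "M summable_on S"
  shows has_sum_integral_M_test:
      "((\<lambda>i. integral {a..b} (g i)) has_sum integral {a..b} (\<lambda>x. \<Sum>\<^sub>\<infinity>i\<in>S. g i x)) S"
    and continuous_on_infsum_M_test: "continuous_on {a..b} (\<lambda>x. \<Sum>\<^sub>\<infinity>i\<in>S. g i x)"
proof -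
  note lim = Weierstrass_m_test_general[OF bound summable]
  show "((\<lambda>i. integral {a..b} (g i)) has_sum integral {a..b} (\<lambda>x. \<Sum>\<^sub>\<infinity>i\<in>S. g i x)) S"
    by (rule uniform_limit_infsum_integral[OF cont lim])
  show "continuous_on {a..b} (\<lambda>x. \<Sum>\<^sub>\<infinity>i\<in>S. g i x)"
    by (rule uniform_limit_theorem[OF _ lim]) (auto intro!: continuous_intros cont always_eventually)
qed

lemma filterlim_symmetric_intervals:
  "filterlim (\<lambda>N. {- int N..<int N}) (finite_subsets_at_top UNIV) sequentially"
  unfolding filterlim_finite_subsets_at_top
proof safe
  fix X :: "int set" assume "finite X"
  then obtain B where B: "\<And>k. k \<in> X \<Longrightarrow> \<bar>k\<bar> \<le> B"
    using finite_imageI[of X abs] by (metis bdd_above.unfold bdd_above_finite imageI)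
  have "\<forall>\<^sub>F N in sequentially. N \<ge> nat (B + 1)"
    by (rule eventually_ge_at_top)
  then show "\<forall>\<^sub>F N in sequentially.
      finite {- int N..<int N} \<and> X \<subseteq> {- int N..<int N} \<and> {- int N..<int N} \<subseteq> UNIV"
    by eventually_elim (use B in \<open>fastforce simp: abs_le_iff\<close>)
qed

lemma UNIV_neq_cbox: "\<not> (\<exists>a b :: 'a :: euclidean_space. UNIV = cbox a b)"
  by (metis bounded_cbox not_bounded_UNIV)

lemma has_integral_UNIV_imp_symmetric_limit:
  fixes f :: "real \<Rightarrow> 'a :: banach"
  assumes "(f has_integral I) UNIV"
  shows "(\<lambda>N. integral {- real N..real N} f) \<longlonglongrightarrow> I"
proof (rule LIMSEQ_I)
  fix e :: real assume "e > 0"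
  from has_integral_altD[OF assms UNIV_neq_cbox \<open>e > 0\<close>] obtain B where
    B: "\<forall>a b. ball 0 B \<subseteq> cbox a b \<longrightarrow>
      (\<exists>z. ((\<lambda>x. if x \<in> UNIV then f x else 0) has_integral z) (cbox a b) \<and> norm (z - I) < e)"
    by blast
  have "norm (integral {- real N..real N} f - I) < e" if "N \<ge> nat \<lceil>B\<rceil>" for N
  proof -
    have "B \<le> real N"
      using that by linarith
    then have "ball 0 B \<subseteq> cbox (- real N) (real N)"
      by (auto simp: dist_real_def)
    from B[rule_format, OF this] show ?thesis
      by (auto simp: has_integral_iff)
  qed
  then show "\<exists>n0. \<forall>n\<ge>n0. norm (integral {- real n..real n} f - I) < e"
    by blast
qed

lemma sum_integral_unit_intervals:
  fixes f :: "real \<Rightarrow> 'a :: banach"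
  assumes "continuous_on UNIV f"
  shows "(\<Sum>m\<in>{- int N..<int N}. integral {of_int m..of_int m + 1} f) = integral {- real N..real N} f"
proof (induction N)
  case (Suc N)
  have int: "f integrable_on {a..b}" for a b
    by (intro integrable_continuous_real continuous_on_subset[OF assms]) simp
  have "{- int (Suc N)..<int (Suc N)} = insert (- int (Suc N)) (insert (int N) {- int N..<int N})"
    by auto
  then have "(\<Sum>m\<in>{- int (Suc N)..<int (Suc N)}. integral {of_int m..of_int m + 1} f) =
      integral {- real (Suc N)..- real N} f +
      (integral {real N..real (Suc N)} f + integral {- real N..real N} f)"
    by (simp add: Suc.IH) (simp add: add.commute)
  also have "\<dots> = integral {- real (Suc N)..real (Suc N)} f"
    by (subst add.commute[of "integral {real N..real (Suc N)} f"])
      (simp add: Henstock_Kurzweil_Integration.integral_combine int)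
  finally show ?case .
qed simp

lemma has_sum_integral_unit_intervals:
  fixes f :: "real \<Rightarrow> 'a :: banach"
  assumes "continuous_on UNIV f" "(f has_integral I) UNIV"
    and "(\<lambda>m. integral {of_int m..of_int m + 1} f) summable_on UNIV"
  shows "((\<lambda>m. integral {of_int m..of_int m + 1} f) has_sum I) UNIV"
proof -
  obtain S where S: "((\<lambda>m. integral {of_int m..of_int m + 1} f) has_sum S) UNIV"
    using assms(3) by (auto simp: summable_on_def)
  then have "(\<lambda>N. integral {- real N..real N} f) \<longlonglongrightarrow> S"
    unfolding has_sum_def sum_integral_unit_intervals[OF assms(1), symmetric]
    by (rule filterlim_compose[OF _ filterlim_symmetric_intervals])
  then have "S = I"
    using has_integral_UNIV_imp_symmetric_limit[OF assms(2)] by (rule LIMSEQ_unique)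
  with S show ?thesis
    by simp
qed

lemma periodization_majorant:
  assumes bound: "\<And>y. norm (\<phi> y) \<le> C * cauchy_weight y" and x: "x \<in> {0..1}"
  shows "norm (\<phi> (x + of_int m)) \<le> 4 * C * cauchy_weight (of_int m)"
proof -
  have "0 \<le> C * cauchy_weight 0"
    using norm_ge_zero bound by (rule order_trans)
  then have "C \<ge> 0"
    by (simp add: cauchy_weight_def)
  have "cauchy_weight (x + of_int m) \<le> 2 * (1 + x\<^sup>2) * cauchy_weight (of_int m)"
    by (rule cauchy_weight_shift_le)
  also have "\<dots> \<le> 4 * cauchy_weight (of_int m)"
    using x by (intro mult_right_mono cauchy_weight_nonneg) (auto simp: power_le_one)
  finally have "C * cauchy_weight (x + of_int m) \<le> C * (4 * cauchy_weight (of_int m))"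
    using \<open>C \<ge> 0\<close> by (rule mult_left_mono)
  then show ?thesis
    using bound[of "x + of_int m"] by simp
qed

lemma fourier_coeff_periodization:
  assumes cont: "continuous_on UNIV \<phi>" and bound: "\<And>y. norm (\<phi> y) \<le> C * cauchy_weight y"
    and ft: "((\<lambda>y. \<phi> y * cis2pi (- (of_int k * y))) has_integral c) UNIV"
  shows "fourier_coeff (\<lambda>x. \<Sum>\<^sub>\<infinity>m. \<phi> (x + of_int m)) k = c"
proof -
  define f where "f y = \<phi> y * cis2pi (- (of_int k * y))" for y
  have contf: "continuous_on UNIV f"
    unfolding f_def by (intro continuous_intros cont)
  have f_shift: "f (x + of_int m) = \<phi> (x + of_int m) * cis2pi (- (of_int k * x))" for x m
  proof -
    have "cis2pi (- (of_int k * (x + of_int m))) =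
        cis2pi (- (of_int k * x)) * cis2pi (of_int (- (k * m)))"
      unfolding cis2pi_add[symmetric] by (simp add: algebra_simps)
    then show ?thesis
      by (simp only: f_def cis2pi_of_int mult_1_right)
  qed
  have unit: "integral {of_int m..of_int m + 1} f = integral {0..1} (\<lambda>x. f (x + of_int m))" for m
    using integral_shift_Icc_real[of 0 1 f "of_int m"] by (simp add: o_def add.commute)
  have sum: "((\<lambda>m. integral {0..1} (\<lambda>x. f (x + of_int m))) has_sum
      integral {0..1} (\<lambda>x. \<Sum>\<^sub>\<infinity>m. f (x + of_int m))) UNIV"
  proof (rule has_sum_integral_M_test)
    show "continuous_on {0..1} (\<lambda>x. f (x + of_int m))" for m
      by (rule continuous_on_compose2[OF contf]) (auto intro: continuous_intros)
    show "norm (f (x + of_int m)) \<le> 4 * C * cauchy_weight (of_int m)" if "x \<in> {0..1}" for m x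
      using periodization_majorant[OF bound that] by (simp add: f_shift norm_mult)
    show "(\<lambda>m. 4 * C * cauchy_weight (of_int m)) summable_on UNIV"
      by (intro summable_on_cmult_right summable_on_cauchy_weight_int)
  qed
  then have "((\<lambda>m. integral {of_int m..of_int m + 1} f) has_sum c) UNIV"
    using ft unfolding f_def[symmetric]
    by (intro has_sum_integral_unit_intervals contf) (auto simp: unit summable_on_def)
  with sum have "integral {0..1} (\<lambda>x. \<Sum>\<^sub>\<infinity>m. f (x + of_int m)) = c"
    unfolding unit by (rule has_sum_unique)
  then show ?thesis
    by (simp add: fourier_coeff_def f_shift infsum_cmult_left')
qed

lemma
  assumes "\<psi> summable_on UNIV"
  shows continuous_on_fourier_series: "continuous_on {0..1} (\<lambda>x. \<Sum>\<^sub>\<infinity>k. \<psi> k * cis2pi (of_int k * x))"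
    and fourier_coeff_fourier_series:
      "fourier_coeff (\<lambda>x. \<Sum>\<^sub>\<infinity>k. \<psi> k * cis2pi (of_int k * x)) j = \<psi> j"
proof -
  have summable: "(\<lambda>k. norm (\<psi> k)) summable_on UNIV"
    using assms summable_on_iff_abs_summable_on_complex by blast
  show "continuous_on {0..1} (\<lambda>x. \<Sum>\<^sub>\<infinity>k. \<psi> k * cis2pi (of_int k * x))"
    by (rule continuous_on_infsum_M_test[OF _ _ summable]) (auto simp: norm_mult intro!: continuous_intros)
  let ?e = "\<lambda>k x. \<psi> k * cis2pi (of_int k * x) * cis2pi (- (of_int j * x))"
  have "integral {0..1} (?e k) = (if k = j then \<psi> j else 0)" for k
  proof -
    have "?e k = (\<lambda>x. \<psi> k * cis2pi (of_int (k - j) * x))"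
      unfolding mult.assoc cis2pi_add[symmetric] by (simp add: left_diff_distrib)
    then show ?thesis
      by (simp only: integral_mult_right integral_cis2pi_period) simp
  qed
  moreover have "((\<lambda>k. integral {0..1} (?e k)) has_sum integral {0..1} (\<lambda>x. \<Sum>\<^sub>\<infinity>k. ?e k x)) UNIV"
    by (rule has_sum_integral_M_test[OF _ _ summable]) (auto simp: norm_mult intro!: continuous_intros)
  ultimately have "((\<lambda>k. if k = j then \<psi> j else 0) has_sum integral {0..1} (\<lambda>x. \<Sum>\<^sub>\<infinity>k. ?e k x)) UNIV"
    by simp
  moreover have "((\<lambda>k. if k = j then \<psi> j else 0) has_sum \<psi> j) UNIV"
    by (rule has_sum_finite_neutralI[of "{j}"]) auto
  ultimately have "integral {0..1} (\<lambda>x. \<Sum>\<^sub>\<infinity>k. ?e k x) = \<psi> j"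
    by (rule has_sum_unique)
  then show "fourier_coeff (\<lambda>x. \<Sum>\<^sub>\<infinity>k. \<psi> k * cis2pi (of_int k * x)) j = \<psi> j"
    by (simp add: fourier_coeff_def infsum_cmult_left')
qed

lemma infsum_int_shift: "(\<Sum>\<^sub>\<infinity>m. f (m + j)) = (\<Sum>\<^sub>\<infinity>m. f (m :: int))"
  by (rule infsum_reindex_bij_betw) (rule bij_plus_right)

theorem poisson_summation:
  assumes cont: "continuous_on UNIV \<phi>" and bound: "\<And>y. norm (\<phi> y) \<le> C * cauchy_weight y"
    and ft: "\<And>k. ((\<lambda>y. \<phi> y * cis2pi (- (of_int k * y))) has_integral \<psi> k) UNIV"
    and summable: "\<psi> summable_on UNIV"
  shows "(\<Sum>\<^sub>\<infinity>m. \<phi> (x + of_int m)) = (\<Sum>\<^sub>\<infinity>k. \<psi> k * cis2pi (of_int k * x))"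
proof -
  define P where "P x = (\<Sum>\<^sub>\<infinity>m. \<phi> (x + of_int m))" for x
  define S where "S x = (\<Sum>\<^sub>\<infinity>k. \<psi> k * cis2pi (of_int k * x))" for x
  have P_periodic: "P (x + of_int j) = P x" for x j
    using infsum_int_shift[of "\<lambda>m. \<phi> (x + of_int m)" j] by (simp add: P_def add_ac)
  have S_periodic: "S (x + of_int j) = S x" for x j
  proof -
    have "cis2pi (of_int k * (x + of_int j)) = cis2pi (of_int k * x) * cis2pi (of_int (k * j))" for k
      unfolding cis2pi_add[symmetric] by (simp add: algebra_simps)
    then show ?thesis
      by (simp only: S_def cis2pi_of_int mult_1_right)
  qed
  have contP: "continuous_on {0..1} P"
    unfolding P_def
  proof (rule continuous_on_infsum_M_test)
    show "continuous_on {0..1} (\<lambda>x. \<phi> (x + of_int m))" for m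
      by (rule continuous_on_compose2[OF cont]) (auto intro: continuous_intros)
    show "(\<lambda>m. 4 * C * cauchy_weight (of_int m)) summable_on UNIV"
      by (intro summable_on_cmult_right summable_on_cauchy_weight_int)
  qed (rule periodization_majorant[OF bound])
  have contS: "continuous_on {0..1} S"
    unfolding S_def by (rule continuous_on_fourier_series[OF summable])
  have "fourier_coeff P k = fourier_coeff S k" for k
    unfolding P_def S_def
    by (simp add: fourier_coeff_periodization[OF cont bound ft] fourier_coeff_fourier_series[OF summable])
  then have "fourier_coeff (\<lambda>x. P x - S x) k = 0" for k
    by (simp add: fourier_coeff_diff[OF contP contS])
  then have "P (frac x) - S (frac x) = 0"
    using P_periodic[of 0 1] S_periodic[of 0 1] contP contS frac_lt_1[of x]
    by (intro fourier_coeff_eq_0_imp_eq_0[of "\<lambda>x. P x - S x"] continuous_on_diff) (auto simp: less_imp_le)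
  then show ?thesis
    using P_periodic[of "frac x" "\<lfloor>x\<rfloor>"] S_periodic[of "frac x" "\<lfloor>x\<rfloor>"]
    by (simp add: frac_def P_def S_def)
qed

section \<open>Hermite polynomials times Gaussians\<close>

lemma abs_le_exp_square:
  fixes s :: real
  assumes "c > 0"
  shows "\<bar>s\<bar> \<le> (1 + 1 / c) * exp (c * s\<^sup>2)"
proof -
  have "\<bar>s\<bar> \<le> 1 + s\<^sup>2"
    using zero_le_power2[of "\<bar>s\<bar> - 1"] zero_le_power2[of s] by (simp add: power2_diff)
  also have "\<dots> \<le> (1 + 1 / c) * (1 + c * s\<^sup>2)"
    using assms by (simp add: field_simps)
  also have "\<dots> \<le> (1 + 1 / c) * exp (c * s\<^sup>2)"
    using assms by (intro mult_left_mono exp_ge_add_one_self) auto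
  finally show ?thesis .
qed

lemma poly_le_exp_square:
  fixes p :: "real poly"
  assumes "\<delta> > 0"
  obtains K where "K \<ge> 0" "\<And>s. \<bar>poly p s\<bar> \<le> K * exp (\<delta> * s\<^sup>2)"
proof -
  have "\<exists>K\<ge>0. \<forall>s. \<bar>poly p s\<bar> \<le> K * exp (\<delta> * s\<^sup>2)"
    using assms
  proof (induction p arbitrary: \<delta>)
    case 0
    then show ?case by auto
  next
    case (pCons a p)
    obtain K where K: "K \<ge> 0" "\<And>s. \<bar>poly p s\<bar> \<le> K * exp (\<delta> / 2 * s\<^sup>2)"
      using pCons.IH[of "\<delta> / 2"] pCons.prems by auto
    define L where "L = 1 + 1 / (\<delta> / 2)"
    have "L \<ge> 0"
      using pCons.prems by (simp add: L_def)
    have "\<bar>poly (pCons a p) s\<bar> \<le> (\<bar>a\<bar> + L * K) * exp (\<delta> * s\<^sup>2)" for s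
    proof -
      have "\<bar>poly (pCons a p) s\<bar> \<le> \<bar>a\<bar> + \<bar>s\<bar> * \<bar>poly p s\<bar>"
        by (simp add: abs_mult[symmetric])
      also have "\<bar>s\<bar> * \<bar>poly p s\<bar> \<le> (L * exp (\<delta> / 2 * s\<^sup>2)) * (K * exp (\<delta> / 2 * s\<^sup>2))"
        unfolding L_def using pCons.prems by (intro mult_mono abs_le_exp_square K) auto
      also have "\<dots> = L * K * exp (\<delta> / 2 * s\<^sup>2 + \<delta> / 2 * s\<^sup>2)"
        by (simp only: exp_add mult_ac)
      also have "\<delta> / 2 * s\<^sup>2 + \<delta> / 2 * s\<^sup>2 = \<delta> * s\<^sup>2"
        by (simp add: field_simps)
      also have "\<bar>a\<bar> \<le> \<bar>a\<bar> * exp (\<delta> * s\<^sup>2)"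
        using pCons.prems by (simp add: mult_le_cancel_left1)
      finally show ?thesis
        by (simp add: algebra_simps)
    qed
    then show ?case
      using K(1) \<open>L \<ge> 0\<close> by (intro exI[of _ "\<bar>a\<bar> + L * K"]) auto
  qed
  then show ?thesis
    using that by blast
qed

lemma poly_gaussian_le_gaussian:
  fixes p :: "real poly"
  assumes "c > 0"
  obtains K where "K \<ge> 0" "\<And>y. \<bar>poly p y\<bar> * exp (- (2 * c * y\<^sup>2)) \<le> K * exp (- (c * y\<^sup>2))"
proof -
  obtain K where K: "K \<ge> 0" "\<And>y. \<bar>poly p y\<bar> \<le> K * exp (c * y\<^sup>2)"
    using poly_le_exp_square[OF assms, of p] by blast
  have "\<bar>poly p y\<bar> * exp (- (2 * c * y\<^sup>2)) \<le> K * exp (- (c * y\<^sup>2))" for y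
  proof -
    have "\<bar>poly p y\<bar> * exp (- (2 * c * y\<^sup>2)) \<le> K * exp (c * y\<^sup>2) * exp (- (2 * c * y\<^sup>2))"
      using K by (intro mult_right_mono) auto
    also have "\<dots> = K * exp (c * y\<^sup>2 + - (2 * c * y\<^sup>2))"
      by (simp only: exp_add mult.assoc)
    finally show ?thesis
      by simp
  qed
  with K(1) show ?thesis
    by (rule that)
qed

lemma gaussian_le_cauchy_weight:
  assumes "c > 0"
  shows "exp (- (c * y\<^sup>2)) \<le> (1 + 1 / c) * cauchy_weight y"
proof -
  have "1 + y\<^sup>2 \<le> (1 + 1 / c) * (1 + c * y\<^sup>2)"
    using assms by (simp add: field_simps)
  also have "\<dots> \<le> (1 + 1 / c) * exp (c * y\<^sup>2)"
    using assms by (intro mult_left_mono exp_ge_add_one_self) auto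
  finally have "exp (- (c * y\<^sup>2)) * (1 + y\<^sup>2) \<le> exp (- (c * y\<^sup>2)) * ((1 + 1 / c) * exp (c * y\<^sup>2))"
    by (intro mult_left_mono) auto
  also have "\<dots> = 1 + 1 / c"
    by (simp add: exp_minus field_simps)
  finally show ?thesis
    by (simp add: cauchy_weight_def pos_le_divide_eq add_pos_nonneg)
qed

lemma poly_gaussian_le_cauchy_weight:
  fixes p :: "real poly"
  assumes "c > 0"
  obtains C where "\<And>y. \<bar>poly p y\<bar> * exp (- (c * y\<^sup>2)) \<le> C * cauchy_weight y"
proof -
  obtain K where K: "K \<ge> 0" "\<And>y. \<bar>poly p y\<bar> * exp (- (c * y\<^sup>2)) \<le> K * exp (- (c / 2 * y\<^sup>2))"
    using poly_gaussian_le_gaussian[of "c / 2" p] assms by auto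
  have "\<bar>poly p y\<bar> * exp (- (c * y\<^sup>2)) \<le> K * (1 + 1 / (c / 2)) * cauchy_weight y" for y
    using order_trans[OF K(2) mult_left_mono[OF gaussian_le_cauchy_weight K(1)]] assms
    by (simp add: mult.assoc)
  then show ?thesis
    by (rule that)
qed

lemma tendsto_cauchy_weight: "(cauchy_weight \<longlongrightarrow> 0) at_infinity"
proof -
  have "filterlim (\<lambda>y::real. (norm y)\<^sup>2) at_top at_infinity"
    by (intro filterlim_pow_at_top filterlim_norm_at_top) simp
  then have "filterlim (\<lambda>y::real. 1 + y\<^sup>2) at_infinity at_infinity"
    by (intro filterlim_at_top_imp_at_infinity filterlim_tendsto_add_at_top[OF tendsto_const]) simp
  then show ?thesis
    unfolding cauchy_weight_def by (rule tendsto_divide_0[OF tendsto_const])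
qed

lemma has_integral_derivative_vanishing_at_infinity:
  fixes G :: "real \<Rightarrow> 'a :: banach"
  assumes deriv: "\<And>y. (G has_vector_derivative G' y) (at y)" and lim: "(G \<longlongrightarrow> 0) at_infinity"
  shows "(G' has_integral 0) UNIV"
proof -
  have "\<exists>B>0. \<forall>a b. ball 0 B \<subseteq> cbox a b \<longrightarrow> (\<exists>z. (G' has_integral z) (cbox a b) \<and> norm z < e)"
    if "e > 0" for e
  proof -
    have "\<forall>\<^sub>F y in at_infinity. norm (G y) < e / 2"
      using tendstoD[OF lim, of "e / 2"] \<open>e > 0\<close> by simp
    then obtain B0 where B0: "\<And>y. norm y \<ge> B0 \<Longrightarrow> norm (G y) < e / 2"
      unfolding eventually_at_infinity by blast
    define B where "B = max B0 1"
    have B: "B > 0" "\<And>y. norm y \<ge> B \<Longrightarrow> norm (G y) < e / 2"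
      using B0 by (simp_all add: B_def)
    have "\<exists>z. (G' has_integral z) (cbox a b) \<and> norm z < e" if "ball 0 B \<subseteq> cbox a b" for a b
    proof -
      have "cball 0 B \<subseteq> cbox a b"
        using closure_mono[OF that] \<open>B > 0\<close> by (simp add: closure_cbox)
      from subsetD[OF this, of "- B"] subsetD[OF this, of B] have ab: "a \<le> - B" "B \<le> b"
        using \<open>B > 0\<close> by auto
      then have "(G' has_integral (G b - G a)) {a..b}"
        using \<open>B > 0\<close>
        by (intro fundamental_theorem_of_calculus has_vector_derivative_at_within[OF deriv]) linarith
      moreover have "norm (G b - G a) < e"
        using B(2)[of a] B(2)[of b] ab \<open>B > 0\<close> norm_triangle_ineq4[of "G b" "G a"] by simp
      ultimately show ?thesis
        by auto
    qed
    with \<open>B > 0\<close> show ?thesis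
      by blast
  qed
  then show ?thesis
    using UNIV_neq_cbox by (subst has_integral_alt) simp
qed

lemma has_bochner_integral_std_normal_iexp:
  "has_bochner_integral lborel (\<lambda>x. std_normal_density x *\<^sub>R iexp (t * x)) (of_real (exp (- t\<^sup>2 / 2)))"
  (is "has_bochner_integral lborel ?F _")
proof -
  have "integrable lborel ?F"
    by (rule Bochner_Integration.integrable_bound[OF integrable_normal_density[of 1 0]]) auto
  moreover have "integral\<^sup>L lborel ?F = char std_normal_distribution t"
    unfolding char_def by (subst integral_density) (auto simp: normal_density_nonneg)
  ultimately show ?thesis
    by (simp add: has_bochner_integral_iff char_std_normal_distribution)
qed

lemma gaussian_fourier:
  assumes "l > 0"
  shows "((\<lambda>y. of_real (exp (- pi * (l * y)\<^sup>2)) * cis2pi (w * y)) has_integral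
      of_real (exp (- pi * (w / l)\<^sup>2) / l)) UNIV"
proof -
  define t where "t = sqrt (2 * pi) * w / l"
  define c where "c = sqrt (2 * pi) * l"
  have "c > 0"
    using assms by (simp add: c_def)
  define F where "F x = std_normal_density x *\<^sub>R iexp (t * x)" for x
  have "has_bochner_integral lborel F (of_real (exp (- t\<^sup>2 / 2)))"
    unfolding F_def by (rule has_bochner_integral_std_normal_iexp)
  then have "has_bochner_integral lborel (\<lambda>y. F (0 + c * y)) (of_real (exp (- t\<^sup>2 / 2)) /\<^sub>R \<bar>c\<bar>)"
    using \<open>c > 0\<close> by (subst (asm) lborel_has_bochner_integral_real_affine_iff[of c _ _ 0]) auto
  then have "((\<lambda>y. F (0 + c * y)) has_integral of_real (exp (- t\<^sup>2 / 2)) /\<^sub>R \<bar>c\<bar>) UNIV"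
    by (metis has_bochner_integral_iff has_integral_integral_lborel)
  from has_integral_mult_right[OF this, of "of_real (sqrt (2 * pi))"]
  have "((\<lambda>y. of_real (sqrt (2 * pi)) * F (c * y)) has_integral
      of_real (sqrt (2 * pi)) * (of_real (exp (- t\<^sup>2 / 2)) /\<^sub>R \<bar>c\<bar>)) UNIV"
    by simp
  moreover have "of_real (sqrt (2 * pi)) * F (c * y) =
      of_real (exp (- pi * (l * y)\<^sup>2)) * cis2pi (w * y)" for y
  proof -
    have "(c * y)\<^sup>2 / 2 = pi * (l * y)\<^sup>2"
      by (simp add: c_def power_mult_distrib)
    moreover have "t * (c * y) = 2 * pi * (w * y)"
      using assms by (simp add: c_def t_def)
    ultimately show ?thesis
      unfolding F_def cis2pi_def cis_conv_exp std_normal_density_def scaleR_conv_of_real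
        minus_divide_left[symmetric]
      by (simp only:) simp
  qed
  moreover have "of_real (sqrt (2 * pi)) * (of_real (exp (- t\<^sup>2 / 2)) /\<^sub>R \<bar>c\<bar>) =
      (of_real (sqrt (2 * pi) * (exp (- t\<^sup>2 / 2) / c)) :: complex)"
    using \<open>c > 0\<close> by (simp add: scaleR_conv_of_real field_simps)
  moreover have "sqrt (2 * pi) * (exp (- t\<^sup>2 / 2) / c) = exp (- pi * (w / l)\<^sup>2) / l"
    by (simp add: c_def t_def power_divide power_mult_distrib)
  ultimately show ?thesis
    by (simp only:)
qed

primrec hermite_poly :: "nat \<Rightarrow> real poly" where
  "hermite_poly 0 = 1"
| "hermite_poly (Suc n) = [:0, 1:] * hermite_poly n - smult (1 / (2 * pi)) (pderiv (hermite_poly n))"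

definition hermite_gaussian :: "nat \<Rightarrow> real \<Rightarrow> real \<Rightarrow> real \<Rightarrow> real \<Rightarrow> complex" where
  "hermite_gaussian n R l w y =
     of_real (poly (hermite_poly n) (R + l * y) * exp (- pi * (l * y)\<^sup>2)) * cis2pi (w * y)"

definition hermite_gaussian_hat :: "nat \<Rightarrow> real \<Rightarrow> real \<Rightarrow> real \<Rightarrow> complex" where
  "hermite_gaussian_hat n R l w =
     (of_real R + \<i> * of_real (w / l)) ^ n * of_real (exp (- pi * (w / l)\<^sup>2) / l)"

lemma hermite_gaussian_mult_cis2pi:
  "hermite_gaussian n R l w y * cis2pi (v * y) = hermite_gaussian n R l (w + v) y"
  by (simp add: hermite_gaussian_def cis2pi_add distrib_right mult.assoc)

lemma has_vector_derivative_hermite_gaussian: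
  assumes "l \<noteq> 0"
  shows "(hermite_gaussian n R l w has_vector_derivative
    of_real (2 * pi * l) * ((of_real R + \<i> * of_real (w / l)) * hermite_gaussian n R l w y -
      hermite_gaussian (Suc n) R l w y)) (at y)"
proof -
  define h where "h = poly (hermite_poly n) (R + l * y)"
  define h' where "h' = poly (pderiv (hermite_poly n)) (R + l * y)"
  define g where "g = exp (- pi * (l * y)\<^sup>2)"
  have real_factor: "((\<lambda>y. poly (hermite_poly n) (R + l * y) * exp (- pi * (l * y)\<^sup>2)) has_real_derivative
      l * (h' - 2 * pi * l * y * h) * g) (at y)"
    unfolding h_def h'_def g_def
    by (rule derivative_eq_intros DERIV_chain'[OF _ poly_DERIV] refl)+
      (simp add: algebra_simps power2_eq_square)
  have next_poly: "poly (hermite_poly (Suc n)) (R + l * y) = (R + l * y) * h - h' / (2 * pi)"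
    by (simp add: h_def h'_def)
  show ?thesis
    unfolding hermite_gaussian_def[abs_def]
    by (rule has_vector_derivative_eq_rhs[OF has_vector_derivative_mult[OF
            has_vector_derivative_of_real[OF real_factor] has_vector_derivative_cis2pi]],
        unfold next_poly h_def[symmetric] g_def[symmetric])
      (use assms in \<open>simp add: field_simps\<close>)
qed

lemma continuous_on_hermite_gaussian: "continuous_on A (hermite_gaussian n R l w)"
  unfolding hermite_gaussian_def[abs_def] by (intro continuous_intros)

lemma hermite_gaussian_le_cauchy_weight:
  assumes "l \<noteq> 0"
  obtains C where "\<And>y. norm (hermite_gaussian n R l w y) \<le> C * cauchy_weight y"
proof -
  obtain C where "\<And>y. \<bar>poly (hermite_poly n \<circ>\<^sub>p [:R, l:]) y\<bar> * exp (- (pi * l\<^sup>2 * y\<^sup>2)) \<le>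
      C * cauchy_weight y"
    using poly_gaussian_le_cauchy_weight[of "pi * l\<^sup>2" "hermite_poly n \<circ>\<^sub>p [:R, l:]"] assms by auto
  moreover have "poly (hermite_poly n \<circ>\<^sub>p [:R, l:]) y = poly (hermite_poly n) (R + l * y)" for y
    by (simp add: poly_pcompose mult.commute)
  ultimately have "norm (hermite_gaussian n R l w y) \<le> C * cauchy_weight y" for y
    by (simp add: hermite_gaussian_def norm_mult abs_mult power_mult_distrib mult.assoc)
  then show ?thesis
    by (rule that)
qed

lemma hermite_gaussian_hat_le_cauchy_weight:
  assumes "l > 0"
  obtains C where "\<And>w. norm (hermite_gaussian_hat n R l w) \<le> C * cauchy_weight w"
proof -
  define p where "p = [:\<bar>R\<bar>, 1 / l:] ^ n"
  obtain C where C: "\<And>w. \<bar>poly p w\<bar> * exp (- (pi / l\<^sup>2 * w\<^sup>2)) \<le> C * cauchy_weight w"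
    using poly_gaussian_le_cauchy_weight[of "pi / l\<^sup>2" p] assms by auto
  have "norm (hermite_gaussian_hat n R l w) \<le> C / l * cauchy_weight w" for w
  proof -
    have "norm (of_real R + \<i> * of_real (w / l)) \<le> \<bar>R\<bar> + \<bar>w\<bar> / l"
      using assms by (intro norm_triangle_mono) (auto simp: norm_mult norm_divide)
    then have "norm (of_real R + \<i> * of_real (w / l)) ^ n \<le> \<bar>poly p \<bar>w\<bar>\<bar>"
      using assms by (simp add: p_def power_mono)
    then have "norm (hermite_gaussian_hat n R l w) \<le> \<bar>poly p \<bar>w\<bar>\<bar> * exp (- (pi / l\<^sup>2 * \<bar>w\<bar>\<^sup>2)) / l"
      using assms by (simp add: hermite_gaussian_hat_def norm_mult norm_power norm_divide power_divide
          mult_right_mono divide_right_mono)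
    also have "\<dots> \<le> C * cauchy_weight \<bar>w\<bar> / l"
      using assms by (intro divide_right_mono C) auto
    finally show ?thesis
      by (simp add: cauchy_weight_def mult.commute)
  qed
  then show ?thesis
    by (rule that)
qed

lemma hermite_gaussian_fourier:
  assumes "l > 0"
  shows "(hermite_gaussian n R l w has_integral hermite_gaussian_hat n R l w) UNIV"
proof (induction n)
  case 0
  show ?case
    using gaussian_fourier[OF assms, of w]
    by (simp add: hermite_gaussian_def[abs_def] hermite_gaussian_hat_def)
next
  case (Suc n)
  define z where "z = of_real R + \<i> * of_real (w / l)"
  define G' where "G' y = of_real (2 * pi * l) *
    (z * hermite_gaussian n R l w y - hermite_gaussian (Suc n) R l w y)" for y
  obtain C where C: "\<And>y. norm (hermite_gaussian n R l w y) \<le> C * cauchy_weight y"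
    using hermite_gaussian_le_cauchy_weight[of l] assms by blast
  have "(hermite_gaussian n R l w \<longlongrightarrow> 0) at_infinity"
    by (rule Lim_null_comparison[OF always_eventually tendsto_mult_right_zero[OF tendsto_cauchy_weight]])
      (use C in blast)
  then have "(G' has_integral 0) UNIV"
    using has_vector_derivative_hermite_gaussian assms unfolding G'_def z_def
    by (intro has_integral_derivative_vanishing_at_infinity) auto
  from has_integral_diff[OF has_integral_mult_right[OF Suc.IH, of z]
      has_integral_mult_right[OF this, of "1 / of_real (2 * pi * l)"]]
  have "((\<lambda>y. z * hermite_gaussian n R l w y - 1 / of_real (2 * pi * l) * G' y) has_integral
      z * hermite_gaussian_hat n R l w) UNIV"
    by simp
  moreover have "z * hermite_gaussian n R l w y - 1 / of_real (2 * pi * l) * G' y =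
      hermite_gaussian (Suc n) R l w y" for y
    using assms by (simp add: G'_def)
  ultimately show ?case
    by (simp add: hermite_gaussian_hat_def z_def mult.assoc)
qed

theorem hermite_gaussian_poisson:
  assumes "l > 0"
  shows "(\<Sum>\<^sub>\<infinity>m. hermite_gaussian n R l \<xi> (a + of_int m)) =
    (\<Sum>\<^sub>\<infinity>k. hermite_gaussian_hat n R l (\<xi> + of_int k) * cis2pi (- (a * of_int k)))"
proof -
  let ?\<psi> = "\<lambda>k. hermite_gaussian_hat n R l (\<xi> - of_int k)"
  obtain C where C: "\<And>y. norm (hermite_gaussian n R l \<xi> y) \<le> C * cauchy_weight y"
    using hermite_gaussian_le_cauchy_weight[of l] assms by blast
  obtain D where D: "\<And>w. norm (hermite_gaussian_hat n R l w) \<le> D * cauchy_weight w"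
    using hermite_gaussian_hat_le_cauchy_weight[OF assms] by blast
  have "(\<lambda>k. D * cauchy_weight (- \<xi> + of_int k)) summable_on UNIV"
    by (intro summable_on_cmult_right summable_on_cauchy_weight_shift)
  moreover have "norm (?\<psi> k) \<le> D * cauchy_weight (- \<xi> + of_int k)" for k
    using D[of "\<xi> - of_int k"] by (simp add: cauchy_weight_def power2_commute)
  ultimately have "?\<psi> summable_on UNIV"
    by (rule abs_summable_summable[OF Infinite_Sum.abs_summable_on_comparison_test'])
  moreover have "((\<lambda>y. hermite_gaussian n R l \<xi> y * cis2pi (- (of_int k * y)))
      has_integral ?\<psi> k) UNIV" for k
    using hermite_gaussian_fourier[OF assms, of n R "\<xi> - of_int k"]
      hermite_gaussian_mult_cis2pi[of n R l \<xi> _ "- of_int k"] by simp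
  ultimately have "(\<Sum>\<^sub>\<infinity>m. hermite_gaussian n R l \<xi> (a + of_int m)) =
      (\<Sum>\<^sub>\<infinity>k. ?\<psi> k * cis2pi (of_int k * a))"
    by (intro poisson_summation[OF continuous_on_hermite_gaussian C])
  also have "\<dots> = (\<Sum>\<^sub>\<infinity>k. ?\<psi> (- k) * cis2pi (of_int (- k) * a))"
    by (rule infsum_reindex_bij_betw[OF bij_uminus, symmetric])
  finally show ?thesis
    by (simp add: mult.commute)
qed

section \<open>Sums over the plane lattice\<close>

definition lattice_sum :: "real \<Rightarrow> real \<Rightarrow> (real \<Rightarrow> real \<Rightarrow> complex) \<Rightarrow> complex" where
  "lattice_sum a1 a2 f = (\<Sum>\<^sub>\<infinity>p::int \<times> int. f (a1 + of_int (fst p)) (a2 + of_int (snd p)))"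

definition cauchy_dominated :: "(real \<Rightarrow> real \<Rightarrow> complex) \<Rightarrow> bool" where
  "cauchy_dominated f \<longleftrightarrow> (\<exists>C. \<forall>x y. norm (f x y) \<le> C * (cauchy_weight x * cauchy_weight y))"

lemma cauchy_dominated_mult_cis2pi:
  "cauchy_dominated f \<Longrightarrow> cauchy_dominated (\<lambda>x y. f x y * cis2pi (g x y))"
  by (simp add: cauchy_dominated_def norm_mult)

lemma summable_on_cauchy_weight_pairs:
  "(\<lambda>p::int \<times> int. C * (cauchy_weight (a1 + of_int (fst p)) * cauchy_weight (a2 + of_int (snd p))))
     summable_on UNIV"
proof -
  have "(\<lambda>p::int \<times> int. cauchy_weight (a1 + of_int (fst p)) * cauchy_weight (a2 + of_int (snd p)))
      summable_on UNIV \<times> UNIV"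
  proof (rule summable_on_SigmaI)
    fix m :: int
    show "((\<lambda>k. cauchy_weight (a1 + of_int (fst (m, k))) * cauchy_weight (a2 + of_int (snd (m, k)))) has_sum
        cauchy_weight (a1 + of_int m) * (\<Sum>\<^sub>\<infinity>k. cauchy_weight (a2 + of_int k))) UNIV"
      unfolding fst_conv snd_conv
      by (intro has_sum_cmult_right has_sum_infsum summable_on_cauchy_weight_shift)
    show "(\<lambda>m. cauchy_weight (a1 + of_int m) * (\<Sum>\<^sub>\<infinity>k. cauchy_weight (a2 + of_int k))) summable_on UNIV"
      by (intro summable_on_cmult_left summable_on_cauchy_weight_shift)
  qed (simp add: cauchy_weight_nonneg)
  then show ?thesis
    by (intro summable_on_cmult_right) simp
qed

lemma cauchy_dominated_imp_abs_summable:
  assumes "cauchy_dominated f"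
  shows "(\<lambda>p::int \<times> int. norm (f (a1 + of_int (fst p)) (a2 + of_int (snd p)))) summable_on UNIV"
proof -
  obtain C where "\<And>x y. norm (f x y) \<le> C * (cauchy_weight x * cauchy_weight y)"
    using assms by (auto simp: cauchy_dominated_def)
  then show ?thesis
    by (rule Infinite_Sum.abs_summable_on_comparison_test'[OF summable_on_cauchy_weight_pairs])
qed

lemma lattice_sum_eq_iterated:
  assumes "cauchy_dominated f"
  shows "lattice_sum a1 a2 f = (\<Sum>\<^sub>\<infinity>m. \<Sum>\<^sub>\<infinity>k. f (a1 + of_int m) (a2 + of_int k))"
proof -
  have "(\<lambda>(m, k). f (a1 + of_int m) (a2 + of_int k)) summable_on UNIV \<times> UNIV"
    using abs_summable_summable[OF cauchy_dominated_imp_abs_summable[OF assms]]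
    by (simp add: case_prod_unfold)
  from infsum_Sigma'_banach[OF this] show ?thesis
    by (simp add: lattice_sum_def case_prod_unfold)
qed

lemma iterated_lattice_sum_swap:
  assumes "cauchy_dominated f"
  shows "(\<Sum>\<^sub>\<infinity>m. \<Sum>\<^sub>\<infinity>k. f (a1 + of_int m) (a2 + of_int k)) =
    (\<Sum>\<^sub>\<infinity>k. \<Sum>\<^sub>\<infinity>m. f (a1 + of_int m) (a2 + of_int k))"
proof (rule infsum_swap_banach)
  show "(\<lambda>(m, k). f (a1 + of_int m) (a2 + of_int k)) summable_on UNIV \<times> UNIV"
    using abs_summable_summable[OF cauchy_dominated_imp_abs_summable[OF assms]]
    by (simp add: case_prod_unfold)
qed

section \<open>Positive definite kernels\<close>

text \<open>
  The parameter \<open>s\<close> is the rapidity of the vector \<open>(- exp (- s), exp s)\<close> on the hyperbola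
  \<open>Q1 c = - 1\<close>; \<open>siegel_kernel\<close> is the Fourier transform of \<open>gauss_kernel\<close> in the variable \<open>y\<close>.
\<close>

definition gauss_kernel :: "nat \<Rightarrow> real \<Rightarrow> complex \<Rightarrow> real \<Rightarrow> real \<Rightarrow> real \<Rightarrow> real \<Rightarrow> complex" where
  "gauss_kernel n s \<tau> b1 b2 x y =
     of_real (sqrt (Im \<tau>) / sqrt (Im \<tau>) ^ n *
       poly (hermite_poly n) (sqrt (Im \<tau>) * (exp s * x + exp (- s) * y)) *
       exp (- pi * Im \<tau> * ((exp s * x)\<^sup>2 + (exp (- s) * y)\<^sup>2))) *
     cis2pi (Re \<tau> * x * y + x * b2 + y * b1)"

definition siegel_kernel :: "nat \<Rightarrow> real \<Rightarrow> complex \<Rightarrow> real \<Rightarrow> real \<Rightarrow> complex" where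
  "siegel_kernel n s \<tau> x \<eta> = ((cnj \<tau> * of_real x + of_real \<eta>) / of_real (Im \<tau>)) ^ n *
     of_real (exp (- pi * (exp s)\<^sup>2 * (norm (\<tau> * of_real x + of_real \<eta>))\<^sup>2 / Im \<tau>))"

lemma gauss_kernel_le_gaussian:
  assumes v: "Im \<tau> > 0"
  obtains K where "K \<ge> 0" "\<And>s b1 b2 x y. norm (gauss_kernel n s \<tau> b1 b2 x y) \<le>
    K * exp (- (pi / 2 * Im \<tau> * ((exp s * x)\<^sup>2 + (exp (- s) * y)\<^sup>2)))"
proof -
  let ?v = "Im \<tau>"
  obtain K where K: "K \<ge> 0" "\<And>z. \<bar>poly (hermite_poly n) z\<bar> \<le> K * exp (pi / 4 * z\<^sup>2)"
    using poly_le_exp_square[of "pi / 4" "hermite_poly n"] by auto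
  define A where "A = sqrt ?v / sqrt ?v ^ n"
  have "A \<ge> 0"
    using v by (simp add: A_def)
  have "norm (gauss_kernel n s \<tau> b1 b2 x y) \<le>
      A * K * exp (- (pi / 2 * ?v * ((exp s * x)\<^sup>2 + (exp (- s) * y)\<^sup>2)))" for s b1 b2 x y
  proof -
    define X where "X = ?v * ((exp s * x)\<^sup>2 + (exp (- s) * y)\<^sup>2)"
    define z where "z = sqrt ?v * (exp s * x + exp (- s) * y)"
    have "(exp s * x + exp (- s) * y)\<^sup>2 \<le> 2 * ((exp s * x)\<^sup>2 + (exp (- s) * y)\<^sup>2)"
      using sum_squares_bound[of "exp s * x" "exp (- s) * y"] by (simp add: power2_sum)
    from mult_left_mono[OF this, of ?v] v have "z\<^sup>2 \<le> 2 * X"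
      by (simp add: z_def X_def power_mult_distrib)
    then have "K * exp (pi / 4 * z\<^sup>2) \<le> K * exp (pi / 2 * X)"
      using K(1) by (intro mult_left_mono) auto
    with K(2)[of z] have "\<bar>poly (hermite_poly n) z\<bar> \<le> K * exp (pi / 2 * X)"
      by (rule order_trans)
    then have "A * (\<bar>poly (hermite_poly n) z\<bar> * exp (- (pi * X))) \<le>
        A * (K * exp (pi / 2 * X) * exp (- (pi * X)))"
      using \<open>A \<ge> 0\<close> by (intro mult_left_mono mult_right_mono) auto
    also have "\<dots> = A * K * exp (pi / 2 * X + - (pi * X))"
      by (simp only: exp_add mult.assoc)
    finally show ?thesis
      using v
        by (simp add: gauss_kernel_def norm_mult norm_divide norm_power abs_mult A_def X_def z_def mult.assoc)
  qed
  moreover have "A * K \<ge> 0"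
    using \<open>A \<ge> 0\<close> K(1) by simp
  ultimately show ?thesis
    using that by blast
qed

lemma gauss_kernel_le_cauchy_weight:
  assumes v: "Im \<tau> > 0"
  obtains C where "\<And>s b1 b2 x y. \<bar>s\<bar> \<le> S \<Longrightarrow>
    norm (gauss_kernel n s \<tau> b1 b2 x y) \<le> C * (cauchy_weight x * cauchy_weight y)"
proof -
  obtain K where K: "K \<ge> 0" "\<And>s b1 b2 x y. norm (gauss_kernel n s \<tau> b1 b2 x y) \<le>
      K * exp (- (pi / 2 * Im \<tau> * ((exp s * x)\<^sup>2 + (exp (- s) * y)\<^sup>2)))"
    using gauss_kernel_le_gaussian[OF v, of n] by blast
  define c where "c = pi / 2 * Im \<tau> * (exp (- S))\<^sup>2"
  have "c > 0"
    using v by (simp add: c_def)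
  have "norm (gauss_kernel n s \<tau> b1 b2 x y) \<le>
      K * (1 + 1 / c)\<^sup>2 * (cauchy_weight x * cauchy_weight y)" if "\<bar>s\<bar> \<le> S" for s b1 b2 x y
  proof -
    have "(exp (- S))\<^sup>2 * (x\<^sup>2 + y\<^sup>2) \<le> (exp s * x)\<^sup>2 + (exp (- s) * y)\<^sup>2"
      unfolding distrib_left power_mult_distrib
      using that by (intro add_mono mult_right_mono power_mono) auto
    from mult_left_mono[OF this, of "pi / 2 * Im \<tau>"]
    have "c * x\<^sup>2 + c * y\<^sup>2 \<le> pi / 2 * Im \<tau> * ((exp s * x)\<^sup>2 + (exp (- s) * y)\<^sup>2)"
      using v by (simp only: c_def distrib_left mult.assoc) simp
    then have "K * exp (- (pi / 2 * Im \<tau> * ((exp s * x)\<^sup>2 + (exp (- s) * y)\<^sup>2))) \<le>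
        K * exp (- (c * x\<^sup>2) + - (c * y\<^sup>2))"
      using K(1) by (intro mult_left_mono) auto
    also have "\<dots> \<le> K * (((1 + 1 / c) * cauchy_weight x) * ((1 + 1 / c) * cauchy_weight y))"
      unfolding exp_add using \<open>c > 0\<close> K(1) cauchy_weight_nonneg
      by (intro mult_left_mono mult_mono gaussian_le_cauchy_weight) auto
    finally show ?thesis
      using K(2)[of s b1 b2 x y] by (simp add: power2_eq_square mult_ac)
  qed
  then show ?thesis
    by (rule that)
qed

lemma cauchy_dominated_gauss_kernel:
  assumes "Im \<tau> > 0"
  shows "cauchy_dominated (gauss_kernel n s \<tau> b1 b2)"
proof -
  obtain C where "\<And>r b1 b2 x y. \<bar>r\<bar> \<le> \<bar>s\<bar> \<Longrightarrow>
      norm (gauss_kernel n r \<tau> b1 b2 x y) \<le> C * (cauchy_weight x * cauchy_weight y)"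
    using gauss_kernel_le_cauchy_weight[OF assms, of "\<bar>s\<bar>" n] by metis
  then show ?thesis
    unfolding cauchy_dominated_def by blast
qed

lemma square_sum_le_norm_linear_form:
  assumes v: "Im \<tau> > 0"
  obtains L where "L > 0" "\<And>x \<eta>. x\<^sup>2 + \<eta>\<^sup>2 \<le> L * (norm (\<tau> * of_real x + of_real \<eta>))\<^sup>2"
proof -
  define L where "L = (1 / Im \<tau>)\<^sup>2 + (1 + norm \<tau> / Im \<tau>)\<^sup>2"
  have "x\<^sup>2 + \<eta>\<^sup>2 \<le> L * (norm (\<tau> * of_real x + of_real \<eta>))\<^sup>2" for x \<eta>
  proof -
    define z where "z = \<tau> * of_real x + of_real \<eta>"
    have "\<bar>x\<bar> * Im \<tau> = \<bar>Im z\<bar>"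
      using v by (simp add: z_def abs_mult)
    then have x: "\<bar>x\<bar> \<le> 1 / Im \<tau> * norm z"
      using v abs_Im_le_cmod[of z] by (simp add: pos_le_divide_eq)
    have "\<bar>\<eta>\<bar> = norm (z - \<tau> * of_real x)"
      by (simp add: z_def)
    also have "\<dots> \<le> norm z + norm \<tau> * \<bar>x\<bar>"
      by (rule order_trans[OF norm_triangle_ineq4]) (simp add: norm_mult)
    also have "\<dots> \<le> norm z + norm \<tau> * (1 / Im \<tau> * norm z)"
      by (intro add_left_mono mult_left_mono x norm_ge_zero)
    also have "\<dots> = (1 + norm \<tau> / Im \<tau>) * norm z"
      by (simp add: distrib_right)
    finally have "\<bar>\<eta>\<bar> \<le> (1 + norm \<tau> / Im \<tau>) * norm z" .
    from add_mono[OF power_mono[OF x abs_ge_zero, of 2] power_mono[OF this abs_ge_zero, of 2]]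
    show ?thesis
      by (simp only: L_def z_def power_mult_distrib power2_abs distrib_right[of "(1 / Im \<tau>)\<^sup>2"])
  qed
  moreover have "L > 0"
    using v by (simp add: L_def add_pos_nonneg)
  ultimately show ?thesis
    using that by blast
qed

lemma cauchy_dominated_siegel_kernel:
  assumes v: "Im \<tau> > 0"
  shows "cauchy_dominated (siegel_kernel n s \<tau>)"
proof -
  let ?z = "\<lambda>x \<eta>. norm (\<tau> * of_real x + of_real \<eta>)"
  define c where "c = pi * (exp s)\<^sup>2 / Im \<tau> / 2"
  obtain K where K: "K \<ge> 0" "\<And>z. \<bar>poly (monom 1 n) z\<bar> * exp (- (2 * c * z\<^sup>2)) \<le> K * exp (- (c * z\<^sup>2))"
    using poly_gaussian_le_gaussian[of c "monom 1 n"] v by (auto simp: c_def)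
  obtain L where L: "L > 0" "\<And>x \<eta>. x\<^sup>2 + \<eta>\<^sup>2 \<le> L * (?z x \<eta>)\<^sup>2"
    using square_sum_le_norm_linear_form[OF v] by blast
  define e where "e = c / L"
  have "e > 0"
    using v L(1) by (simp add: e_def c_def)
  define A where "A = (1 / Im \<tau>) ^ n"
  have "A \<ge> 0"
    using v by (simp add: A_def)
  have "norm (siegel_kernel n s \<tau> x \<eta>) \<le>
      A * K * (1 + 1 / e)\<^sup>2 * (cauchy_weight x * cauchy_weight \<eta>)" for x \<eta>
  proof -
    have "norm (cnj \<tau> * of_real x + of_real \<eta>) = ?z x \<eta>"
      using complex_mod_cnj[of "\<tau> * of_real x + of_real \<eta>"] by simp
    then have "norm (siegel_kernel n s \<tau> x \<eta>) = A * (?z x \<eta> ^ n * exp (- (2 * c * (?z x \<eta>)\<^sup>2)))"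
      using v by (simp add: siegel_kernel_def norm_mult norm_power norm_divide A_def c_def power_divide)
    also have "\<dots> \<le> A * (K * exp (- (c * (?z x \<eta>)\<^sup>2)))"
      using K(2)[of "?z x \<eta>"] \<open>A \<ge> 0\<close> by (intro mult_left_mono) (auto simp: poly_monom)
    also have "\<dots> \<le> A * (K * exp (- (e * x\<^sup>2) + - (e * \<eta>\<^sup>2)))"
    proof -
      have "e * (x\<^sup>2 + \<eta>\<^sup>2) \<le> e * (L * (?z x \<eta>)\<^sup>2)"
        using L(2) \<open>e > 0\<close> by (intro mult_left_mono) auto
      then have "e * x\<^sup>2 + e * \<eta>\<^sup>2 \<le> c * (?z x \<eta>)\<^sup>2"
        using L(1) by (simp add: e_def distrib_left)
      then show ?thesis
        using \<open>A \<ge> 0\<close> K(1) by (intro mult_left_mono) auto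
    qed
    also have "\<dots> \<le> A * (K * (((1 + 1 / e) * cauchy_weight x) * ((1 + 1 / e) * cauchy_weight \<eta>)))"
      unfolding exp_add using \<open>e > 0\<close> \<open>A \<ge> 0\<close> K(1) cauchy_weight_nonneg
      by (intro mult_left_mono mult_mono gaussian_le_cauchy_weight) auto
    finally show ?thesis
      by (simp add: power2_eq_square mult_ac)
  qed
  then show ?thesis
    unfolding cauchy_dominated_def by blast
qed

lemma gauss_kernel_eq_hermite_gaussian:
  assumes v: "Im \<tau> > 0"
  shows "gauss_kernel n s \<tau> b1 b2 x y =
    of_real (sqrt (Im \<tau>) / sqrt (Im \<tau>) ^ n * exp (- pi * Im \<tau> * (exp s * x)\<^sup>2)) * cis2pi (x * b2) *
    hermite_gaussian n (sqrt (Im \<tau>) * (exp s * x)) (sqrt (Im \<tau>) * exp (- s)) (Re \<tau> * x + b1) y"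
proof -
  have "- pi * Im \<tau> * ((exp s * x)\<^sup>2 + (exp (- s) * y)\<^sup>2) =
      - pi * Im \<tau> * (exp s * x)\<^sup>2 + - pi * (sqrt (Im \<tau>) * exp (- s) * y)\<^sup>2"
    using v by (simp add: power_mult_distrib algebra_simps)
  then have gaussian: "exp (- pi * Im \<tau> * ((exp s * x)\<^sup>2 + (exp (- s) * y)\<^sup>2)) =
      exp (- pi * Im \<tau> * (exp s * x)\<^sup>2) * exp (- pi * (sqrt (Im \<tau>) * exp (- s) * y)\<^sup>2)"
    by (simp only: exp_add)
  have phase: "cis2pi (Re \<tau> * x * y + x * b2 + y * b1) = cis2pi (x * b2) * cis2pi ((Re \<tau> * x + b1) * y)"
    unfolding cis2pi_add[symmetric] by (simp add: algebra_simps)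
  have argument: "sqrt (Im \<tau>) * (exp s * x + exp (- s) * y) =
      sqrt (Im \<tau>) * (exp s * x) + sqrt (Im \<tau>) * exp (- s) * y"
    by (simp add: algebra_simps)
  show ?thesis
    unfolding gauss_kernel_def hermite_gaussian_def gaussian phase argument of_real_mult
    by (simp only: mult_ac)
qed

lemma hermite_gaussian_hat_eq_siegel_kernel:
  assumes v: "Im \<tau> > 0"
  shows "of_real (sqrt (Im \<tau>) / sqrt (Im \<tau>) ^ n * exp (- pi * Im \<tau> * (exp s * x)\<^sup>2)) *
      hermite_gaussian_hat n (sqrt (Im \<tau>) * (exp s * x)) (sqrt (Im \<tau>) * exp (- s)) (Re \<tau> * x + \<eta>) =
    of_real (exp s) * (\<i> * of_real (exp s)) ^ n * siegel_kernel n s \<tau> x \<eta>"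
proof -
  define r where "r = sqrt (Im \<tau>)"
  define p where "p = exp s"
  define w where "w = Re \<tau> * x + \<eta>"
  define z where "z = cnj \<tau> * of_real x + of_real \<eta>"
  have r: "r > 0" "r * r = Im \<tau>" and p: "p > 0" "exp (- s) = 1 / p"
    using v by (simp_all add: r_def p_def exp_minus inverse_eq_divide)
  have base: "of_real (r * (p * x)) + \<i> * of_real (w / (r * (1 / p))) = \<i> * of_real p * (z / of_real r)"
    using r p by (simp add: complex_eq_iff z_def w_def field_simps)
  have "- pi * p\<^sup>2 * (w\<^sup>2 + (r * r * x)\<^sup>2) / (r * r) =
      - pi * (r * r) * (p * x)\<^sup>2 + - pi * (w / (r * (1 / p)))\<^sup>2"
    using r(1) p(1) by (simp add: field_simps power2_eq_square)
  moreover have "(norm (\<tau> * of_real x + of_real \<eta>))\<^sup>2 = w\<^sup>2 + (Im \<tau> * x)\<^sup>2"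
    by (simp add: cmod_power2 w_def)
  ultimately have "- pi * p\<^sup>2 * (norm (\<tau> * of_real x + of_real \<eta>))\<^sup>2 / Im \<tau> =
      - pi * Im \<tau> * (p * x)\<^sup>2 + - pi * (w / (r * (1 / p)))\<^sup>2"
    by (simp only: r(2))
  then have gaussian: "exp (- pi * p\<^sup>2 * (norm (\<tau> * of_real x + of_real \<eta>))\<^sup>2 / Im \<tau>) =
      exp (- pi * Im \<tau> * (p * x)\<^sup>2) * exp (- pi * (w / (r * (1 / p)))\<^sup>2)"
    by (simp only: exp_add)
  have power: "(z / of_real (Im \<tau>)) ^ n = (z / of_real r) ^ n / of_real r ^ n"
    by (simp add: r(2)[symmetric] power_divide power_mult_distrib)
  have "of_real (r / r ^ n * g) * ((\<i> * of_real p * u) ^ n * of_real (g' / (r * (1 / p)))) =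
      of_real p * (\<i> * of_real p) ^ n * (u ^ n / of_real r ^ n * of_real (g * g'))" for g g' u
    using r(1) p(1) by (simp add: power_mult_distrib)
  then show ?thesis
    unfolding hermite_gaussian_hat_def siegel_kernel_def p r_def[symmetric] p_def[symmetric] w_def[symmetric]
      z_def[symmetric] base gaussian power .
qed

lemma gauss_kernel_poisson:
  assumes v: "Im \<tau> > 0"
  shows "(\<Sum>\<^sub>\<infinity>k. gauss_kernel n s \<tau> b1 b2 x (a2 + of_int k)) =
    of_real (exp s) * (\<i> * of_real (exp s)) ^ n *
    (\<Sum>\<^sub>\<infinity>k. siegel_kernel n s \<tau> x (b1 + of_int k) * cis2pi (x * b2 - a2 * of_int k))"
proof -
  let ?A = "of_real (sqrt (Im \<tau>) / sqrt (Im \<tau>) ^ n * exp (- pi * Im \<tau> * (exp s * x)\<^sup>2)) :: complex"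
  let ?hat = "hermite_gaussian_hat n (sqrt (Im \<tau>) * (exp s * x)) (sqrt (Im \<tau>) * exp (- s))"
  have "(\<Sum>\<^sub>\<infinity>k. gauss_kernel n s \<tau> b1 b2 x (a2 + of_int k)) =
      ?A * cis2pi (x * b2) * (\<Sum>\<^sub>\<infinity>k. ?hat (Re \<tau> * x + b1 + of_int k) * cis2pi (- (a2 * of_int k)))"
    using v by (simp only: gauss_kernel_eq_hermite_gaussian infsum_cmult_right')
      (subst hermite_gaussian_poisson, simp_all)
  also have "\<dots> = (\<Sum>\<^sub>\<infinity>k. (?A * ?hat (Re \<tau> * x + (b1 + of_int k))) * cis2pi (x * b2 - a2 * of_int k))"
    unfolding infsum_cmult_right'[symmetric] diff_conv_add_uminus cis2pi_add
    by (simp only: mult_ac add.assoc)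
  finally show ?thesis
    unfolding hermite_gaussian_hat_eq_siegel_kernel[OF v] by (simp only: mult.assoc infsum_cmult_right')
qed

lemma Im_inversion: "Im (- 1 / \<tau>) = Im \<tau> / (norm \<tau>)\<^sup>2"
  by (simp add: Im_divide cmod_power2)

lemma Im_inversion_pos: "Im \<tau> > 0 \<Longrightarrow> Im (- 1 / \<tau>) > 0"
  unfolding Im_inversion by (intro divide_pos_pos) auto

lemma siegel_kernel_inversion:
  assumes v: "Im \<tau> > 0"
  shows "siegel_kernel n s (- 1 / \<tau>) x \<eta> = (- \<tau>) ^ n * siegel_kernel n s \<tau> (- \<eta>) x"
proof -
  have "\<tau> \<noteq> 0"
    using v by auto
  have "(- 1 / c * of_real x + of_real \<eta>) / (V / (\<tau> * c)) = - \<tau> * ((c * of_real (- \<eta>) + of_real x) / V)"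
    if "c \<noteq> 0" "V \<noteq> 0" for c V
    using that \<open>\<tau> \<noteq> 0\<close> by (simp add: field_simps)
  moreover have "of_real (Im (- 1 / \<tau>)) = of_real (Im \<tau>) / (\<tau> * cnj \<tau>)"
    unfolding Im_inversion by (simp only: of_real_divide complex_norm_square)
  ultimately have linear_form: "(cnj (- 1 / \<tau>) * of_real x + of_real \<eta>) / of_real (Im (- 1 / \<tau>)) =
      - \<tau> * ((cnj \<tau> * of_real (- \<eta>) + of_real x) / of_real (Im \<tau>))"
    using \<open>\<tau> \<noteq> 0\<close> v by (simp only: complex_cnj_divide complex_cnj_minus complex_cnj_one) simp
  have "- 1 / \<tau> * of_real x + of_real \<eta> = - ((\<tau> * of_real (- \<eta>) + of_real x) / \<tau>)"
    using \<open>\<tau> \<noteq> 0\<close> by (simp add: field_simps)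
  then have "norm (- 1 / \<tau> * of_real x + of_real \<eta>) = norm (\<tau> * of_real (- \<eta>) + of_real x) / norm \<tau>"
    by (simp only: norm_minus_cancel norm_divide)
  then have "(norm (- 1 / \<tau> * of_real x + of_real \<eta>))\<^sup>2 / Im (- 1 / \<tau>) =
      (norm (\<tau> * of_real (- \<eta>) + of_real x))\<^sup>2 / Im \<tau>"
    unfolding Im_inversion using \<open>\<tau> \<noteq> 0\<close> v by (simp add: power_divide)
  then show ?thesis
    unfolding siegel_kernel_def linear_form power_mult_distrib times_divide_eq_right[symmetric]
    by (simp only: mult.assoc)
qed

theorem gauss_kernel_lattice_sum_inversion:
  assumes v: "Im \<tau> > 0"
  shows "lattice_sum a1 a2 (gauss_kernel n s (- 1 / \<tau>) b1 b2) =
    (- \<tau>) ^ n * cis2pi (a1 * b2 + a2 * b1) * lattice_sum (- b1) (- b2) (gauss_kernel n s \<tau> a1 a2)"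
proof -
  let ?c = "of_real (exp s) * (\<i> * of_real (exp s)) ^ n"
  let ?F = "\<lambda>x \<eta>. siegel_kernel n s \<tau> x \<eta> * cis2pi (x * a2 + b2 * (\<eta> - a1))"
  have poisson: "lattice_sum d1 d2 (gauss_kernel n s t e1 e2) =
      ?c * (\<Sum>\<^sub>\<infinity>m. \<Sum>\<^sub>\<infinity>k. siegel_kernel n s t (d1 + of_int m) (e1 + of_int k) *
        cis2pi ((d1 + of_int m) * e2 - d2 * of_int k))" if "Im t > 0" for t d1 d2 e1 e2
    unfolding lattice_sum_eq_iterated[OF cauchy_dominated_gauss_kernel[OF that]]
      gauss_kernel_poisson[OF that] infsum_cmult_right' ..
  have summand: "siegel_kernel n s (- 1 / \<tau>) (a1 + of_int m) (b1 + of_int k) *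
      cis2pi ((a1 + of_int m) * b2 - a2 * of_int k) =
      (- \<tau>) ^ n * cis2pi (a1 * b2 + a2 * b1) * ?F (- b1 + of_int (- k)) (a1 + of_int m)" for m k
  proof -
    have "cis2pi ((a1 + of_int m) * b2 - a2 * of_int k) =
        cis2pi (a1 * b2 + a2 * b1) * cis2pi ((- b1 + of_int (- k)) * a2 + b2 * (a1 + of_int m - a1))"
      unfolding cis2pi_add[symmetric] by (simp add: algebra_simps)
    moreover have "- (b1 + of_int k) = - b1 + of_int (- k)"
      by simp
    ultimately show ?thesis
      by (simp only: siegel_kernel_inversion[OF v] mult_ac)
  qed
  have "lattice_sum a1 a2 (gauss_kernel n s (- 1 / \<tau>) b1 b2) =
      (- \<tau>) ^ n * cis2pi (a1 * b2 + a2 * b1) *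
        (?c * (\<Sum>\<^sub>\<infinity>m. \<Sum>\<^sub>\<infinity>k. ?F (- b1 + of_int (- k)) (a1 + of_int m)))"
    unfolding poisson[OF Im_inversion_pos[OF v]] summand infsum_cmult_right' by (simp only: mult_ac)
  also have "(\<Sum>\<^sub>\<infinity>m. \<Sum>\<^sub>\<infinity>k. ?F (- b1 + of_int (- k)) (a1 + of_int m)) =
      (\<Sum>\<^sub>\<infinity>m. \<Sum>\<^sub>\<infinity>k. ?F (- b1 + of_int k) (a1 + of_int m))"
    by (rule infsum_cong) (rule infsum_reindex_bij_betw[OF bij_uminus])
  also have "\<dots> = (\<Sum>\<^sub>\<infinity>k. \<Sum>\<^sub>\<infinity>m. ?F (- b1 + of_int k) (a1 + of_int m))"
    by (rule iterated_lattice_sum_swap[where f = ?F, symmetric])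
      (intro cauchy_dominated_mult_cis2pi cauchy_dominated_siegel_kernel v)
  also have "?c * \<dots> = lattice_sum (- b1) (- b2) (gauss_kernel n s \<tau> a1 a2)"
    unfolding poisson[OF v] by simp
  finally show ?thesis .
qed

section \<open>Theta series of one block\<close>

definition block_density :: "nat \<Rightarrow> nat \<Rightarrow> real \<Rightarrow> real \<Rightarrow> real \<Rightarrow> real" where
  "block_density \<alpha> \<beta> s x y = 2 / 2 ^ (\<alpha> + \<beta>) * exp (s * (real \<beta> - real \<alpha>)) *
     poly (hermite_poly (Suc (\<alpha> + \<beta>))) (exp s * x + exp (- s) * y) *
     exp (- pi * (exp s * x - exp (- s) * y)\<^sup>2)"

text \<open>
  The straight path makes the integral from \<open>s1\<close> to \<open>s0\<close> oriented, so that no case distinction on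
  the order of \<open>s0\<close> and \<open>s1\<close> is needed.
\<close>

definition block_integral :: "real \<Rightarrow> real \<Rightarrow> nat \<Rightarrow> nat \<Rightarrow> real \<Rightarrow> real \<Rightarrow> real" where
  "block_integral s0 s1 \<alpha> \<beta> x y =
     integral {0..1} (\<lambda>t. (s0 - s1) * block_density \<alpha> \<beta> (linepath s1 s0 t) x y)"

definition theta_block_term ::
    "real \<Rightarrow> real \<Rightarrow> nat \<Rightarrow> nat \<Rightarrow> complex \<Rightarrow> real \<Rightarrow> real \<Rightarrow> real \<Rightarrow> real \<Rightarrow> complex" where
  "theta_block_term s0 s1 \<alpha> \<beta> \<tau> b1 b2 x y =
     of_real (block_integral s0 s1 \<alpha> \<beta> (sqrt (Im \<tau>) * x) (sqrt (Im \<tau>) * y) / sqrt (Im \<tau>) ^ (\<alpha> + \<beta>)) *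
     exp (2 * of_real pi * \<i> * of_real (x * y) * \<tau>) * cis2pi (x * b2 + y * b1)"

definition theta_block ::
    "real \<Rightarrow> real \<Rightarrow> nat \<Rightarrow> nat \<Rightarrow> complex \<Rightarrow> real \<Rightarrow> real \<Rightarrow> real \<Rightarrow> real \<Rightarrow> complex" where
  "theta_block s0 s1 \<alpha> \<beta> \<tau> a1 a2 b1 b2 = lattice_sum a1 a2 (theta_block_term s0 s1 \<alpha> \<beta> \<tau> b1 b2)"

definition path_weight :: "real \<Rightarrow> real \<Rightarrow> nat \<Rightarrow> nat \<Rightarrow> real \<Rightarrow> real" where
  "path_weight s0 s1 \<alpha> \<beta> t =
     (s0 - s1) * (2 / 2 ^ (\<alpha> + \<beta>) * exp (linepath s1 s0 t * (real \<beta> - real \<alpha>)))"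

lemma continuous_on_block_density [continuous_intros]:
  assumes "continuous_on A f" "continuous_on A g" "continuous_on A h"
  shows "continuous_on A (\<lambda>t. block_density \<alpha> \<beta> (f t) (g t) (h t))"
  unfolding block_density_def using assms by (intro continuous_intros) auto

lemma continuous_on_gauss_kernel [continuous_intros]:
  "continuous_on A f \<Longrightarrow> continuous_on A (\<lambda>t. gauss_kernel n (f t) \<tau> b1 b2 x y)"
  unfolding gauss_kernel_def by (intro continuous_intros)

lemma continuous_on_path_weight [continuous_intros]: "continuous_on A (path_weight s0 s1 \<alpha> \<beta>)"
  unfolding path_weight_def[abs_def] by (intro continuous_intros)

lemma block_integrand_integrable:
  "(\<lambda>t. (s0 - s1) * block_density \<alpha> \<beta> (linepath s1 s0 t) x y) integrable_on {0..1}"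
  by (intro integrable_continuous_real continuous_intros)

lemma block_density_eq_gauss_kernel:
  assumes v: "Im \<tau> > 0"
  shows "of_real (block_density \<alpha> \<beta> s (sqrt (Im \<tau>) * x) (sqrt (Im \<tau>) * y) / sqrt (Im \<tau>) ^ (\<alpha> + \<beta>)) *
      exp (2 * of_real pi * \<i> * of_real (x * y) * \<tau>) * cis2pi (x * b2 + y * b1) =
    of_real (2 / 2 ^ (\<alpha> + \<beta>) * exp (s * (real \<beta> - real \<alpha>))) * gauss_kernel (Suc (\<alpha> + \<beta>)) s \<tau> b1 b2 x y"
proof -
  define r where "r = sqrt (Im \<tau>)"
  have "r > 0"
    using v by (simp add: r_def)
  define h where "h = poly (hermite_poly (Suc (\<alpha> + \<beta>))) (r * (exp s * x + exp (- s) * y))"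
  define w where "w = 2 / 2 ^ (\<alpha> + \<beta>) * exp (s * (real \<beta> - real \<alpha>))"
  have argument: "exp s * (r * x) + exp (- s) * (r * y) = r * (exp s * x + exp (- s) * y)"
    by (simp add: algebra_simps)
  have "(p * (r * x) - q * (r * y))\<^sup>2 =
      r\<^sup>2 * ((p * x)\<^sup>2 + (q * y)\<^sup>2) - 2 * r\<^sup>2 * (p * q * (x * y))" for p q
    by (simp add: power2_eq_square algebra_simps)
  from this[of "exp s" "exp (- s)"] have square: "(exp s * (r * x) - exp (- s) * (r * y))\<^sup>2 =
      Im \<tau> * ((exp s * x)\<^sup>2 + (exp (- s) * y)\<^sup>2) - 2 * Im \<tau> * (x * y)"
    using v by (simp add: r_def exp_minus)
  define Q where "Q = (exp s * x)\<^sup>2 + (exp (- s) * y)\<^sup>2"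
  have "of_real (- pi * (Im \<tau> * Q - 2 * Im \<tau> * (x * y))) + 2 * of_real pi * \<i> * of_real (x * y) * \<tau> =
      of_real (- pi * Im \<tau> * Q) + 2 * of_real pi * \<i> * of_real (Re \<tau> * x * y)"
    by (simp add: complex_eq_iff algebra_simps)
  then have gaussian: "of_real (exp (- pi * (Im \<tau> * Q - 2 * Im \<tau> * (x * y)))) *
      exp (2 * of_real pi * \<i> * of_real (x * y) * \<tau>) =
      of_real (exp (- pi * Im \<tau> * Q)) * cis2pi (Re \<tau> * x * y)"
    unfolding cis2pi_eq_exp exp_of_real[symmetric] exp_add[symmetric] by (rule arg_cong)
  have phase: "cis2pi (Re \<tau> * x * y + x * b2 + y * b1) =
      cis2pi (Re \<tau> * x * y) * cis2pi (x * b2 + y * b1)"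
    by (simp add: cis2pi_add[symmetric] add.assoc)
  have regroup: "of_real (w * h * g / r ^ (\<alpha> + \<beta>)) * e * e' =
      of_real w * (of_real (r / r ^ Suc (\<alpha> + \<beta>) * h) * (of_real g * e) * e')"
    for g and e e' :: complex
    using \<open>r > 0\<close> by simp
  show ?thesis
    unfolding block_density_def gauss_kernel_def r_def[symmetric] argument square h_def[symmetric]
      w_def[symmetric] Q_def[symmetric] regroup gaussian phase
    by (simp only: of_real_mult mult.assoc)
qed

lemma theta_block_term_eq_integral:
  assumes v: "Im \<tau> > 0"
  shows "theta_block_term s0 s1 \<alpha> \<beta> \<tau> b1 b2 x y =
    integral {0..1} (\<lambda>t. of_real (path_weight s0 s1 \<alpha> \<beta> t) *
      gauss_kernel (Suc (\<alpha> + \<beta>)) (linepath s1 s0 t) \<tau> b1 b2 x y)"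
proof -
  let ?r = "sqrt (Im \<tau>)"
  let ?D = "\<lambda>t. block_density \<alpha> \<beta> (linepath s1 s0 t) (?r * x) (?r * y)"
  let ?e = "exp (2 * of_real pi * \<i> * of_real (x * y) * \<tau>) * cis2pi (x * b2 + y * b1)"
  have "((\<lambda>t. of_real ((s0 - s1) * ?D t / ?r ^ (\<alpha> + \<beta>)) * ?e) has_integral
      of_real (block_integral s0 s1 \<alpha> \<beta> (?r * x) (?r * y) / ?r ^ (\<alpha> + \<beta>)) * ?e) {0..1}"
    unfolding block_integral_def
    by (intro has_integral_mult_left has_integral_of_real has_integral_divide integrable_integral
        block_integrand_integrable)
  moreover have "of_real ((s0 - s1) * ?D t / ?r ^ (\<alpha> + \<beta>)) * ?e =
      of_real (path_weight s0 s1 \<alpha> \<beta> t) *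
      gauss_kernel (Suc (\<alpha> + \<beta>)) (linepath s1 s0 t) \<tau> b1 b2 x y" for t
  proof -
    have "of_real ((s0 - s1) * ?D t / ?r ^ (\<alpha> + \<beta>)) * ?e =
        of_real (s0 - s1) * (of_real (?D t / ?r ^ (\<alpha> + \<beta>)) *
        exp (2 * of_real pi * \<i> * of_real (x * y) * \<tau>) * cis2pi (x * b2 + y * b1))"
      by (simp only: of_real_mult mult.assoc times_divide_eq_right[symmetric])
    then show ?thesis
      unfolding block_density_eq_gauss_kernel[OF v] path_weight_def by (simp only: of_real_mult mult.assoc)
  qed
  ultimately show ?thesis
    by (simp add: theta_block_term_def integral_unique mult.assoc)
qed

lemma weighted_gauss_kernel_le_cauchy_weight:
  assumes v: "Im \<tau> > 0"
  obtains C where "\<And>t b1 b2 x y. t \<in> {0..1} \<Longrightarrow>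
    norm (of_real (path_weight s0 s1 \<alpha> \<beta> t) * gauss_kernel n (linepath s1 s0 t) \<tau> b1 b2 x y) \<le>
    C * (cauchy_weight x * cauchy_weight y)"
proof -
  let ?S = "max \<bar>s0\<bar> \<bar>s1\<bar>"
  obtain C where C: "\<And>s b1 b2 x y. \<bar>s\<bar> \<le> ?S \<Longrightarrow>
      norm (gauss_kernel n s \<tau> b1 b2 x y) \<le> C * (cauchy_weight x * cauchy_weight y)"
    using gauss_kernel_le_cauchy_weight[OF v, of ?S n] by metis
  have "bounded (path_weight s0 s1 \<alpha> \<beta> ` {0..1})"
    by (intro compact_imp_bounded compact_continuous_image continuous_intros) auto
  then obtain W where "\<forall>w\<in>path_weight s0 s1 \<alpha> \<beta> ` {0..1}. norm w \<le> W"
    unfolding bounded_iff by blast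
  then have W: "\<bar>path_weight s0 s1 \<alpha> \<beta> t\<bar> \<le> W" if "t \<in> {0..1}" for t
    using that by simp
  have "norm (of_real (path_weight s0 s1 \<alpha> \<beta> t) * gauss_kernel n (linepath s1 s0 t) \<tau> b1 b2 x y) \<le>
      W * C * (cauchy_weight x * cauchy_weight y)" if t: "t \<in> {0..1}" for t b1 b2 x y
  proof -
    have "closed_segment s1 s0 \<subseteq> cball 0 ?S"
      by (rule closed_segment_subset) auto
    then have "\<bar>linepath s1 s0 t\<bar> \<le> ?S"
      using linepath_in_path[OF t, of s1 s0] by auto
    from mult_mono[OF W[OF t] C[OF this] order_trans[OF abs_ge_zero W[OF t]] norm_ge_zero] show ?thesis
      by (simp add: norm_mult mult.assoc)
  qed
  then show ?thesis
    by (rule that)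
qed

lemma
  assumes v: "Im \<tau> > 0"
  shows cauchy_dominated_theta_block_term: "cauchy_dominated (theta_block_term s0 s1 \<alpha> \<beta> \<tau> b1 b2)"
    and theta_block_eq_integral: "theta_block s0 s1 \<alpha> \<beta> \<tau> a1 a2 b1 b2 =
      integral {0..1} (\<lambda>t. of_real (path_weight s0 s1 \<alpha> \<beta> t) *
        lattice_sum a1 a2 (gauss_kernel (Suc (\<alpha> + \<beta>)) (linepath s1 s0 t) \<tau> b1 b2))"
proof -
  let ?g = "\<lambda>x y t. of_real (path_weight s0 s1 \<alpha> \<beta> t) *
    gauss_kernel (Suc (\<alpha> + \<beta>)) (linepath s1 s0 t) \<tau> b1 b2 x y"
  obtain C where C: "\<And>t x y. t \<in> {0..1} \<Longrightarrow> norm (?g x y t) \<le> C * (cauchy_weight x * cauchy_weight y)"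
    using weighted_gauss_kernel_le_cauchy_weight[OF v, of s0 s1 \<alpha> \<beta> "Suc (\<alpha> + \<beta>)"] by metis
  have cont: "continuous_on {0..1} (?g x y)" for x y
    by (intro continuous_intros)
  have "norm (theta_block_term s0 s1 \<alpha> \<beta> \<tau> b1 b2 x y) \<le> C * (cauchy_weight x * cauchy_weight y)" for x y
  proof -
    have "norm (integral {0..1} (?g x y)) \<le>
        integral {0..1} (\<lambda>t::real. C * (cauchy_weight x * cauchy_weight y))"
      by (intro integral_norm_bound_integral integrable_continuous_real cont C) auto
    then show ?thesis
      by (simp add: theta_block_term_eq_integral[OF v])
  qed
  then show "cauchy_dominated (theta_block_term s0 s1 \<alpha> \<beta> \<tau> b1 b2)"
    unfolding cauchy_dominated_def by blast
  have "((\<lambda>p::int \<times> int. integral {0..1} (?g (a1 + of_int (fst p)) (a2 + of_int (snd p)))) has_sum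
      integral {0..1} (\<lambda>t. \<Sum>\<^sub>\<infinity>p::int \<times> int. ?g (a1 + of_int (fst p)) (a2 + of_int (snd p)) t)) UNIV"
    by (rule has_sum_integral_M_test[OF cont C summable_on_cauchy_weight_pairs])
  from infsumI[OF this] show "theta_block s0 s1 \<alpha> \<beta> \<tau> a1 a2 b1 b2 =
      integral {0..1} (\<lambda>t. of_real (path_weight s0 s1 \<alpha> \<beta> t) *
        lattice_sum a1 a2 (gauss_kernel (Suc (\<alpha> + \<beta>)) (linepath s1 s0 t) \<tau> b1 b2))"
    by (simp only: theta_block_def lattice_sum_def theta_block_term_eq_integral[OF v] infsum_cmult_right')
qed

theorem theta_block_inversion:
  assumes v: "Im \<tau> > 0"
  shows "theta_block s0 s1 \<alpha> \<beta> (- 1 / \<tau>) a1 a2 b1 b2 =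
    (- \<tau>) ^ Suc (\<alpha> + \<beta>) * cis2pi (a1 * b2 + a2 * b1) * theta_block s0 s1 \<alpha> \<beta> \<tau> (- b1) (- b2) a1 a2"
  unfolding theta_block_eq_integral[OF v] theta_block_eq_integral[OF Im_inversion_pos[OF v]]
    gauss_kernel_lattice_sum_inversion[OF v] integral_mult_right[symmetric]
  by (simp only: mult_ac)

section \<open>The completion of a monomial\<close>

lemma has_real_derivative_E: "(E has_real_derivative 2 * exp (- pi * z\<^sup>2)) (at z)"
proof -
  let ?f = "\<lambda>u::real. exp (- pi * u\<^sup>2)"
  define A where "A = \<bar>z\<bar> + 1"
  have A: "- A < z" "z < A" "0 < A"
    unfolding A_def by linarith+
  have "((\<lambda>u. LBINT y=ereal 0..ereal u. ?f y) has_vector_derivative ?f z) (at z within {- A..A})"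
    using A by (intro interval_integral_FTC2 continuous_intros) auto
  then have "((\<lambda>u. LBINT y=0..u. ?f y) has_real_derivative ?f z) (at z)"
    using at_within_Icc_at[OF A(1,2)]
    by (simp add: has_real_derivative_iff_has_vector_derivative zero_ereal_def)
  from DERIV_cmult[OF this, of 2] show ?thesis
    unfolding E_def[abs_def] .
qed

lemma deriv_E_eq_poly_gaussian:
  "\<exists>p. (deriv ^^ Suc k) E = (\<lambda>z. poly p z * exp (- pi * z\<^sup>2))"
proof (induction k)
  case 0
  have "(deriv ^^ Suc 0) E = (\<lambda>z. poly [:2:] z * exp (- pi * z\<^sup>2))"
    using has_real_derivative_E DERIV_imp_deriv by (auto simp: fun_eq_iff)
  then show ?case
    by blast
next
  case (Suc k)
  then obtain p where p: "(deriv ^^ Suc k) E = (\<lambda>z. poly p z * exp (- pi * z\<^sup>2))"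
    by blast
  define q where "q = pderiv p - smult (2 * pi) ([:0, 1:] * p)"
  have "((\<lambda>z. poly p z * exp (- pi * z\<^sup>2))
      has_real_derivative poly q z * exp (- pi * z\<^sup>2)) (at z)" for z
    by (rule derivative_eq_intros poly_DERIV refl)+ (simp add: q_def algebra_simps)
  then have "(deriv ^^ Suc (Suc k)) E = (\<lambda>z. poly q z * exp (- pi * z\<^sup>2))"
    unfolding funpow.simps(2)[of "Suc k"] o_apply p by (intro ext DERIV_imp_deriv)
  then show ?case
    by blast
qed

lemma has_real_derivative_deriv_E:
  "((deriv ^^ k) E has_real_derivative (deriv ^^ Suc k) E z) (at z)"
proof (cases k)
  case 0
  then show ?thesis
    using has_real_derivative_E[of z] by (simp add: DERIV_imp_deriv)
next
  case (Suc j)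
  obtain p where p: "(deriv ^^ Suc j) E = (\<lambda>z. poly p z * exp (- pi * z\<^sup>2))"
    using deriv_E_eq_poly_gaussian by blast
  have "(deriv ^^ k) E differentiable (at z)"
    unfolding Suc p real_differentiable_def
    by (rule exI) (rule derivative_eq_intros poly_DERIV refl)+
  then show ?thesis
    by (simp add: DERIV_deriv_iff_real_differentiable)
qed

definition monomial_taylor_coeff :: "real \<Rightarrow> real \<Rightarrow> nat \<Rightarrow> nat \<Rightarrow> nat \<Rightarrow> real \<Rightarrow> real \<Rightarrow> real" where
  "monomial_taylor_coeff c1 c2 \<alpha> \<beta> k x y = coeff ([:x, c1:] ^ \<alpha> * [:y, c2:] ^ \<beta>) k"

lemma monomial_taylor_coeff_0: "monomial_taylor_coeff c1 c2 \<alpha> \<beta> 0 x y = x ^ \<alpha> * y ^ \<beta>"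
  by (simp add: monomial_taylor_coeff_def coeff_mult coeff_0_power)

lemma monomial_taylor_coeff_Suc_left:
  "monomial_taylor_coeff c1 c2 (Suc \<alpha>) \<beta> k x y = x * monomial_taylor_coeff c1 c2 \<alpha> \<beta> k x y +
     c1 * (if k = 0 then 0 else monomial_taylor_coeff c1 c2 \<alpha> \<beta> (k - 1) x y)"
  unfolding monomial_taylor_coeff_def power_Suc mult.assoc by (cases k) simp_all

lemma monomial_taylor_coeff_swap:
  "monomial_taylor_coeff c1 c2 \<alpha> \<beta> k x y = monomial_taylor_coeff c2 c1 \<beta> \<alpha> k y x"
  by (simp add: monomial_taylor_coeff_def mult.commute)

lemma monomial_taylor_coeff_eq_0:
  assumes "k > \<alpha> + \<beta>"
  shows "monomial_taylor_coeff c1 c2 \<alpha> \<beta> k x y = 0"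
proof -
  have "degree ([:x, c1:] ^ \<alpha> * [:y, c2:] ^ \<beta>) \<le> degree ([:x, c1:] ^ \<alpha>) + degree ([:y, c2:] ^ \<beta>)"
    by (rule degree_mult_le)
  also have "\<dots> \<le> degree [:x, c1:] * \<alpha> + degree [:y, c2:] * \<beta>"
    by (intro add_mono degree_power_le)
  also have "\<dots> \<le> 1 * \<alpha> + 1 * \<beta>"
    by (intro add_mono mult_right_mono) auto
  finally show ?thesis
    unfolding monomial_taylor_coeff_def using assms by (intro coeff_eq_0) simp
qed

lemma coeff_linear_poly_power_binomial:
  fixes a b :: "'a :: comm_semiring_1"
  shows "coeff ([:a, b:] ^ n) i = of_nat (n choose i) * b ^ i * a ^ (n - i)"
proof (cases "i \<le> n")
  case False
  have "degree ([:a, b:] ^ n) \<le> degree [:a, b:] * n"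
    by (rule degree_power_le)
  also have "\<dots> \<le> 1 * n"
    by (rule mult_right_mono) auto
  finally show ?thesis
    using False by (simp add: coeff_eq_0 binomial_eq_0)
qed (rule coeff_linear_poly_power)

lemma has_real_derivative_coeff_linear_poly_power:
  "((\<lambda>y. coeff ([:y, c:] ^ n) i) has_real_derivative real n * coeff ([:y, c:] ^ (n - 1)) i) (at y)"
proof -
  have "((\<lambda>y. real (n choose i) * c ^ i * y ^ (n - i)) has_real_derivative
      real (n choose i) * c ^ i * (real (n - i) * y ^ (n - i - 1))) (at y)"
    by (auto intro!: derivative_eq_intros)
  also have "real (n choose i) * c ^ i * (real (n - i) * y ^ (n - i - 1)) =
      real ((n - i) * (n choose i)) * c ^ i * y ^ (n - 1 - i)"
    by (simp add: diff_commute)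
  also have "\<dots> = real n * coeff ([:y, c:] ^ (n - 1)) i"
    unfolding binomial_absorb_comp by (simp add: coeff_linear_poly_power_binomial)
  finally show ?thesis
    by (simp add: coeff_linear_poly_power_binomial)
qed

lemma has_real_derivative_monomial_taylor_coeff_snd:
  "((\<lambda>y. monomial_taylor_coeff c1 c2 \<alpha> \<beta> k x y) has_real_derivative
     real \<beta> * monomial_taylor_coeff c1 c2 \<alpha> (\<beta> - 1) k x y) (at y)"
proof -
  have "((\<lambda>y. \<Sum>i\<le>k. coeff ([:x, c1:] ^ \<alpha>) i * coeff ([:y, c2:] ^ \<beta>) (k - i)) has_real_derivative
      (\<Sum>i\<le>k. coeff ([:x, c1:] ^ \<alpha>) i * (real \<beta> * coeff ([:y, c2:] ^ (\<beta> - 1)) (k - i)))) (at y)"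
    by (intro DERIV_sum DERIV_cmult has_real_derivative_coeff_linear_poly_power)
  then show ?thesis
    by (simp add: monomial_taylor_coeff_def coeff_mult sum_distrib_left mult.left_commute)
qed

lemma has_real_derivative_monomial_taylor_coeff_fst:
  "((\<lambda>x. monomial_taylor_coeff c1 c2 \<alpha> \<beta> k x y) has_real_derivative
     real \<alpha> * monomial_taylor_coeff c1 c2 (\<alpha> - 1) \<beta> k x y) (at x)"
  using has_real_derivative_monomial_taylor_coeff_snd[of c2 c1 \<beta> \<alpha> k y x]
  by (simp add: monomial_taylor_coeff_swap[of c2 c1])

lemma directional_derivative_monomial_taylor_coeff:
  "c1 * (real \<alpha> * monomial_taylor_coeff c1 c2 (\<alpha> - 1) \<beta> k x y) +
   c2 * (real \<beta> * monomial_taylor_coeff c1 c2 \<alpha> (\<beta> - 1) k x y) =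
   real (Suc k) * monomial_taylor_coeff c1 c2 \<alpha> \<beta> (Suc k) x y"
proof -
  let ?p = "[:x, c1:]" and ?q = "[:y, c2:]"
  have "pderiv (?p ^ \<alpha> * ?q ^ \<beta>) =
      smult (c1 * real \<alpha>) (?p ^ (\<alpha> - 1) * ?q ^ \<beta>) + smult (c2 * real \<beta>) (?p ^ \<alpha> * ?q ^ (\<beta> - 1))"
    by (simp add: pderiv_mult pderiv_power pderiv_pCons mult_ac)
  from arg_cong[OF this, of "\<lambda>r. coeff r k"] show ?thesis
    by (simp add: monomial_taylor_coeff_def coeff_pderiv mult_ac)
qed

definition completed_monomial :: "real \<Rightarrow> real \<Rightarrow> nat \<Rightarrow> nat \<Rightarrow> real \<Rightarrow> real \<Rightarrow> real" where
  "completed_monomial c1 c2 \<alpha> \<beta> x y = (\<Sum>k\<le>\<alpha> + \<beta>. (- 1 / (4 * pi)) ^ k *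
     ((deriv ^^ k) E (c2 * x + c1 * y) * monomial_taylor_coeff c1 c2 \<alpha> \<beta> k x y))"

lemma completed_monomial_eq_sum:
  assumes "\<alpha> + \<beta> \<le> N"
  shows "completed_monomial c1 c2 \<alpha> \<beta> x y = (\<Sum>k\<le>N. (- 1 / (4 * pi)) ^ k *
     ((deriv ^^ k) E (c2 * x + c1 * y) * monomial_taylor_coeff c1 c2 \<alpha> \<beta> k x y))"
  unfolding completed_monomial_def
  by (rule sum.mono_neutral_left) (use assms in \<open>auto simp: monomial_taylor_coeff_eq_0\<close>)

lemma completed_monomial_swap: "completed_monomial c1 c2 \<alpha> \<beta> x y = completed_monomial c2 c1 \<beta> \<alpha> y x"
  unfolding completed_monomial_def monomial_taylor_coeff_swap[of c1 c2] by (simp only: add.commute)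

lemma completed_monomial_0_0: "completed_monomial c1 c2 0 0 x y = E (c2 * x + c1 * y)"
  by (simp add: completed_monomial_def monomial_taylor_coeff_0)

lemma completed_monomial_Suc_left:
  "completed_monomial c1 c2 (Suc \<alpha>) \<beta> x y = x * completed_monomial c1 c2 \<alpha> \<beta> x y -
     (\<Sum>k\<le>\<alpha> + \<beta>. (- 1 / (4 * pi)) ^ k * (c1 * (deriv ^^ Suc k) E (c2 * x + c1 * y) *
       monomial_taylor_coeff c1 c2 \<alpha> \<beta> k x y)) / (4 * pi)"
proof -
  let ?s = "- 1 / (4 * pi)"
  let ?E = "\<lambda>k. (deriv ^^ k) E (c2 * x + c1 * y)"
  let ?T = "\<lambda>k. monomial_taylor_coeff c1 c2 \<alpha> \<beta> k x y"
  let ?T' = "\<lambda>k. c1 * (if k = 0 then 0 else ?T (k - 1))"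
  have "completed_monomial c1 c2 (Suc \<alpha>) \<beta> x y = (\<Sum>k\<le>Suc (\<alpha> + \<beta>). ?s ^ k * (?E k * (x * ?T k + ?T' k)))"
    unfolding completed_monomial_def monomial_taylor_coeff_Suc_left add_Suc ..
  also have "\<dots> = x * (\<Sum>k\<le>Suc (\<alpha> + \<beta>). ?s ^ k * (?E k * ?T k)) +
      (\<Sum>k\<le>Suc (\<alpha> + \<beta>). ?s ^ k * (?E k * ?T' k))"
    by (simp only: sum_distrib_left sum.distrib[symmetric] distrib_left mult.left_commute[of x])
  also have "(\<Sum>k\<le>Suc (\<alpha> + \<beta>). ?s ^ k * (?E k * ?T k)) = completed_monomial c1 c2 \<alpha> \<beta> x y"
    by (rule completed_monomial_eq_sum[symmetric]) simp
  also have "(\<Sum>k\<le>Suc (\<alpha> + \<beta>). ?s ^ k * (?E k * ?T' k)) =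
      (\<Sum>k\<le>\<alpha> + \<beta>. ?s ^ Suc k * (?E (Suc k) * (c1 * ?T k)))"
    by (subst sum.atMost_Suc_shift) simp
  also have "\<dots> = ?s * (\<Sum>k\<le>\<alpha> + \<beta>. ?s ^ k * (c1 * ?E (Suc k) * ?T k))"
    unfolding sum_distrib_left by (simp only: power_Suc mult_ac)
  finally show ?thesis
    by simp
qed

lemma has_real_derivative_completed_monomial_snd:
  "((\<lambda>y. completed_monomial c1 c2 \<alpha> \<beta> x y) has_real_derivative
     4 * pi * (x * completed_monomial c1 c2 \<alpha> \<beta> x y - completed_monomial c1 c2 (Suc \<alpha>) \<beta> x y) +
     real \<beta> * completed_monomial c1 c2 \<alpha> (\<beta> - 1) x y) (at y)"
proof -
  let ?s = "- 1 / (4 * pi)"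
  let ?E = "\<lambda>k. (deriv ^^ k) E (c2 * x + c1 * y)"
  let ?T = "\<lambda>\<beta> k. monomial_taylor_coeff c1 c2 \<alpha> \<beta> k x y"
  have "((\<lambda>y. (deriv ^^ k) E (c2 * x + c1 * y)) has_real_derivative ?E (Suc k) * c1) (at y)" for k
    by (rule DERIV_chain'[OF _ has_real_derivative_deriv_E]) (auto intro!: derivative_eq_intros)
  then have "((\<lambda>y. completed_monomial c1 c2 \<alpha> \<beta> x y) has_real_derivative
      (\<Sum>k\<le>\<alpha> + \<beta>. ?s ^ k * (?E k * (real \<beta> * ?T (\<beta> - 1) k) + ?E (Suc k) * c1 * ?T \<beta> k))) (at y)"
    unfolding completed_monomial_def
    by (intro DERIV_sum DERIV_cmult DERIV_mult' has_real_derivative_monomial_taylor_coeff_snd)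
  also have "(\<Sum>k\<le>\<alpha> + \<beta>. ?s ^ k * (?E k * (real \<beta> * ?T (\<beta> - 1) k) + ?E (Suc k) * c1 * ?T \<beta> k)) =
      real \<beta> * (\<Sum>k\<le>\<alpha> + \<beta>. ?s ^ k * (?E k * ?T (\<beta> - 1) k)) +
      (\<Sum>k\<le>\<alpha> + \<beta>. ?s ^ k * (c1 * ?E (Suc k) * ?T \<beta> k))"
    by (simp only: sum_distrib_left sum.distrib[symmetric] distrib_left mult_ac)
  also have "(\<Sum>k\<le>\<alpha> + \<beta>. ?s ^ k * (?E k * ?T (\<beta> - 1) k)) = completed_monomial c1 c2 \<alpha> (\<beta> - 1) x y"
    by (rule completed_monomial_eq_sum[symmetric]) simp
  finally show ?thesis
    by (rule DERIV_cong) (simp add: completed_monomial_Suc_left)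
qed

lemma has_real_derivative_completed_monomial_fst:
  "((\<lambda>x. completed_monomial c1 c2 \<alpha> \<beta> x y) has_real_derivative
     4 * pi * (y * completed_monomial c1 c2 \<alpha> \<beta> x y - completed_monomial c1 c2 \<alpha> (Suc \<beta>) x y) +
     real \<alpha> * completed_monomial c1 c2 (\<alpha> - 1) \<beta> x y) (at x)"
  using has_real_derivative_completed_monomial_snd[of c2 c1 \<beta> \<alpha> y x]
  by (simp add: completed_monomial_swap[of c2 c1])

text \<open>
  \<open>x - \<partial>\<^sub>y / (4 pi)\<close> raises the exponent \<open>\<alpha>\<close>; the recursion of the Hermite polynomials is made for this.
\<close>

lemma has_real_derivative_block_density_snd:
  "((\<lambda>y. block_density \<alpha> \<beta> s x y) has_real_derivative
     4 * pi * (x * block_density \<alpha> \<beta> s x y - block_density (Suc \<alpha>) \<beta> s x y)) (at y)"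
proof -
  let ?n = "Suc (\<alpha> + \<beta>)"
  define p where "p = exp s"
  define q where "q = exp (- s)"
  define z where "z = p * x + q * y"
  define h where "h = poly (hermite_poly ?n) z"
  define h' where "h' = poly (pderiv (hermite_poly ?n)) z"
  define g where "g = exp (- pi * (p * x - q * y)\<^sup>2)"
  define K where "K = 2 / 2 ^ (\<alpha> + \<beta>) * exp (s * (real \<beta> - real \<alpha>))"
  have "exp (s * (real \<beta> - real (Suc \<alpha>))) = exp (s * (real \<beta> - real \<alpha>)) * q"
    by (simp add: q_def exp_add[symmetric] algebra_simps)
  then have raised: "block_density (Suc \<alpha>) \<beta> s x y = K * q / 2 * (z * h - h' / (2 * pi)) * g"
    by (simp add: block_density_def p_def[symmetric] q_def[symmetric] K_def
        z_def[symmetric] h_def h'_def g_def)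
  have "((\<lambda>y. K * poly (hermite_poly ?n) (p * x + q * y) * exp (- pi * (p * x - q * y)\<^sup>2)) has_real_derivative
      K * (q * h' + 2 * pi * q * (p * x - q * y) * h) * g) (at y)"
    unfolding h_def h'_def g_def z_def
    by (rule derivative_eq_intros DERIV_chain'[OF _ poly_DERIV] refl)+
      (simp add: algebra_simps power2_eq_square)
  moreover have "K * (q * h' + 2 * pi * q * (p * x - q * y) * h) * g =
      4 * pi * (x * (K * h * g) - K * q / 2 * (z * h - h' / (2 * pi)) * g)"
  proof -
    have "q * (p * x) = x"
      by (simp add: p_def q_def exp_minus)
    then have "q * h' + 2 * pi * q * (p * x - q * y) * h =
        4 * pi * (x * h - q / 2 * (z * h - h' / (2 * pi)))"
      by (simp add: z_def algebra_simps)
    from arg_cong[OF this, of "\<lambda>u. K * u * g"] show ?thesis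
      by (simp add: algebra_simps)
  qed
  moreover have "block_density \<alpha> \<beta> s x =
      (\<lambda>y. K * poly (hermite_poly ?n) (p * x + q * y) * exp (- pi * (p * x - q * y)\<^sup>2))"
    by (simp add: fun_eq_iff block_density_def p_def q_def K_def del: hermite_poly.simps)
  ultimately show ?thesis
    unfolding raised by (simp only: h_def g_def z_def)
qed

lemma has_real_derivative_block_integral_snd:
  "((\<lambda>y. block_integral s0 s1 \<alpha> \<beta> x y) has_real_derivative
     4 * pi * (x * block_integral s0 s1 \<alpha> \<beta> x y - block_integral s0 s1 (Suc \<alpha>) \<beta> x y)) (at y)"
proof -
  let ?D = "\<lambda>\<alpha> y t. (s0 - s1) * block_density \<alpha> \<beta> (linepath s1 s0 t) x y"
  let ?D' = "\<lambda>y t. 4 * pi * (x * ?D \<alpha> y t - ?D (Suc \<alpha>) y t)"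
  have "((\<lambda>y. integral (cbox 0 1) (?D \<alpha> y))
      has_real_derivative integral (cbox 0 1) (?D' y)) (at y within UNIV)"
  proof (rule leibniz_rule_field_derivative)
    show "((\<lambda>y. ?D \<alpha> y t) has_real_derivative ?D' y t) (at y within UNIV)" for y t
      by (rule DERIV_cong[OF DERIV_cmult[OF has_real_derivative_block_density_snd]])
        (simp add: algebra_simps)
    show "?D \<alpha> y integrable_on cbox 0 1" for y
      using block_integrand_integrable by simp
    show "continuous_on (UNIV \<times> cbox 0 1) (\<lambda>(y, t). ?D' y t)"
      unfolding case_prod_unfold
      by (intro continuous_intros continuous_on_compose2[OF continuous_on_linepath[of UNIV s1 s0]]) auto
  qed auto
  also have "integral (cbox 0 1) (?D' y) =
      4 * pi * (x * block_integral s0 s1 \<alpha> \<beta> x y - block_integral s0 s1 (Suc \<alpha>) \<beta> x y)"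
    unfolding block_integral_def box_real
    by (intro integral_unique has_integral_mult_right has_integral_diff integrable_integral
        block_integrand_integrable)
  finally show ?thesis
    by (simp add: block_integral_def)
qed

lemma block_integral_swap: "block_integral s0 s1 \<alpha> \<beta> x y = - block_integral (- s0) (- s1) \<beta> \<alpha> y x"
proof -
  have "linepath (- s1) (- s0) t = - linepath s1 s0 t" for t
    by (simp add: linepath_def)
  moreover have "block_density \<alpha> \<beta> s x y = block_density \<beta> \<alpha> (- s) y x" for s
    by (simp add: block_density_def add.commute power2_commute algebra_simps)
  ultimately show ?thesis
    unfolding block_integral_def integral_neg[symmetric] by (simp add: algebra_simps)
qed

lemma has_real_derivative_block_integral_fst:
  "((\<lambda>x. block_integral s0 s1 \<alpha> \<beta> x y) has_real_derivative
     4 * pi * (y * block_integral s0 s1 \<alpha> \<beta> x y - block_integral s0 s1 \<alpha> (Suc \<beta>) x y)) (at x)"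
  using DERIV_minus[OF has_real_derivative_block_integral_snd[of "- s0" "- s1" \<beta> \<alpha> y x]]
  by (simp add: block_integral_swap[of s0 s1] algebra_simps)

lemma block_integral_0_0:
  "block_integral s0 s1 0 0 x y = E (exp s0 * x - exp (- s0) * y) - E (exp s1 * x - exp (- s1) * y)"
proof -
  define F where "F s = E (exp s * x - exp (- s) * y)" for s
  have deriv_F: "(F has_real_derivative block_density 0 0 s x y) (at s)" for s
  proof -
    have "((\<lambda>s. exp s * x - exp (- s) * y) has_real_derivative exp s * x + exp (- s) * y) (at s)"
      by (auto intro!: derivative_eq_intros)
    then show ?thesis
      unfolding F_def[abs_def]
      by (rule DERIV_cong[OF DERIV_chain'[OF _ has_real_derivative_E]]) (simp add: block_density_def)
  qed
  have deriv_path: "(linepath s1 s0 has_real_derivative s0 - s1) (at t)" for t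
    using has_vector_derivative_linepath_within[of s1 s0 t UNIV]
    by (simp add: has_real_derivative_iff_has_vector_derivative)
  have "((\<lambda>t. F (linepath s1 s0 t)) has_real_derivative
      (s0 - s1) * block_density 0 0 (linepath s1 s0 t) x y) (at t)" for t
    using DERIV_chain2[OF deriv_F deriv_path] by (simp only: mult.commute)
  then have "((\<lambda>t. (s0 - s1) * block_density 0 0 (linepath s1 s0 t) x y) has_integral
      F (linepath s1 s0 1) - F (linepath s1 s0 0)) {0..1}"
    by (intro fundamental_theorem_of_calculus)
      (auto simp: has_real_derivative_iff_has_vector_derivative intro: has_vector_derivative_at_within)
  from integral_unique[OF this] show ?thesis
    unfolding block_integral_def by (simp only: F_def linepath_0' linepath_1')
qed

text \<open>
  \<open>heat_flow t \<alpha> \<beta> g\<close> is \<open>exp (t \<partial>\<^sub>x \<partial>\<^sub>y) (x ^ \<alpha> * y ^ \<beta>)\<close> with every monomial \<open>x ^ a * y ^ b\<close> replaced by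
  \<open>g a b\<close>; the recursion is \<open>exp (t \<partial>\<^sub>x \<partial>\<^sub>y) \<circ> x = (x + t \<partial>\<^sub>y) \<circ> exp (t \<partial>\<^sub>x \<partial>\<^sub>y)\<close>.
\<close>

primrec heat_flow :: "'a \<Rightarrow> nat \<Rightarrow> nat \<Rightarrow> (nat \<Rightarrow> nat \<Rightarrow> 'a) \<Rightarrow> 'a :: comm_ring_1" where
  "heat_flow t 0 \<beta> g = g 0 \<beta>"
| "heat_flow t (Suc \<alpha>) \<beta> g =
     heat_flow t \<alpha> \<beta> (\<lambda>a b. g (Suc a) b) + t * of_nat \<beta> * heat_flow t \<alpha> (\<beta> - 1) g"

lemma heat_flow_zero: "heat_flow 0 \<alpha> \<beta> g = g \<alpha> \<beta>"
  by (induction \<alpha> arbitrary: g) simp_all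

lemma heat_flow_cmult: "heat_flow t \<alpha> \<beta> (\<lambda>a b. c * g a b) = c * heat_flow t \<alpha> \<beta> g"
  by (induction \<alpha> arbitrary: \<beta> g) (simp_all add: algebra_simps)

lemma heat_flow_diff: "heat_flow t \<alpha> \<beta> (\<lambda>a b. g a b - h a b) = heat_flow t \<alpha> \<beta> g - heat_flow t \<alpha> \<beta> h"
  by (induction \<alpha> arbitrary: \<beta> g h) (simp_all add: right_diff_distrib)

lemma of_real_heat_flow:
  "of_real (heat_flow t \<alpha> \<beta> g) = heat_flow (of_real t) \<alpha> \<beta> (\<lambda>a b. of_real (g a b))"
  by (induction \<alpha> arbitrary: \<beta> g) simp_all

lemma has_field_derivative_heat_flow_arg:
  assumes "\<And>a b. ((\<lambda>y. g y a b) has_field_derivative g' a b) (at y)"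
  shows "((\<lambda>y. heat_flow t \<alpha> \<beta> (g y)) has_field_derivative heat_flow t \<alpha> \<beta> g') (at y)"
  using assms
proof (induction \<alpha> arbitrary: \<beta> g g')
  case (Suc \<alpha>)
  then show ?case
    by (auto intro!: derivative_intros DERIV_cmult)
qed simp

lemma has_field_derivative_heat_flow:
  "((\<lambda>t. heat_flow t \<alpha> \<beta> g) has_field_derivative of_nat (\<alpha> * \<beta>) * heat_flow t (\<alpha> - 1) (\<beta> - 1) g) (at t)"
proof (induction \<alpha> arbitrary: \<beta> g)
  case (Suc \<alpha>)
  note [derivative_intros] = Suc.IH
  have recursion: "of_nat \<alpha> * heat_flow t \<alpha> (\<beta> - 1) g = of_nat \<alpha> *
      (heat_flow t (\<alpha> - 1) (\<beta> - 1) (\<lambda>a b. g (Suc a) b) +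
          t * of_nat (\<beta> - 1) * heat_flow t (\<alpha> - 1) (\<beta> - 1 - 1) g)"
    by (cases \<alpha>) simp_all
  have "((\<lambda>t. heat_flow t (Suc \<alpha>) \<beta> g) has_field_derivative
      of_nat (\<alpha> * \<beta>) * heat_flow t (\<alpha> - 1) (\<beta> - 1) (\<lambda>a b. g (Suc a) b) +
      (of_nat \<beta> * heat_flow t \<alpha> (\<beta> - 1) g +
       t * of_nat \<beta> * (of_nat (\<alpha> * (\<beta> - 1)) * heat_flow t (\<alpha> - 1) (\<beta> - 1 - 1) g))) (at t)"
    by (auto intro!: derivative_eq_intros)
  also have "of_nat (\<alpha> * \<beta>) * heat_flow t (\<alpha> - 1) (\<beta> - 1) (\<lambda>a b. g (Suc a) b) +
      (of_nat \<beta> * heat_flow t \<alpha> (\<beta> - 1) g +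
       t * of_nat \<beta> * (of_nat (\<alpha> * (\<beta> - 1)) * heat_flow t (\<alpha> - 1) (\<beta> - 1 - 1) g)) =
      of_nat \<beta> * (heat_flow t \<alpha> (\<beta> - 1) g +
        of_nat \<alpha> * (heat_flow t (\<alpha> - 1) (\<beta> - 1) (\<lambda>a b. g (Suc a) b) +
          t * of_nat (\<beta> - 1) * heat_flow t (\<alpha> - 1) (\<beta> - 1 - 1) g))"
    by (simp only: of_nat_mult distrib_left mult_ac add_ac)
  also have "\<dots> = of_nat (Suc \<alpha> * \<beta>) * heat_flow t \<alpha> (\<beta> - 1) g"
    unfolding recursion[symmetric] by (simp add: algebra_simps)
  finally show ?case
    by simp
qed simp

definition completed_difference :: "real \<Rightarrow> real \<Rightarrow> nat \<Rightarrow> nat \<Rightarrow> real \<Rightarrow> real \<Rightarrow> real" where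
  "completed_difference s0 s1 \<alpha> \<beta> x y =
     completed_monomial (- exp (- s0)) (exp s0) \<alpha> \<beta> x y -
     completed_monomial (- exp (- s1)) (exp s1) \<alpha> \<beta> x y"

lemma has_real_derivative_completed_difference_snd:
  "((\<lambda>y. completed_difference s0 s1 \<alpha> \<beta> x y) has_real_derivative
     4 * pi * (x * completed_difference s0 s1 \<alpha> \<beta> x y - completed_difference s0 s1 (Suc \<alpha>) \<beta> x y) +
     real \<beta> * completed_difference s0 s1 \<alpha> (\<beta> - 1) x y) (at y)"
  unfolding completed_difference_def
  by (rule DERIV_cong[OF DERIV_diff[OF has_real_derivative_completed_monomial_snd
          has_real_derivative_completed_monomial_snd]])
    (simp add: algebra_simps)

lemma has_real_derivative_completed_difference_fst:
  "((\<lambda>x. completed_difference s0 s1 \<alpha> \<beta> x y) has_real_derivative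
     4 * pi * (y * completed_difference s0 s1 \<alpha> \<beta> x y - completed_difference s0 s1 \<alpha> (Suc \<beta>) x y) +
     real \<alpha> * completed_difference s0 s1 (\<alpha> - 1) \<beta> x y) (at x)"
  unfolding completed_difference_def
  by (rule DERIV_cong[OF DERIV_diff[OF has_real_derivative_completed_monomial_fst
          has_real_derivative_completed_monomial_fst]])
    (simp add: algebra_simps)

lemma completed_difference_0_eq_block_integral:
  "completed_difference s0 s1 0 \<beta> x y = block_integral s0 s1 0 \<beta> x y"
proof (induction \<beta> arbitrary: x)
  case 0
  show ?case
    by (simp add: completed_difference_def completed_monomial_0_0 block_integral_0_0)
next
  case (Suc \<beta>)
  have "((\<lambda>x. block_integral s0 s1 0 \<beta> x y) has_real_derivative
      4 * pi * (y * block_integral s0 s1 0 \<beta> x y - completed_difference s0 s1 0 (Suc \<beta>) x y)) (at x)"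
    using has_real_derivative_completed_difference_fst[of s0 s1 0 \<beta> y x] by (simp add: Suc.IH)
  from DERIV_unique[OF this has_real_derivative_block_integral_fst] show ?case
    by simp
qed

theorem completed_difference_eq_heat_flow:
  "completed_difference s0 s1 \<alpha> \<beta> x y =
      heat_flow (1 / (4 * pi)) \<alpha> \<beta> (\<lambda>a b. block_integral s0 s1 a b x y)"
proof (induction \<alpha> arbitrary: \<beta> y)
  case 0
  show ?case
    by (simp add: completed_difference_0_eq_block_integral)
next
  case (Suc \<alpha>)
  let ?H = "heat_flow (1 / (4 * pi)) \<alpha> \<beta>"
  let ?J = "\<lambda>y a b. block_integral s0 s1 a b x y"
  have "((\<lambda>y. ?H (?J y)) has_real_derivative
      ?H (\<lambda>a b. 4 * pi * (x * ?J y a b - ?J y (Suc a) b))) (at y)"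
    by (intro has_field_derivative_heat_flow_arg has_real_derivative_block_integral_snd)
  then have "((\<lambda>y. ?H (?J y)) has_real_derivative
      4 * pi * (x * ?H (?J y) - ?H (\<lambda>a b. ?J y (Suc a) b))) (at y)"
    by (simp only: heat_flow_cmult heat_flow_diff)
  moreover have "((\<lambda>y. ?H (?J y)) has_real_derivative
      4 * pi * (x * ?H (?J y) - completed_difference s0 s1 (Suc \<alpha>) \<beta> x y) +
      real \<beta> * heat_flow (1 / (4 * pi)) \<alpha> (\<beta> - 1) (?J y)) (at y)"
    using has_real_derivative_completed_difference_snd[of s0 s1 \<alpha> \<beta> x y] by (simp only: Suc.IH)
  ultimately have "4 * pi * (x * ?H (?J y) - ?H (\<lambda>a b. ?J y (Suc a) b)) =
      4 * pi * (x * ?H (?J y) - completed_difference s0 s1 (Suc \<alpha>) \<beta> x y) +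
      real \<beta> * heat_flow (1 / (4 * pi)) \<alpha> (\<beta> - 1) (?J y)"
    by (rule DERIV_unique)
  then show ?case
    by (simp add: field_simps)
qed

section \<open>Block sums\<close>

definition multi_indices :: "nat \<Rightarrow> (nat^2^'m::finite) set" where
  "multi_indices d = {\<alpha>. (\<Sum>j\<in>UNIV. \<Sum>i\<in>UNIV. \<alpha> $ j $ i) = d}"

lemma finite_multi_indices: "finite (multi_indices d)"
  unfolding multi_indices_def by (rule finite_multiindex)

lemma sum_multi_index: "\<alpha> \<in> multi_indices d \<Longrightarrow> (\<Sum>j\<in>UNIV. \<alpha> $ j $ 1 + \<alpha> $ j $ 2) = d"
  by (simp add: multi_indices_def sum_2)

text \<open>
  The linear functional that sends the monomial \<open>\<Prod>j. x\<^sub>j ^ a\<^sub>j * y\<^sub>j ^ b\<^sub>j\<close> to \<open>\<Prod>j. N j a\<^sub>j b\<^sub>j\<close>, applied to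
  the homogeneous polynomial of degree \<open>d\<close> with coefficients \<open>coef\<close>.
\<close>

definition block_sum :: "nat \<Rightarrow> (nat^2^'m \<Rightarrow> complex) \<Rightarrow> ('m::finite \<Rightarrow> nat \<Rightarrow> nat \<Rightarrow> complex) \<Rightarrow> complex" where
  "block_sum d coef N = (\<Sum>\<alpha>\<in>multi_indices d.
     coef \<alpha> * (\<Prod>j\<in>UNIV. N j (\<alpha> $ j $ 1) (\<alpha> $ j $ 2)))"

lemma prod_UNIV_2: "(\<Prod>i\<in>UNIV. f i) = f 1 * f (2::2)"
  unfolding UNIV_2 by simp

definition block_monomial :: "real^2^'m \<Rightarrow> 'm \<Rightarrow> nat \<Rightarrow> nat \<Rightarrow> complex" where
  "block_monomial x j a b = of_real (x $ j $ 1 ^ a * x $ j $ 2 ^ b)"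

definition block_polynomial :: "nat \<Rightarrow> (nat^2^'m \<Rightarrow> complex) \<Rightarrow> real^2^'m::finite \<Rightarrow> complex" where
  "block_polynomial d coef x = block_sum d coef (block_monomial x)"

lemma homogeneous_polynomial_iff: "homogeneous_polynomial d f \<longleftrightarrow> (\<exists>coef. f = block_polynomial d coef)"
  by (simp add: homogeneous_polynomial_def block_polynomial_def block_sum_def block_monomial_def
      multi_indices_def prod_UNIV_2 fun_eq_iff)

lemma block_sum_cong:
  assumes "\<And>j a b. N j a b = N' j a b"
  shows "block_sum d coef N = block_sum d coef N'"
  using assms by (simp add: block_sum_def)

lemma block_sum_cmult:
  "block_sum d coef (\<lambda>j a b. u j * w ^ (a + b) * N j a b) = (\<Prod>j\<in>UNIV. u j) * w ^ d * block_sum d coef N"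
  unfolding block_sum_def sum_distrib_left
proof (intro sum.cong refl)
  fix \<alpha> :: "nat^2^'a" assume "\<alpha> \<in> multi_indices d"
  then have "w ^ d = (\<Prod>j\<in>UNIV. w ^ (\<alpha> $ j $ 1 + \<alpha> $ j $ 2))"
    by (simp add: power_sum[symmetric] sum_multi_index)
  then show "coef \<alpha> * (\<Prod>j\<in>UNIV. u j * w ^ (\<alpha> $ j $ 1 + \<alpha> $ j $ 2) * N j (\<alpha> $ j $ 1) (\<alpha> $ j $ 2)) =
      (\<Prod>j\<in>UNIV. u j) * w ^ d * (coef \<alpha> * (\<Prod>j\<in>UNIV. N j (\<alpha> $ j $ 1) (\<alpha> $ j $ 2)))"
    by (simp add: prod.distrib)
qed

lemma block_sum_fun_upd:
  "block_sum d coef (N(j := K)) = (\<Sum>\<alpha>\<in>multi_indices d.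
     coef \<alpha> * (K (\<alpha> $ j $ 1) (\<alpha> $ j $ 2) * (\<Prod>i\<in>UNIV - {j}. N i (\<alpha> $ i $ 1) (\<alpha> $ i $ 2))))"
  unfolding block_sum_def
proof (intro sum.cong refl arg_cong2[where f = "(*)"])
  fix \<alpha> :: "nat^2^'a"
  have "(\<Prod>i\<in>UNIV. (N(j := K)) i (\<alpha> $ i $ 1) (\<alpha> $ i $ 2)) =
      K (\<alpha> $ j $ 1) (\<alpha> $ j $ 2) * (\<Prod>i\<in>UNIV - {j}. (N(j := K)) i (\<alpha> $ i $ 1) (\<alpha> $ i $ 2))"
    by (subst prod.remove[of _ j]) auto
  then show "(\<Prod>i\<in>UNIV. (N(j := K)) i (\<alpha> $ i $ 1) (\<alpha> $ i $ 2)) =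
      K (\<alpha> $ j $ 1) (\<alpha> $ j $ 2) * (\<Prod>i\<in>UNIV - {j}. N i (\<alpha> $ i $ 1) (\<alpha> $ i $ 2))"
    by simp
qed

lemma block_sum_fun_upd_linear:
  "block_sum d coef (N(j := \<lambda>a b. u * K a b + v * L a b)) =
     u * block_sum d coef (N(j := K)) + v * block_sum d coef (N(j := L))"
  unfolding block_sum_fun_upd sum_distrib_left sum.distrib[symmetric]
  by (intro sum.cong refl) (simp add: algebra_simps)

lemma partial_block_sum:
  fixes F :: "'m::finite \<Rightarrow> real^2 \<Rightarrow> nat \<Rightarrow> nat \<Rightarrow> complex"
  assumes deriv: "\<And>z a b. ((\<lambda>t. F j (z + t *\<^sub>R axis i 1) a b) has_vector_derivative G z a b) (at 0)"
  shows "partial j i (\<lambda>x. block_sum d coef (\<lambda>k. F k (x $ k))) =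
      (\<lambda>x. block_sum d coef (\<lambda>k. (F(j := G)) k (x $ k)))"
proof
  fix x :: "real^2^'m"
  define N where "N k = F k (x $ k)" for k
  have "(\<lambda>k. F k ((x + t *\<^sub>R axis j (axis i 1)) $ k)) = N(j := F j (x $ j + t *\<^sub>R axis i 1))" for t
    by (auto simp: N_def axis_def)
  moreover have "((\<lambda>t. block_sum d coef (N(j := F j (x $ j + t *\<^sub>R axis i 1)))) has_vector_derivative
      block_sum d coef (N(j := G (x $ j)))) (at 0)"
    unfolding block_sum_fun_upd
    by (intro has_vector_derivative_sum has_vector_derivative_mult_right
        has_vector_derivative_mult_left deriv)
  moreover have "N(j := G (x $ j)) = (\<lambda>k. (F(j := G)) k (x $ k))"
    by (auto simp: N_def)
  ultimately show "partial j i (\<lambda>x. block_sum d coef (\<lambda>k. F k (x $ k))) x =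
      block_sum d coef (\<lambda>k. (F(j := G)) k (x $ k))"
    unfolding partial_def by (simp add: vector_derivative_at)
qed

lemma
  fixes g :: "real \<Rightarrow> real \<Rightarrow> real" and z :: "real^2"
  shows has_vector_derivative_axis_1:
      "((\<lambda>x. g x (z $ 2)) has_real_derivative D) (at (z $ 1)) \<Longrightarrow>
        ((\<lambda>t. of_real (g ((z + t *\<^sub>R axis 1 1) $ 1) ((z + t *\<^sub>R axis 1 1) $ 2)))
          has_vector_derivative (of_real D :: complex)) (at 0)"
    and has_vector_derivative_axis_2:
      "((\<lambda>y. g (z $ 1) y) has_real_derivative D) (at (z $ 2)) \<Longrightarrow>
        ((\<lambda>t. of_real (g ((z + t *\<^sub>R axis 2 1) $ 1) ((z + t *\<^sub>R axis 2 1) $ 2)))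
          has_vector_derivative (of_real D :: complex)) (at 0)"
  using DERIV_at_within_shift[of "\<lambda>x. g x (z $ 2)" D "z $ 1" 0 UNIV]
    DERIV_at_within_shift[of "\<lambda>y. g (z $ 1) y" D "z $ 2" 0 UNIV]
  by (auto simp: axis_def intro!: has_vector_derivative_of_real)

section \<open>The completion as a block sum\<close>

definition hyperbolic_unit :: "real^2 \<Rightarrow> real^2" where
  "hyperbolic_unit c = c /\<^sub>R sqrt (- Q1 c)"

lemma hyperbolic_unit_nth: "hyperbolic_unit c $ i = c $ i / sqrt (- Q1 c)"
  by (simp add: hyperbolic_unit_def divide_inverse)

definition rapidity :: "real^2 \<Rightarrow> real" where
  "rapidity c = ln (hyperbolic_unit c $ 2)"

lemma hyperbolic_unit_cone:
  assumes "c \<in> cone_C"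
  shows "hyperbolic_unit c $ 1 = - exp (- rapidity c)" "hyperbolic_unit c $ 2 = exp (rapidity c)"
proof -
  have c: "Q1 c < 0" "c $ 2 > 0"
    using assms by (auto simp: cone_C_def)
  then have pos: "hyperbolic_unit c $ 2 > 0"
    by (simp add: hyperbolic_unit_nth)
  then show "hyperbolic_unit c $ 2 = exp (rapidity c)"
    by (simp add: rapidity_def)
  define r where "r = sqrt (- Q1 c)"
  have "r > 0" "r * r = - (c $ 1 * c $ 2)"
    using c by (simp_all add: r_def Q1_def)
  then have "hyperbolic_unit c $ 1 = - inverse (hyperbolic_unit c $ 2)"
    using c(2) by (simp add: hyperbolic_unit_nth r_def[symmetric] field_simps)
  then show "hyperbolic_unit c $ 1 = - exp (- rapidity c)"
    using pos by (simp add: rapidity_def exp_minus)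
qed

lemma rho_eq: "rho c k x =
    (deriv ^^ k) E (hyperbolic_unit c $ 2 * x $ 1 + hyperbolic_unit c $ 1 * x $ 2)"
  by (simp add: rho_def B1_def hyperbolic_unit_nth add_divide_distrib add.commute mult.commute)

definition monomial_derivative :: "real^2 \<Rightarrow> nat \<Rightarrow> real^2 \<Rightarrow> nat \<Rightarrow> nat \<Rightarrow> complex" where
  "monomial_derivative c k z a b = of_real (fact k *
     monomial_taylor_coeff (hyperbolic_unit c $ 1) (hyperbolic_unit c $ 2) a b k (z $ 1) (z $ 2))"

lemma dir_deriv_block_sum:
  fixes F :: "'m::finite \<Rightarrow> real^2 \<Rightarrow> nat \<Rightarrow> nat \<Rightarrow> complex" and c :: "real^2"
  defines "u \<equiv> hyperbolic_unit c"
  assumes "\<And>z a b. ((\<lambda>t. F j (z + t *\<^sub>R axis 1 1) a b) has_vector_derivative G1 z a b) (at 0)"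
    and "\<And>z a b. ((\<lambda>t. F j (z + t *\<^sub>R axis 2 1) a b) has_vector_derivative G2 z a b) (at 0)"
  shows "dir_deriv j c (\<lambda>x. block_sum d coef (\<lambda>i. F i (x $ i))) =
    (\<lambda>x. block_sum d coef (\<lambda>i.
      (F(j := \<lambda>z a b. of_real (u $ 1) * G1 z a b + of_real (u $ 2) * G2 z a b)) i (x $ i)))"
proof
  fix x :: "real^2^'m"
  define N where "N i = F i (x $ i)" for i
  have upd: "(\<lambda>i. (F(j := G)) i (x $ i)) = N(j := G (x $ j))" for G
    by (auto simp: N_def)
  have "dir_deriv j c (\<lambda>x. block_sum d coef (\<lambda>i. F i (x $ i))) x =
      of_real (u $ 1) * block_sum d coef (N(j := G1 (x $ j))) +
      of_real (u $ 2) * block_sum d coef (N(j := G2 (x $ j)))"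
    unfolding dir_deriv_def partial_block_sum[of F j 1 G1, OF assms(2)]
      partial_block_sum[of F j 2 G2, OF assms(3)] upd
    by (simp add: u_def hyperbolic_unit_nth scaleR_conv_of_real distrib_left)
  then show "dir_deriv j c (\<lambda>x. block_sum d coef (\<lambda>i. F i (x $ i))) x = block_sum d coef (\<lambda>i.
      (F(j := \<lambda>z a b. of_real (u $ 1) * G1 z a b + of_real (u $ 2) * G2 z a b)) i (x $ i))"
    by (simp only: upd block_sum_fun_upd_linear)
qed

lemma dir_deriv_monomial_derivative:
  fixes c :: "real^2^'m::finite"
  shows "dir_deriv j (c $ j) (\<lambda>x. block_sum d coef (\<lambda>i. monomial_derivative (c $ i) (\<kappa> i) (x $ i))) =
    (\<lambda>x. block_sum d coef (\<lambda>i. monomial_derivative (c $ i) ((\<kappa>(j := Suc (\<kappa> j))) i) (x $ i)))"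
proof -
  let ?u = "hyperbolic_unit (c $ j)"
  let ?T = "\<lambda>a b z. monomial_taylor_coeff (?u $ 1) (?u $ 2) a b (\<kappa> j) (z $ 1) (z $ 2)"
  define F where "F i = monomial_derivative (c $ i) (\<kappa> i)" for i
  define G1 :: "real^2 \<Rightarrow> nat \<Rightarrow> nat \<Rightarrow> complex"
    where "G1 z a b = of_real (fact (\<kappa> j) * (real a * ?T (a - 1) b z))" for z a b
  define G2 :: "real^2 \<Rightarrow> nat \<Rightarrow> nat \<Rightarrow> complex"
    where "G2 z a b = of_real (fact (\<kappa> j) * (real b * ?T a (b - 1) z))" for z a b
  have "((\<lambda>t. F j (z + t *\<^sub>R axis 1 1) a b) has_vector_derivative G1 z a b) (at 0)" for z a b
    unfolding F_def G1_def monomial_derivative_def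
    by (rule has_vector_derivative_axis_1)
      (intro DERIV_cmult has_real_derivative_monomial_taylor_coeff_fst)
  moreover have "((\<lambda>t. F j (z + t *\<^sub>R axis 2 1) a b) has_vector_derivative G2 z a b) (at 0)" for z a b
    unfolding F_def G2_def monomial_derivative_def
    by (rule has_vector_derivative_axis_2)
      (intro DERIV_cmult has_real_derivative_monomial_taylor_coeff_snd)
  moreover have "of_real (?u $ 1) * G1 z a b + of_real (?u $ 2) * G2 z a b =
      monomial_derivative (c $ j) (Suc (\<kappa> j)) z a b" for z a b
  proof -
    have "?u $ 1 * (fact (\<kappa> j) * (real a * ?T (a - 1) b z)) +
        ?u $ 2 * (fact (\<kappa> j) * (real b * ?T a (b - 1) z)) =
        fact (\<kappa> j) * (?u $ 1 * (real a * ?T (a - 1) b z) + ?u $ 2 * (real b * ?T a (b - 1) z))"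
      by (simp add: algebra_simps)
    then show ?thesis
      unfolding directional_derivative_monomial_taylor_coeff G1_def G2_def monomial_derivative_def
      by (simp add: mult_ac flip: of_real_mult of_real_add)
  qed
  moreover have "(\<lambda>i. (F(j := monomial_derivative (c $ j) (Suc (\<kappa> j)))) i (x $ i)) =
      (\<lambda>i. monomial_derivative (c $ i) ((\<kappa>(j := Suc (\<kappa> j))) i) (x $ i))" for x :: "real^2^'m"
    by (auto simp: F_def)
  ultimately show ?thesis
    using dir_deriv_block_sum[of F j G1 G2 "c $ j"] unfolding F_def by simp
qed

lemma dir_deriv_power_monomial_derivative:
  "(dir_deriv j (c $ j) ^^ n) (\<lambda>x. block_sum d coef (\<lambda>i. monomial_derivative (c $ i) (\<kappa> i) (x $ i))) =
     (\<lambda>x. block_sum d coef (\<lambda>i. monomial_derivative (c $ i) ((\<kappa>(j := \<kappa> j + n)) i) (x $ i)))"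
proof (induction n)
  case (Suc n)
  then show ?case
    by (simp only: funpow.simps o_apply dir_deriv_monomial_derivative fun_upd_upd fun_upd_same
        add_Suc_right)
qed simp

lemma
  shows distinct_index_list: "distinct (index_list :: 'm::finite list)"
    and set_index_list: "set (index_list :: 'm list) = UNIV"
proof -
  have "\<exists>js :: 'm list. distinct js \<and> set js = UNIV"
    using finite_distinct_list[OF finite[of "UNIV :: 'm set"]] by blast
  from someI_ex[OF this] show "distinct (index_list :: 'm list)" "set (index_list :: 'm list) = UNIV"
    unfolding index_list_def by auto
qed

lemma dir_deriv_prod_block_polynomial:
  "dir_deriv_prod c k (block_polynomial d coef) x =
      block_sum d coef (\<lambda>i. monomial_derivative (c $ i) (k $ i) (x $ i))"
proof -
  let ?F = "\<lambda>\<kappa> x. block_sum d coef (\<lambda>i. monomial_derivative (c $ i) (\<kappa> i) (x $ i))"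
  have "block_polynomial d coef = ?F (\<lambda>_. 0)"
    by (intro ext, unfold block_polynomial_def, rule block_sum_cong)
      (simp add: block_monomial_def monomial_derivative_def monomial_taylor_coeff_0)
  moreover have "foldr (\<lambda>j. dir_deriv j (c $ j) ^^ (k $ j)) js (?F (\<lambda>_. 0)) =
      ?F (\<lambda>i. if i \<in> set js then k $ i else 0)"
    if "distinct js" for js
    using that
  proof (induction js)
    case (Cons j js)
    then have "foldr (\<lambda>j. dir_deriv j (c $ j) ^^ (k $ j)) (j # js) (?F (\<lambda>_. 0)) =
        ?F ((\<lambda>i. if i \<in> set js then k $ i else 0)(j := k $ j))"
      by (simp add: dir_deriv_power_monomial_derivative)
    also have "(\<lambda>i. if i \<in> set js then k $ i else 0)(j := k $ j) =
        (\<lambda>i. if i \<in> set (j # js) then k $ i else 0)"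
      by auto
    finally show ?case .
  qed simp
  note this[OF distinct_index_list]
  ultimately show ?thesis
    by (simp add: dir_deriv_prod_def set_index_list)
qed

lemma prod_sum_vec:
  fixes t :: "'m::finite \<Rightarrow> 'b \<Rightarrow> 'a::comm_semiring_1"
  assumes "\<And>j. finite (B j)"
  shows "(\<Prod>j\<in>UNIV. \<Sum>k\<in>B j. t j k) = (\<Sum>k | \<forall>j. k $ j \<in> B j. \<Prod>j\<in>UNIV. t j (k $ j))"
proof -
  have "(\<Prod>j\<in>UNIV. \<Sum>k\<in>B j. t j k) = (\<Sum>g\<in>PiE UNIV B. \<Prod>j\<in>UNIV. t j (g j))"
    using assms by (intro prod_sum_PiE) auto
  also have "\<dots> = (\<Sum>k | \<forall>j. k $ j \<in> B j. \<Prod>j\<in>UNIV. t j (k $ j))"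
    by (rule sum.reindex_bij_witness[where i = vec_nth and j = vec_lambda])
      (auto simp: vec_lambda_inverse vec_nth_inverse PiE_iff)
  finally show ?thesis .
qed

lemma sum_multi_indices_prod:
  fixes t :: "'m::finite \<Rightarrow> nat \<Rightarrow> 'a::comm_semiring_1"
  assumes vanish: "\<And>j k. k > e j \<Longrightarrow> t j k = 0" and "(\<Sum>j\<in>UNIV. e j) \<le> d"
  shows "(\<Sum>k = 0..d. \<Sum>kv | (\<Sum>j\<in>UNIV. kv $ j) = k. \<Prod>j\<in>UNIV. t j (kv $ j)) = (\<Prod>j\<in>UNIV. \<Sum>k\<le>e j. t j k)"
proof -
  let ?K = "\<lambda>k. {kv :: nat^'m. (\<Sum>j\<in>UNIV. kv $ j) = k}"
  have "(\<Sum>k = 0..d. \<Sum>kv\<in>?K k. \<Prod>j\<in>UNIV. t j (kv $ j)) = (\<Sum>kv\<in>(\<Union>k\<in>{0..d}. ?K k). \<Prod>j\<in>UNIV. t j (kv $ j))"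
    using finite_vec_sum_eq by (intro sum.UNION_disjoint[symmetric]) auto
  also have "\<dots> = (\<Sum>kv | \<forall>j. kv $ j \<in> {..e j}. \<Prod>j\<in>UNIV. t j (kv $ j))"
  proof (rule sum.mono_neutral_right)
    show "finite (\<Union>k\<in>{0..d}. ?K k)"
      using finite_vec_sum_eq by blast
    show "{kv. \<forall>j. kv $ j \<in> {..e j}} \<subseteq> (\<Union>k\<in>{0..d}. ?K k)"
    proof
      fix kv :: "nat^'m" assume "kv \<in> {kv. \<forall>j. kv $ j \<in> {..e j}}"
      then have "(\<Sum>j\<in>UNIV. kv $ j) \<le> (\<Sum>j\<in>UNIV. e j)"
        by (intro sum_mono) auto
      then show "kv \<in> (\<Union>k\<in>{0..d}. ?K k)"
        using assms(2) by auto
    qed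
    show "\<forall>kv\<in>(\<Union>k\<in>{0..d}. ?K k) - {kv. \<forall>j. kv $ j \<in> {..e j}}. (\<Prod>j\<in>UNIV. t j (kv $ j)) = 0"
    proof
      fix kv assume "kv \<in> (\<Union>k\<in>{0..d}. ?K k) - {kv. \<forall>j. kv $ j \<in> {..e j}}"
      then obtain j where "kv $ j > e j"
        by (auto simp: not_le)
      then show "(\<Prod>j\<in>UNIV. t j (kv $ j)) = 0"
        using vanish by (intro prod_zero) auto
    qed
  qed
  also have "\<dots> = (\<Prod>j\<in>UNIV. \<Sum>k\<le>e j. t j k)"
    by (rule prod_sum_vec[symmetric]) simp
  finally show ?thesis .
qed

definition directional_completion ::
  "nat \<Rightarrow> real^2^'m::finite \<Rightarrow> (real^2^'m \<Rightarrow> complex) \<Rightarrow> real^2^'m \<Rightarrow> complex" where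
  "directional_completion d c f x = (\<Sum>k = 0..d. of_real ((-1) ^ k / (4 * pi) ^ k) *
     (\<Sum>kv | (\<Sum>j\<in>UNIV. kv $ j) = k.
        of_real (\<Prod>j\<in>UNIV. rho (c $ j) (kv $ j) (x $ j) / fact (kv $ j)) * dir_deriv_prod c kv f x))"

lemma directional_completion_block_polynomial:
  "directional_completion d c (block_polynomial d coef) x =
     block_sum d coef (\<lambda>j a b. of_real (completed_monomial
       (hyperbolic_unit (c $ j) $ 1) (hyperbolic_unit (c $ j) $ 2) a b (x $ j $ 1) (x $ j $ 2)))"
proof -
  let ?u = "\<lambda>j. hyperbolic_unit (c $ j)"
  define t where "t a b j k =
      (- 1 / (4 * pi)) ^ k * ((deriv ^^ k) E (?u j $ 2 * x $ j $ 1 + ?u j $ 1 * x $ j $ 2) *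
        monomial_taylor_coeff (?u j $ 1) (?u j $ 2) a b k (x $ j $ 1) (x $ j $ 2))" for a b j k
  let ?t = "\<lambda>\<alpha> j k. t (\<alpha> $ j $ 1) (\<alpha> $ j $ 2) j k"
  have summand: "of_real ((-1) ^ k / (4 * pi) ^ k) *
      (of_real (\<Prod>j\<in>UNIV. rho (c $ j) (kv $ j) (x $ j) / fact (kv $ j)) *
          dir_deriv_prod c kv (block_polynomial d coef) x) =
      (\<Sum>\<alpha>\<in>multi_indices d. coef \<alpha> * of_real (\<Prod>j\<in>UNIV. ?t \<alpha> j (kv $ j)))"
    if "(\<Sum>j\<in>UNIV. kv $ j) = k" for k kv
    unfolding dir_deriv_prod_block_polynomial block_sum_def sum_distrib_left
  proof (intro sum.cong refl)
    fix \<alpha> :: "nat^2^'a"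
    have "(-1) ^ k / (4 * pi) ^ k = (\<Prod>j\<in>UNIV. (- 1 / (4 * pi)) ^ (kv $ j))"
      unfolding that[symmetric] power_divide[symmetric] by (rule power_sum)
    then show "of_real ((-1) ^ k / (4 * pi) ^ k) *
        (of_real (\<Prod>j\<in>UNIV. rho (c $ j) (kv $ j) (x $ j) / fact (kv $ j)) *
        (coef \<alpha> * (\<Prod>j\<in>UNIV. monomial_derivative (c $ j) (kv $ j) (x $ j) (\<alpha> $ j $ 1) (\<alpha> $ j $ 2)))) =
        coef \<alpha> * of_real (\<Prod>j\<in>UNIV. ?t \<alpha> j (kv $ j))"
      by (simp add: t_def monomial_derivative_def rho_eq prod.distrib prod_dividef mult_ac)
  qed
  have "directional_completion d c (block_polynomial d coef) x =
      (\<Sum>k = 0..d. \<Sum>kv | (\<Sum>j\<in>UNIV. kv $ j) = k.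
        \<Sum>\<alpha>\<in>multi_indices d. coef \<alpha> * of_real (\<Prod>j\<in>UNIV. ?t \<alpha> j (kv $ j)))"
    unfolding directional_completion_def sum_distrib_left by (intro sum.cong refl summand) simp
  also have "\<dots> = (\<Sum>\<alpha>\<in>multi_indices d. coef \<alpha> *
      of_real (\<Sum>k = 0..d. \<Sum>kv | (\<Sum>j\<in>UNIV. kv $ j) = k. \<Prod>j\<in>UNIV. ?t \<alpha> j (kv $ j)))"
    by (simp add: sum.swap[of _ _ "multi_indices d"] sum_distrib_left)
  also have "\<dots> = (\<Sum>\<alpha>\<in>multi_indices d. coef \<alpha> * of_real (\<Prod>j\<in>UNIV. \<Sum>k\<le>\<alpha> $ j $ 1 + \<alpha> $ j $ 2. ?t \<alpha> j k))"
  proof (intro sum.cong refl arg_cong2[where f = "(*)"] arg_cong[where f = of_real] sum_multi_indices_prod)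
    show "?t \<alpha> j k = 0" if "\<alpha> $ j $ 1 + \<alpha> $ j $ 2 < k" for \<alpha> :: "nat^2^'a" and j k
      using that by (simp add: t_def monomial_taylor_coeff_eq_0)
    show "(\<Sum>j\<in>UNIV. \<alpha> $ j $ 1 + \<alpha> $ j $ 2) \<le> d" if "\<alpha> \<in> multi_indices d" for \<alpha>
      using that by (simp add: sum_multi_index)
  qed
  finally show ?thesis
    by (simp add: block_sum_def completed_monomial_def t_def)
qed

lemma alternating_sum_block_sum:
  fixes A B :: "'m::finite \<Rightarrow> nat \<Rightarrow> nat \<Rightarrow> complex"
  shows "(\<Sum>\<sigma> | \<forall>j. \<sigma> $ j \<in> {0, 1::nat}. (-1) ^ (\<Sum>j\<in>UNIV. \<sigma> $ j) *
      block_sum d coef (\<lambda>j. if \<sigma> $ j = 0 then A j else B j)) =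
    block_sum d coef (\<lambda>j a b. A j a b - B j a b)"
proof -
  let ?h = "\<lambda>\<alpha> j k. (-1) ^ k * (if k = 0 then A j else B j) (\<alpha> $ j $ 1) (\<alpha> $ j $ 2)"
  have "(-1) ^ (\<Sum>j\<in>UNIV. \<sigma> $ j) * block_sum d coef (\<lambda>j. if \<sigma> $ j = 0 then A j else B j) =
      (\<Sum>\<alpha>\<in>multi_indices d. coef \<alpha> * (\<Prod>j\<in>UNIV. ?h \<alpha> j (\<sigma> $ j)))" for \<sigma> :: "nat^'m"
    unfolding block_sum_def sum_distrib_left
    by (intro sum.cong refl) (simp add: power_sum prod.distrib)
  then have "(\<Sum>\<sigma> | \<forall>j. \<sigma> $ j \<in> {0, 1::nat}. (-1) ^ (\<Sum>j\<in>UNIV. \<sigma> $ j) *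
      block_sum d coef (\<lambda>j. if \<sigma> $ j = 0 then A j else B j)) =
      (\<Sum>\<alpha>\<in>multi_indices d. coef \<alpha> * (\<Sum>\<sigma> | \<forall>j. \<sigma> $ j \<in> {0, 1::nat}. \<Prod>j\<in>UNIV. ?h \<alpha> j (\<sigma> $ j)))"
    by (simp add: sum.swap[of _ _ "multi_indices d"] sum_distrib_left)
  also have "\<dots> = (\<Sum>\<alpha>\<in>multi_indices d. coef \<alpha> * (\<Prod>j\<in>UNIV. \<Sum>k\<in>{0, 1::nat}. ?h \<alpha> j k))"
    by (simp only: prod_sum_vec finite.intros)
  finally show ?thesis
    by (simp add: block_sum_def)
qed

lemma p_op_block_polynomial:
  assumes c: "\<And>j. c0 $ j \<in> cone_C" "\<And>j. c1 $ j \<in> cone_C"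
  shows "p_op d c0 c1 (block_polynomial d coef) x = block_sum d coef (\<lambda>j a b. of_real
    (completed_difference (rapidity (c0 $ j)) (rapidity (c1 $ j)) a b (x $ j $ 1) (x $ j $ 2)))"
proof -
  define P where "P c j a b = complex_of_real (completed_monomial
      (- exp (- rapidity (c $ j))) (exp (rapidity (c $ j))) a b (x $ j $ 1) (x $ j $ 2))"
    for c :: "real^2^'a" and j a b
  have "directional_completion d (select c0 c1 \<sigma>) (block_polynomial d coef) x =
      block_sum d coef (\<lambda>j. if \<sigma> $ j = 0 then P c0 j else P c1 j)" for \<sigma>
    unfolding directional_completion_block_polynomial
    by (rule block_sum_cong) (simp add: P_def select_def hyperbolic_unit_cone c)
  then have "p_op d c0 c1 (block_polynomial d coef) x =
      block_sum d coef (\<lambda>j a b. P c0 j a b - P c1 j a b)"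
    unfolding alternating_sum_block_sum[symmetric] p_op_def directional_completion_def by simp
  then show ?thesis
    by (simp add: P_def completed_difference_def)
qed

section \<open>Spherical polynomials\<close>

lemma sum_coeffs_eq_0_of_power_sum_eq_0:
  fixes c :: "'i \<Rightarrow> complex"
  assumes "finite I" "\<And>t::real. (\<Sum>i\<in>I. c i * of_real (t ^ n i)) = 0"
  shows "(\<Sum>i | i \<in> I \<and> n i = k. c i) = 0"
proof -
  define p where "p = (\<Sum>i\<in>I. monom (c i) (n i))"
  have "poly p (of_real t) = 0" for t :: real
    using assms(2)[of t] by (simp add: p_def poly_sum poly_monom)
  then have "range complex_of_real \<subseteq> {z. poly p z = 0}"
    by auto
  moreover have "infinite (range complex_of_real)"
    using infinite_UNIV_char_0 by (simp add: finite_image_iff inj_of_real)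
  ultimately have "p = 0"
    using poly_roots_finite finite_subset by blast
  moreover have "coeff p k = (\<Sum>i | i \<in> I \<and> n i = k. c i)"
    using assms(1) by (simp add: p_def coeff_sum sum.inter_filter[symmetric] if_distrib eq_commute)
  ultimately show ?thesis
    by simp
qed

lemma sum_coeffs_eq_0_of_monomial_sum_eq_0:
  fixes w :: "'i \<Rightarrow> complex" and e :: "'i \<Rightarrow> 'v \<Rightarrow> nat"
  assumes "finite V" "finite I"
    and "\<And>X::'v \<Rightarrow> real. (\<Sum>i\<in>I. w i * of_real (\<Prod>v\<in>V. X v ^ e i v)) = 0"
  shows "(\<Sum>i | i \<in> I \<and> (\<forall>v\<in>V. e i v = \<gamma> v). w i) = 0"
  using assms
proof (induction V arbitrary: I rule: finite_induct)
  case empty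
  then show ?case by simp
next
  case (insert v V)
  let ?I' = "{i. i \<in> I \<and> e i v = \<gamma> v}"
  have "(\<Sum>i\<in>?I'. w i * of_real (\<Prod>u\<in>V. X u ^ e i u)) = 0" for X :: "'v \<Rightarrow> real"
  proof (rule sum_coeffs_eq_0_of_power_sum_eq_0[OF insert.prems(1)])
    fix t :: real
    have "(\<Prod>u\<in>V. (X(v := t)) u ^ e i u) = (\<Prod>u\<in>V. X u ^ e i u)" for i
      using insert.hyps by (intro prod.cong) auto
    then show "(\<Sum>i\<in>I. w i * of_real (\<Prod>u\<in>V. X u ^ e i u) * of_real (t ^ e i v)) = 0"
      using insert.prems(2)[of "X(v := t)"] insert.hyps by (simp add: mult_ac)
  qed
  from insert.IH[OF _ this] have "(\<Sum>i | i \<in> ?I' \<and> (\<forall>u\<in>V. e i u = \<gamma> u). w i) = 0"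
    using insert.prems(1) by simp
  then show ?case
    by (simp add: conj_assoc)
qed

lemma monomial_relation_linear_functional:
  fixes w :: "'i \<Rightarrow> complex" and e :: "'i \<Rightarrow> 'v::finite \<Rightarrow> nat"
  assumes "finite I" and "\<And>X::'v \<Rightarrow> real. (\<Sum>i\<in>I. w i * of_real (\<Prod>v\<in>UNIV. X v ^ e i v)) = 0"
  shows "(\<Sum>i\<in>I. w i * N (e i)) = 0"
proof -
  have "(\<Sum>i\<in>I. w i * N (e i)) = (\<Sum>\<gamma>\<in>e ` I. \<Sum>i | i \<in> I \<and> e i = \<gamma>. w i * N (e i))"
    by (rule sum.image_gen[OF assms(1)])
  also have "\<dots> = (\<Sum>\<gamma>\<in>e ` I. (\<Sum>i | i \<in> I \<and> e i = \<gamma>. w i) * N \<gamma>)"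
    by (intro sum.cong refl) (auto simp: sum_distrib_right intro!: sum.cong)
  also have "\<dots> = 0"
    using sum_coeffs_eq_0_of_monomial_sum_eq_0[OF finite assms] by (simp add: fun_eq_iff)
  finally show ?thesis .
qed

lemma block_sum_lowered:
  "block_sum d coef (N(j := \<lambda>a b. of_nat (a * b) * N j (a - 1) (b - 1))) =
    (\<Sum>\<alpha>\<in>multi_indices d. coef \<alpha> * of_nat (\<alpha> $ j $ 1 * \<alpha> $ j $ 2) *
      (\<Prod>i\<in>UNIV. N i (\<alpha> $ i $ 1 - of_bool (i = j)) (\<alpha> $ i $ 2 - of_bool (i = j))))"
  unfolding block_sum_fun_upd
proof (intro sum.cong refl)
  fix \<alpha> :: "nat^2^'a"
  have "(\<Prod>i\<in>UNIV. N i (\<alpha> $ i $ 1 - of_bool (i = j)) (\<alpha> $ i $ 2 - of_bool (i = j))) =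
      N j (\<alpha> $ j $ 1 - 1) (\<alpha> $ j $ 2 - 1) *
      (\<Prod>i\<in>UNIV - {j}. N i (\<alpha> $ i $ 1 - of_bool (i = j)) (\<alpha> $ i $ 2 - of_bool (i = j)))"
    by (subst prod.remove[of _ j]) auto
  also have "(\<Prod>i\<in>UNIV - {j}. N i (\<alpha> $ i $ 1 - of_bool (i = j)) (\<alpha> $ i $ 2 - of_bool (i = j))) =
      (\<Prod>i\<in>UNIV - {j}. N i (\<alpha> $ i $ 1) (\<alpha> $ i $ 2))"
    by (intro prod.cong) auto
  finally show "coef \<alpha> * (of_nat (\<alpha> $ j $ 1 * \<alpha> $ j $ 2) * N j (\<alpha> $ j $ 1 - 1) (\<alpha> $ j $ 2 - 1) *
      (\<Prod>i\<in>UNIV - {j}. N i (\<alpha> $ i $ 1) (\<alpha> $ i $ 2))) =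
      coef \<alpha> * of_nat (\<alpha> $ j $ 1 * \<alpha> $ j $ 2) *
      (\<Prod>i\<in>UNIV. N i (\<alpha> $ i $ 1 - of_bool (i = j)) (\<alpha> $ i $ 2 - of_bool (i = j)))"
    by (simp only: mult.assoc)
qed

lemma laplacian_block_polynomial:
  "laplacian (block_polynomial d coef) x = 2 * (\<Sum>j\<in>UNIV. block_sum d coef
     ((block_monomial x)(j := \<lambda>a b. of_nat (a * b) * block_monomial x j (a - 1) (b - 1))))"
proof -
  define F :: "'a \<Rightarrow> real^2 \<Rightarrow> nat \<Rightarrow> nat \<Rightarrow> complex"
    where "F j z a b = of_real (z $ 1 ^ a * z $ 2 ^ b)" for j z a b
  define F2 :: "real^2 \<Rightarrow> nat \<Rightarrow> nat \<Rightarrow> complex"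
    where "F2 z a b = of_real (z $ 1 ^ a * (real b * z $ 2 ^ (b - 1)))" for z a b
  define F12 :: "real^2 \<Rightarrow> nat \<Rightarrow> nat \<Rightarrow> complex"
    where "F12 z a b = of_real (real a * z $ 1 ^ (a - 1) * (real b * z $ 2 ^ (b - 1)))" for z a b
  have eq: "block_polynomial d coef = (\<lambda>x. block_sum d coef (\<lambda>k. F k (x $ k)))"
    by (intro ext, unfold block_polynomial_def, rule block_sum_cong) (simp add: F_def block_monomial_def)
  have "partial j 2 (block_polynomial d coef) =
      (\<lambda>x. block_sum d coef (\<lambda>k. (F(j := F2)) k (x $ k)))" for j
    unfolding eq
    by (rule partial_block_sum, unfold F_def F2_def, rule has_vector_derivative_axis_2)
      (auto intro!: derivative_eq_intros)
  moreover have "partial j 1 (\<lambda>x. block_sum d coef (\<lambda>k. (F(j := F2)) k (x $ k))) =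
      (\<lambda>x. block_sum d coef (\<lambda>k. ((F(j := F2))(j := F12)) k (x $ k)))" for j
    by (rule partial_block_sum, unfold fun_upd_same F2_def F12_def, rule has_vector_derivative_axis_1)
      (auto intro!: derivative_eq_intros)
  moreover have "(\<lambda>k. (F(j := F12)) k (x $ k)) =
      (block_monomial x)(j := \<lambda>a b. of_nat (a * b) * block_monomial x j (a - 1) (b - 1))" for j
    by (auto simp: fun_eq_iff F_def F12_def block_monomial_def)
  ultimately show ?thesis
    by (simp add: laplacian_def)
qed

theorem spherical_block_sum:
  fixes coef :: "nat^2^'m::finite \<Rightarrow> complex"
  assumes harmonic: "\<And>x. laplacian (block_polynomial d coef) x = 0"
  shows "(\<Sum>j\<in>UNIV. block_sum d coef (N(j := \<lambda>a b. of_nat (a * b) * N j (a - 1) (b - 1)))) = 0"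
proof -
  let ?w = "\<lambda>(j, \<alpha>). coef \<alpha> * of_nat (\<alpha> $ j $ 1 * \<alpha> $ j $ 2)"
  let ?e = "\<lambda>(j, \<alpha>) (i, l). \<alpha> $ i $ l - of_bool (i = j) :: nat"
  let ?N = "\<lambda>N \<gamma>. \<Prod>i\<in>UNIV. N i (\<gamma> (i, 1)) (\<gamma> (i, 2))"
  have pairs: "(\<Sum>j\<in>UNIV. block_sum d coef (N(j := \<lambda>a b. of_nat (a * b) * N j (a - 1) (b - 1)))) =
      (\<Sum>q\<in>UNIV \<times> multi_indices d. ?w q * ?N N (?e q))" for N :: "'m \<Rightarrow> nat \<Rightarrow> nat \<Rightarrow> complex"
    unfolding block_sum_lowered by (simp add: sum.cartesian_product case_prod_unfold)
  have relation: "(\<Sum>q\<in>UNIV \<times> multi_indices d. ?w q * of_real (\<Prod>v\<in>UNIV. X v ^ ?e q v)) = 0"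
      for X :: "'m \<times> 2 \<Rightarrow> real"
  proof -
    define x :: "real^2^'m" where "x = (\<chi> i l. X (i, l))"
    have "(\<Prod>v\<in>UNIV. X v ^ \<gamma> v) = (\<Prod>i\<in>UNIV. \<Prod>l\<in>UNIV. X (i, l) ^ \<gamma> (i, l))" for \<gamma>
      by (simp add: prod.cartesian_product case_prod_unfold)
    then have evaluation: "of_real (\<Prod>v\<in>UNIV. X v ^ \<gamma> v) = ?N (block_monomial x) \<gamma>" for \<gamma>
      by (simp add: prod_UNIV_2 x_def block_monomial_def)
    have "laplacian (block_polynomial d coef) x =
        2 * (\<Sum>q\<in>UNIV \<times> multi_indices d. ?w q * ?N (block_monomial x) (?e q))"
      unfolding laplacian_block_polynomial pairs[of "block_monomial x"] ..
    then show ?thesis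
      unfolding evaluation harmonic by simp
  qed
  have "finite ((UNIV :: 'm set) \<times> multi_indices d)"
    by (intro finite_cartesian_product finite finite_multi_indices)
  from monomial_relation_linear_functional[OF this relation, where N = "?N N"] show ?thesis
    unfolding pairs .
qed

theorem block_sum_heat_flow:
  assumes harmonic: "\<And>x. laplacian (block_polynomial d coef) x = 0"
  shows "block_sum d coef (\<lambda>j a b. heat_flow t a b (N j)) = block_sum d coef N"
proof -
  define H where "H t j a b = heat_flow t a b (N j)" for t j a b
  have "((\<lambda>t. block_sum d coef (H t)) has_field_derivative 0) (at t)" for t
  proof -
    have "((\<lambda>t. block_sum d coef (H t)) has_field_derivative
        (\<Sum>\<alpha>\<in>multi_indices d. coef \<alpha> * (\<Sum>j\<in>UNIV.
          of_nat (\<alpha> $ j $ 1 * \<alpha> $ j $ 2) * H t j (\<alpha> $ j $ 1 - 1) (\<alpha> $ j $ 2 - 1) *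
          (\<Prod>i\<in>UNIV - {j}. H t i (\<alpha> $ i $ 1) (\<alpha> $ i $ 2))))) (at t)"
      (is "(_ has_field_derivative ?D) _")
      unfolding block_sum_def H_def
      by (intro DERIV_sum DERIV_cmult has_field_derivative_prod has_field_derivative_heat_flow)
    also have "?D = (\<Sum>j\<in>UNIV. block_sum d coef ((H t)(j := \<lambda>a b. of_nat (a * b) * H t j (a - 1) (b - 1))))"
      unfolding block_sum_fun_upd sum_distrib_left by (rule sum.swap)
    also have "\<dots> = 0"
      by (rule spherical_block_sum[OF harmonic])
    finally show ?thesis .
  qed
  then have "block_sum d coef (H t) = block_sum d coef (H 0)"
    using has_field_derivative_zero_constant[of UNIV "\<lambda>t. block_sum d coef (H t)"]
    by (metis UNIV_I convex_UNIV has_field_derivative_at_within)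
  moreover have "H t = (\<lambda>j a b. heat_flow t a b (N j))" "H 0 = N"
    by (simp_all add: fun_eq_iff H_def heat_flow_zero)
  ultimately show ?thesis
    by simp
qed

theorem p_op_eq_block_sum_block_integral:
  assumes harmonic: "\<And>x. laplacian (block_polynomial d coef) x = 0"
    and c: "\<And>j. c0 $ j \<in> cone_C" "\<And>j. c1 $ j \<in> cone_C"
  shows "p_op d c0 c1 (block_polynomial d coef) x = block_sum d coef (\<lambda>j a b. of_real
    (block_integral (rapidity (c0 $ j)) (rapidity (c1 $ j)) a b (x $ j $ 1) (x $ j $ 2)))"
  unfolding p_op_block_polynomial[OF c] completed_difference_eq_heat_flow of_real_heat_flow
  by (rule block_sum_heat_flow[OF harmonic])

section \<open>The theta series\<close>

lemma has_sum_sum: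
  fixes f :: "'a \<Rightarrow> 'b \<Rightarrow> 'c :: topological_comm_monoid_add"
  assumes "finite A" "\<And>a. a \<in> A \<Longrightarrow> (f a has_sum s a) B"
  shows "((\<lambda>x. \<Sum>a\<in>A. f a x) has_sum (\<Sum>a\<in>A. s a)) B"
  using assms by (induction A rule: finite_induct) (simp_all add: has_sum_add)

lemma has_sum_prod_UNIV:
  fixes g :: "'m::finite \<Rightarrow> 'b::countable \<Rightarrow> complex"
  assumes summable: "\<And>j. (\<lambda>q. norm (g j q)) summable_on UNIV"
  shows "((\<lambda>p. \<Prod>j\<in>UNIV. g j (p j)) has_sum (\<Prod>j\<in>UNIV. \<Sum>\<^sub>\<infinity>q. g j q)) UNIV"
proof -
  have PiE_UNIV: "PiE (UNIV :: 'm set) (\<lambda>_. UNIV :: 'b set) = UNIV"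
    by auto
  have "(\<lambda>p. norm (\<Prod>j\<in>UNIV. g j (p j))) summable_on UNIV"
    using abs_summable_on_prod_PiE[of "UNIV :: 'm set" "\<lambda>_. UNIV" g] summable
    unfolding PiE_UNIV abs_summable_equivalent[symmetric] by simp
  moreover have "(\<Sum>\<^sub>\<infinity>p. \<Prod>j\<in>UNIV. g j (p j)) = (\<Prod>j\<in>UNIV. \<Sum>\<^sub>\<infinity>q. g j q)"
    using infsum_prod_PiE_abs[of "UNIV :: 'm set" g "\<lambda>_. UNIV"] summable unfolding PiE_UNIV by simp
  ultimately show ?thesis
    by (metis abs_summable_summable has_sum_infsum)
qed

definition lattice_point :: "real^2^'m \<Rightarrow> ('m \<Rightarrow> int \<times> int) \<Rightarrow> real^2^'m" where
  "lattice_point a p = (\<chi> j l. a $ j $ l + of_int (if l = 1 then fst (p j) else snd (p j)))"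

lemma lattice_point_nth [simp]:
  "lattice_point a p $ j $ 1 = a $ j $ 1 + of_int (fst (p j))"
  "lattice_point a p $ j $ 2 = a $ j $ 2 + of_int (snd (p j))"
  by (simp_all add: lattice_point_def)

lemma bij_betw_lattice_point: "bij_betw (lattice_point a) UNIV (shifted_lattice a)"
  unfolding bij_betw_def
proof
  show "inj (lattice_point a)"
  proof (rule injI)
    fix p q assume eq: "lattice_point a p = lattice_point a q"
    have "fst (p j) = fst (q j)" "snd (p j) = snd (q j)" for j
      using arg_cong[OF eq, of "\<lambda>z. z $ j $ 1"] arg_cong[OF eq, of "\<lambda>z. z $ j $ 2"] by simp_all
    then show "p = q"
      by (simp add: fun_eq_iff prod_eq_iff)
  qed
  show "range (lattice_point a) = shifted_lattice a"
  proof (intro equalityI subsetI)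
    fix x assume "x \<in> range (lattice_point a)"
    then obtain p where p: "x = lattice_point a p"
      by blast
    define n :: "real^2^'a" where "n = (\<chi> j l. of_int (if l = 1 then fst (p j) else snd (p j)))"
    have "x = a + n" "\<forall>j i. n $ j $ i \<in> \<int>"
      by (simp_all add: p lattice_point_def n_def vec_eq_iff)
    then show "x \<in> shifted_lattice a"
      unfolding shifted_lattice_def by blast
  next
    fix x assume "x \<in> shifted_lattice a"
    then obtain n where n: "x = a + n" "\<And>j i. n $ j $ i \<in> \<int>"
      unfolding shifted_lattice_def by blast
    have "lattice_point a (\<lambda>j. (\<lfloor>n $ j $ 1\<rfloor>, \<lfloor>n $ j $ 2\<rfloor>)) = x"
      unfolding vec_eq_iff forall_2 using n(2) by (simp add: n(1))
    then show "x \<in> range (lattice_point a)"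
      by blast
  qed
qed

lemma cis2pi_sum: "finite A \<Longrightarrow> cis2pi (\<Sum>j\<in>A. f j) = (\<Prod>j\<in>A. cis2pi (f j))"
  by (induction A rule: finite_induct) (simp_all add: cis2pi_add)

lemma exp_Bm_eq_prod_cis2pi:
  "exp (2 * of_real pi * \<i> * of_real (Bm x y)) =
      (\<Prod>j\<in>UNIV. cis2pi (x $ j $ 1 * y $ j $ 2 + x $ j $ 2 * y $ j $ 1))"
  unfolding cis2pi_eq_exp[symmetric] Bm_def B1_def by (rule cis2pi_sum) simp

lemma powr_minus_half:
  assumes "v > 0"
  shows "v powr (- real d / 2) = (1 / sqrt v) ^ d"
proof -
  have "v powr (- real d / 2) = (v powr (1 / 2)) powr (- real d)"
    unfolding powr_powr by simp
  also have "\<dots> = (1 / sqrt v) ^ d"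
    using assms by (simp add: powr_half_sqrt powr_minus powr_realpow power_one_over inverse_eq_divide)
  finally show ?thesis .
qed

lemma theta_term_eq_block_sum:
  assumes harmonic: "\<And>x. laplacian (block_polynomial d coef) x = 0"
    and c: "\<And>j. c0 $ j \<in> cone_C" "\<And>j. c1 $ j \<in> cone_C"
    and v: "Im \<tau> > 0"
  shows "of_real (Im \<tau> powr (- real d / 2)) * theta_term d c0 c1 b (block_polynomial d coef) \<tau> x =
    block_sum d coef (\<lambda>j \<alpha> \<beta>. theta_block_term (rapidity (c0 $ j)) (rapidity (c1 $ j)) \<alpha> \<beta> \<tau>
      (b $ j $ 1) (b $ j $ 2) (x $ j $ 1) (x $ j $ 2))"
proof -
  define q where "q j = exp (2 * of_real pi * \<i> * of_real (x $ j $ 1 * x $ j $ 2) * \<tau>)" for j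
  define e where "e j = cis2pi (x $ j $ 1 * b $ j $ 2 + x $ j $ 2 * b $ j $ 1)" for j
  define J where "J j \<alpha> \<beta> = complex_of_real (block_integral (rapidity (c0 $ j)) (rapidity (c1 $ j)) \<alpha> \<beta>
    (sqrt (Im \<tau>) * x $ j $ 1) (sqrt (Im \<tau>) * x $ j $ 2))" for j \<alpha> \<beta>
  have "exp (2 * of_real pi * \<i> * of_real (Qm x) * \<tau>) = (\<Prod>j\<in>UNIV. q j)"
    by (simp add: q_def Qm_def Q1_def exp_sum[symmetric] sum_distrib_left sum_distrib_right)
  moreover have "exp (2 * of_real pi * \<i> * of_real (Bm x b)) = (\<Prod>j\<in>UNIV. e j)"
    by (simp add: e_def exp_Bm_eq_prod_cis2pi)
  moreover have "p_op d c0 c1 (block_polynomial d coef) (sqrt (Im \<tau>) *\<^sub>R x) = block_sum d coef J"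
    by (simp add: p_op_eq_block_sum_block_integral[OF harmonic c] J_def[abs_def])
  ultimately have "of_real (Im \<tau> powr (- real d / 2)) * theta_term d c0 c1 b (block_polynomial d coef) \<tau> x =
      (\<Prod>j\<in>UNIV. q j * e j) * of_real (1 / sqrt (Im \<tau>)) ^ d * block_sum d coef J"
    unfolding powr_minus_half[OF v] by (simp add: theta_term_def prod.distrib)
  also have "\<dots> = block_sum d coef (\<lambda>j \<alpha> \<beta>. q j * e j * of_real (1 / sqrt (Im \<tau>)) ^ (\<alpha> + \<beta>) * J j \<alpha> \<beta>)"
    by (rule block_sum_cmult[symmetric])
  also have "\<dots> = block_sum d coef (\<lambda>j \<alpha> \<beta>. theta_block_term (rapidity (c0 $ j)) (rapidity (c1 $ j)) \<alpha> \<beta> \<tau>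
      (b $ j $ 1) (b $ j $ 2) (x $ j $ 1) (x $ j $ 2))"
    by (rule block_sum_cong) (simp add: theta_block_term_def q_def e_def J_def power_one_over)
  finally show ?thesis .
qed

lemma
  assumes harmonic: "\<And>x. laplacian (block_polynomial d coef) x = 0"
    and c: "\<And>j. c0 $ j \<in> cone_C" "\<And>j. c1 $ j \<in> cone_C"
    and v: "Im \<tau> > 0"
  shows theta_term_abs_summable:
      "(\<lambda>x. norm (theta_term d c0 c1 b (block_polynomial d coef) \<tau> x)) summable_on shifted_lattice a"
    and theta_eq_block_sum: "theta d c0 c1 a b (block_polynomial d coef) \<tau> =
      block_sum d coef (\<lambda>j \<alpha> \<beta>. theta_block (rapidity (c0 $ j)) (rapidity (c1 $ j)) \<alpha> \<beta> \<tau>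
        (a $ j $ 1) (a $ j $ 2) (b $ j $ 1) (b $ j $ 2))"
proof -
  let ?term = "theta_term d c0 c1 b (block_polynomial d coef) \<tau>"
  define w where "w = complex_of_real (Im \<tau> powr (- real d / 2))"
  define g where "g \<alpha> j q = theta_block_term (rapidity (c0 $ j)) (rapidity (c1 $ j))
      (\<alpha> $ j $ 1) (\<alpha> $ j $ 2) \<tau> (b $ j $ 1) (b $ j $ 2)
      (a $ j $ 1 + of_int (fst q)) (a $ j $ 2 + of_int (snd q))"
    for \<alpha> :: "nat^2^'a" and j q
  have "w \<noteq> 0"
    using v by (simp add: w_def)
  have expand: "w * ?term (lattice_point a p) =
      (\<Sum>\<alpha>\<in>multi_indices d. coef \<alpha> * (\<Prod>j\<in>UNIV. g \<alpha> j (p j)))" for p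
    unfolding w_def theta_term_eq_block_sum[OF harmonic c v] by (simp add: block_sum_def g_def)
  have "((\<lambda>p. w * ?term (lattice_point a p)) has_sum
      (\<Sum>\<alpha>\<in>multi_indices d. coef \<alpha> * (\<Prod>j\<in>UNIV. \<Sum>\<^sub>\<infinity>q. g \<alpha> j q))) UNIV"
    unfolding expand g_def
    by (intro has_sum_sum finite_multi_indices has_sum_cmult_right has_sum_prod_UNIV
        cauchy_dominated_imp_abs_summable cauchy_dominated_theta_block_term v)
  then have has_sum: "((\<lambda>x. w * ?term x) has_sum
      (\<Sum>\<alpha>\<in>multi_indices d. coef \<alpha> * (\<Prod>j\<in>UNIV. \<Sum>\<^sub>\<infinity>q. g \<alpha> j q))) (shifted_lattice a)"
    by (subst (asm) has_sum_reindex_bij_betw[OF bij_betw_lattice_point])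
  then have "?term summable_on shifted_lattice a"
    using summable_on_cmult_right'[OF \<open>w \<noteq> 0\<close>] by (auto simp: summable_on_def)
  then show "(\<lambda>x. norm (?term x)) summable_on shifted_lattice a"
    using summable_on_iff_abs_summable_on_complex by blast
  show "theta d c0 c1 a b (block_polynomial d coef) \<tau> =
      block_sum d coef (\<lambda>j \<alpha> \<beta>. theta_block (rapidity (c0 $ j)) (rapidity (c1 $ j)) \<alpha> \<beta> \<tau>
        (a $ j $ 1) (a $ j $ 2) (b $ j $ 1) (b $ j $ 2))"
    using infsumI[OF has_sum]
    by (simp add: theta_def w_def infsum_cmult_right' block_sum_def theta_block_def lattice_sum_def g_def)
qed

theorem theorem2p6:
  fixes c0 c1 a b :: "real^2^'m"
    and f :: "real^2^'m \<Rightarrow> complex"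
    and d :: nat
    and \<tau> :: complex
  assumes "\<forall>j. c0 $ j \<in> cone_C"
    and "\<forall>j. c1 $ j \<in> cone_C"
    and "spherical_polynomial d f"
    and "Im \<tau> > 0"
  shows "(\<lambda>x. norm (theta_term d c0 c1 b f \<tau> x)) summable_on shifted_lattice a
     \<and> theta d c0 c1 a b f (- 1 / \<tau>) =
         (- \<tau>) ^ (CARD('m) + d) * exp (2 * of_real pi * \<i> * of_real (Bm a b)) *
         theta d c0 c1 (- b) a f \<tau>"
proof -
  obtain coef where f: "f = block_polynomial d coef"
    using assms(3) by (auto simp: spherical_polynomial_def homogeneous_polynomial_iff)
  have harmonic: "laplacian (block_polynomial d coef) x = 0" for x
    using assms(3) by (simp add: spherical_polynomial_def f)
  have c: "c0 $ j \<in> cone_C" "c1 $ j \<in> cone_C" for j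
    using assms(1,2) by auto
  let ?u = "\<lambda>j. - \<tau> * cis2pi (a $ j $ 1 * b $ j $ 2 + a $ j $ 2 * b $ j $ 1)"
  let ?\<theta> = "\<lambda>j \<alpha> \<beta>. theta_block (rapidity (c0 $ j)) (rapidity (c1 $ j)) \<alpha> \<beta> \<tau>
    (- (b $ j $ 1)) (- (b $ j $ 2)) (a $ j $ 1) (a $ j $ 2)"
  have "theta d c0 c1 a b f (- 1 / \<tau>) = block_sum d coef (\<lambda>j \<alpha> \<beta>. ?u j * (- \<tau>) ^ (\<alpha> + \<beta>) * ?\<theta> j \<alpha> \<beta>)"
    unfolding f theta_eq_block_sum[OF harmonic c Im_inversion_pos[OF assms(4)]]
      theta_block_inversion[OF assms(4)] power_Suc by (simp only: mult_ac)
  also have "\<dots> = (\<Prod>j\<in>UNIV. ?u j) * (- \<tau>) ^ d * block_sum d coef ?\<theta>"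
    by (rule block_sum_cmult)
  also have "block_sum d coef ?\<theta> = theta d c0 c1 (- b) a f \<tau>"
    by (simp add: f theta_eq_block_sum[OF harmonic c assms(4)])
  also have "(\<Prod>j\<in>UNIV. ?u j) = (- \<tau>) ^ CARD('m) * exp (2 * of_real pi * \<i> * of_real (Bm a b))"
    by (simp only: exp_Bm_eq_prod_cis2pi prod.distrib prod_constant)
  finally show ?thesis
    using theta_term_abs_summable[OF harmonic c assms(4)] by (simp add: f power_add mult_ac)
qed

end
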